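(* For every $\gamma>0$ there exist $c>0$ and $n_0>0$ such that the following holds. If $(\mathcal H,\phi)$ is an $n$-vertex colored $3$-graph with $2\mid n$, $n\ge n_0$, $\delta_1(\mathcal H)\ge (7/16+\gamma)n^2/2$ and $\Delta_1(\mathcal H_i)\le cn^2$ for every $i\in\mathbb N$, then $(\mathcal H,\phi)$ contains a properly colored loose Hamilton cycle $C_n^{(3)}(1)$.
   Context: A $3$-graph is a $3$-uniform hypergraph. A colored hypergraph is a pair $(\mathcal H,\phi)$ where $\phi:\mathcal H\to\mathbb N$ colors the edges; $\mathcal H_i=\{e\in\mathcal H:\phi(e)=i\}$. For $S\subseteq V(\mathcal H)$, $\deg(S)$ is the number of edges containing $S$; $\delta_s(\mathcal H)=\min\{\deg(S):|S|=s\}$, $\Delta_s(\mathcal H)=\max\{\deg(S):|S|=s\}$. A loose cycle $C_n^{(3)}(1)$ is an $n$-vertex $3$-graph whose vertices can be cyclically ordered so that each edge consists of $3$ consecutive vertices and consecutive edges share exactly one vertex; a Hamilton cycle is a spanning one. A hypergraph is properly colored if every two intersecting edges receive different colors. *)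

theory Defs
  imports Complex_Main
begin

text \<open>A hypergraph is given by its vertex set \<open>V\<close> and its edge set \<open>E\<close>.  An edge coloring is a
  total function \<open>\<phi>\<close> on vertex sets, of which only the values on \<open>E\<close> are relevant.\<close>

definition uniform_hypergraph :: "nat \<Rightarrow> 'a set \<Rightarrow> 'a set set \<Rightarrow> bool" where
  "uniform_hypergraph k V E \<longleftrightarrow> finite V \<and> (\<forall>e\<in>E. e \<subseteq> V \<and> card e = k)"

definition deg :: "'a set set \<Rightarrow> 'a set \<Rightarrow> nat" where
  "deg E S = card {e \<in> E. S \<subseteq> e}"

text \<open>The minimum and maximum \<open>s\<close>-degree.  For finite \<open>V\<close>, the set of degrees is nonempty exactly
  if \<open>s \<le> card V\<close>; otherwise \<open>Min\<close> and \<open>Max\<close> carry no information.\<close>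

definition min_deg :: "nat \<Rightarrow> 'a set \<Rightarrow> 'a set set \<Rightarrow> nat" where
  "min_deg s V E = Min (deg E ` {S. S \<subseteq> V \<and> card S = s})"

definition max_deg :: "nat \<Rightarrow> 'a set \<Rightarrow> 'a set set \<Rightarrow> nat" where
  "max_deg s V E = Max (deg E ` {S. S \<subseteq> V \<and> card S = s})"

definition color_class :: "'a set set \<Rightarrow> ('a set \<Rightarrow> nat) \<Rightarrow> nat \<Rightarrow> 'a set set" where
  "color_class E \<phi> i = {e \<in> E. \<phi> e = i}"

definition properly_colored :: "'a set set \<Rightarrow> ('a set \<Rightarrow> nat) \<Rightarrow> bool" where
  "properly_colored E \<phi> \<longleftrightarrow> (\<forall>e\<in>E. \<forall>f\<in>E. e \<noteq> f \<and> e \<inter> f \<noteq> {} \<longrightarrow> \<phi> e \<noteq> \<phi> f)"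

text \<open>For a cyclic ordering \<open>v 0, \<dots>, v (n - 1)\<close>, the three consecutive vertices starting at
  position \<open>i\<close>.\<close>

definition consecutive3 :: "nat \<Rightarrow> (nat \<Rightarrow> 'a) \<Rightarrow> nat \<Rightarrow> 'a set" where
  "consecutive3 n v i = {v (i mod n), v ((i + 1) mod n), v ((i + 2) mod n)}"

text \<open>\<open>(V, C)\<close> is a loose cycle.  Two successive blocks of three vertices share exactly one vertex
  if the second starts two positions after the first, so the \<open>m\<close> edges start at the even positions
  of a cyclic ordering of \<open>2 * m\<close> vertices.  The conditions on cardinalities are automatic for
  \<open>m \<ge> 3\<close>, and exclude the degenerate orderings of length \<open>2\<close> and \<open>4\<close>.\<close>

definition loose_cycle :: "'a set \<Rightarrow> 'a set set \<Rightarrow> bool" where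
  "loose_cycle V C \<longleftrightarrow>
     (\<exists>m v. m > 0 \<and> bij_betw v {..<2 * m} V \<and>
        C = (\<lambda>i. consecutive3 (2 * m) v (2 * i)) ` {..<m} \<and>
        (\<forall>i<m. card (consecutive3 (2 * m) v (2 * i)) = 3 \<and>
           card (consecutive3 (2 * m) v (2 * i) \<inter> consecutive3 (2 * m) v (2 * (i + 1))) = 1))"

text \<open>Spanning means that the vertex set of the cycle is all of \<open>V\<close>.\<close>

definition loose_Hamilton_cycle :: "'a set \<Rightarrow> 'a set set \<Rightarrow> 'a set set \<Rightarrow> bool" where
  "loose_Hamilton_cycle V E C \<longleftrightarrow> C \<subseteq> E \<and> loose_cycle V C"

end

theory Submission
  imports Defs "HOL-Real_Asymp.Real_Asymp" "HOL-Library.Multiset"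
begin

text \<open>
  The proof is by absorption, with every random choice derandomized, so that neither a regularity
  lemma nor linear programming duality is used.

  Tiling.  For weights \<open>w \<ge> 0\<close> with average \<open>\<mu>\<close>, the link of a vertex \<open>x\<close> of nearly minimal weight has
  density above \<open>7/16\<close>.  By the fractional Erdos-Gallai bound it cannot be covered by fractional vertex
  weights of total less than \<open>n/4\<close>, and this forces a positive density of edges \<open>yxz\<close> with
  \<open>2 w(x) + w(y) + w(z) \<le> (4 + \<epsilon>) \<mu>\<close>.  A loose path of \<open>t\<close> such edges with \<open>x\<close> always in the middle has
  average weight at most about \<open>\<mu>\<close>.  Removing such paths greedily, with weights given by the gradient of
  \<open>\<Sum> exp (- \<kappa> d(u))\<close> for the relative degrees \<open>d(u)\<close>, keeps all relative degrees above \<open>7/16\<close> until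
  almost everything is covered.

  Absorbing.  Any two vertices \<open>x\<close>, \<open>z\<close> are exchangeable in many ways: there are edges \<open>spt\<close>, \<open>tzr\<close>, \<open>pxr\<close>,
  and both \<open>s p t z r\<close> and \<open>s t p x r\<close> are loose paths.  Moreover \<open>y\<close> and a suitable \<open>z\<close> can be
  inserted together into a path \<open>a y1 z1 y2 b\<close>, giving \<open>a z1 y1 z y y2 b\<close>.  Composing the two gadgets
  absorbs an arbitrary pair \<open>(x, y)\<close>.  Further end edges make the end colors of all gadgets
  independent of the pair that is absorbed.

  Connecting.  Two vertices are joined by many paths of three edges.  Paths of two edges would not do: all
  edges through a pair may have the same color.  On a path of three edges, of any two consecutive ones
  one still has two free vertices when the other is fixed, so that color clashes are rare.
\<close>

section \<open>Loose walks and links\<close>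

text \<open>The threshold 7/16 = 1 - (3/4)^2 is a space barrier: a loose Hamilton cycle has n/2
  edges and each vertex lies on at most two of them, so there is none if fewer than n/4 vertices
  meet all edges. Only the tiling is tight at this density; connecting and absorbing leave room and
  are proved for 7/16 without the surplus \<gamma>. The tiling uses relative degrees because
  removing vertices of average weight leaves them unchanged to first order: the lost pairs are
  offset by the smaller square in the denominator. There are about \<eta> n absorbers, while the
  reservoir and the part missed by the tiling are of order \<zeta> n. Only a tiny proportion of the
  absorbers fits a given pair, so \<zeta> is far below \<eta>. The tiling paths are long compared
  with 1/\<zeta>, so that few connectors are needed, and c is chosen last. Absorbers take pairs
  because a closed loose walk has an even number of vertices, so for even n the leftover is
  even.\<close>

fun edges :: "'a list \<Rightarrow> 'a set list" where
  "edges (a # b # c # xs) = {a, b, c} # edges (c # xs)"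
| "edges _ = []"

lemma edges_append: "even (length xs) \<Longrightarrow> edges (xs @ c # ys) = edges (xs @ [c]) @ edges (c # ys)"
proof (induction xs rule: edges.induct)
  case (1 a b d xs)
  then show ?case by (cases xs) auto
qed (auto)

lemma length_edges: "length (edges xs) = (length xs - 1) div 2"
  by (induction xs rule: edges.induct) auto

lemma edges_nth: "2 * i + 2 < length xs \<Longrightarrow> edges xs ! i = {xs ! (2 * i), xs ! (2 * i + 1), xs ! (2 * i + 2)}"
proof (induction xs arbitrary: i rule: edges.induct)
  case (1 a b c xs)
  show ?case
  proof (cases i)
    case (Suc k)
    then have "edges (c # xs) ! k = {(c # xs) ! (2 * k), (c # xs) ! (2 * k + 1), (c # xs) ! (2 * k + 2)}"
      using 1 by auto
    then show ?thesis using Suc by simp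
  qed simp
qed auto

text \<open>A loose path is a vertex list of odd length whose even positions are the joints. Only
  successive edges of a loose path meet, so properness is a condition on neighbours in the list of
  edges. Distinctness of the vertices is kept apart: walks are joined first, and disjointness is
  checked once on whole concatenations.\<close>

definition proper_walk :: "'a set set \<Rightarrow> ('a set \<Rightarrow> nat) \<Rightarrow> 'a list \<Rightarrow> bool" where
  "proper_walk E \<phi> xs \<longleftrightarrow> odd (length xs) \<and> set (edges xs) \<subseteq> E \<and>
     successively (\<lambda>e f. \<phi> e \<noteq> \<phi> f) (edges xs)"

lemma proper_walk_snoc:
  assumes "proper_walk E \<phi> xs" "{last xs, a, b} \<in> E"
    "edges xs \<noteq> [] \<Longrightarrow> \<phi> (last (edges xs)) \<noteq> \<phi> {last xs, a, b}"
  shows "proper_walk E \<phi> (xs @ [a, b])" "edges (xs @ [a, b]) = edges xs @ [{last xs, a, b}]"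
proof -
  have ne: "xs \<noteq> []" using assms(1) by (auto simp: proper_walk_def)
  have ev: "even (length (butlast xs))" using assms(1) by (auto simp: proper_walk_def)
  have "xs @ [a, b] = butlast xs @ last xs # [a, b]" using ne by simp
  then have "edges (xs @ [a, b]) = edges (butlast xs @ [last xs]) @ edges [last xs, a, b]"
    using edges_append[OF ev] by metis
  then show *: "edges (xs @ [a, b]) = edges xs @ [{last xs, a, b}]" using ne by simp
  show "proper_walk E \<phi> (xs @ [a, b])"
    using assms unfolding proper_walk_def * by (auto simp: successively_append_iff)
qed

text \<open>Ordered pairs: over the whole vertex set of a 3-graph the cardinality is twice the
  degree of \<open>u\<close>, which turns n^2/2 in the degree condition into n^2.\<close>

definition link :: "'a set set \<Rightarrow> 'a set \<Rightarrow> 'a \<Rightarrow> ('a \<times> 'a) set" where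
  "link E R u = {(a, b). a \<in> R \<and> b \<in> R \<and> {u, a, b} \<in> E}"

definition color_link :: "'a set set \<Rightarrow> ('a set \<Rightarrow> nat) \<Rightarrow> 'a set \<Rightarrow> 'a \<Rightarrow> nat \<Rightarrow> ('a \<times> 'a) set" where
  "color_link E \<phi> R u i = {(a, b). a \<in> R \<and> b \<in> R \<and> {u, a, b} \<in> E \<and> \<phi> {u, a, b} = i}"

lemma link_subset: "link E R u \<subseteq> R \<times> R" by (auto simp: link_def)
lemma color_link_subset: "color_link E \<phi> R u i \<subseteq> R \<times> R" by (auto simp: color_link_def)
lemma finite_link: "finite R \<Longrightarrow> finite (link E R u)"
  by (rule finite_subset[OF link_subset]) auto
lemma finite_color_link: "finite R \<Longrightarrow> finite (color_link E \<phi> R u i)"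
  by (rule finite_subset[OF color_link_subset]) auto

lemma card3_distinct:
  assumes "card {a, b, c} = 3"
  shows "a \<noteq> b" "a \<noteq> c" "b \<noteq> c"
  using assms by (auto simp: card_insert_if split: if_splits)

definition codeg_on :: "'a set set \<Rightarrow> 'a set \<Rightarrow> 'a \<Rightarrow> 'a \<Rightarrow> nat" where
  "codeg_on E R u a = card {b \<in> R. {u, a, b} \<in> E}"

lemma sum_codeg_on:
  assumes "finite R" "A \<subseteq> R"
  shows "(\<Sum>a\<in>A. codeg_on E R u a) = card {(a, b) \<in> link E R u. a \<in> A}"
proof -
  have "(\<Sum>a\<in>A. codeg_on E R u a) = card (SIGMA a:A. {b \<in> R. {u, a, b} \<in> E})"
    unfolding codeg_on_def using assms by (intro card_SigmaI[symmetric]) (auto intro: finite_subset)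
  also have "(SIGMA a:A. {b \<in> R. {u, a, b} \<in> E}) = {(a, b) \<in> link E R u. a \<in> A}"
    using assms by (auto simp: link_def)
  finally show ?thesis .
qed

section \<open>A light path for every weight function\<close>

text \<open>\<open>Z\<close> maximizes the number of triples with both ends in \<open>Z\<close>
  minus 2 \<eta> N^2 for every vertex of \<open>Z\<close>. Deleting \<open>y\<close> loses, by
  symmetry, at most twice the triples that start at \<open>y\<close>, so maximality bounds their
  number from below. The middle vertex is not confined to \<open>Z\<close>: only the ends of an edge
  become joints from which a path is continued.\<close>

lemma min_degree_subset:
  fixes T :: "('a \<times> 'a \<times> 'a) set" and \<eta> N :: real
  assumes fin: "finite R" and TR: "T \<subseteq> R \<times> R \<times> R"
    and sym: "\<And>y x z. (y, x, z) \<in> T \<Longrightarrow> (z, x, y) \<in> T"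
    and big: "real (card T) > 2 * \<eta> * N\<^sup>2 * real (card R)"
  obtains Z where "Z \<subseteq> R" "Z \<noteq> {}"
    "\<And>y. y \<in> Z \<Longrightarrow> real (card {(x, z). z \<in> Z \<and> (y, x, z) \<in> T}) \<ge> \<eta> * N\<^sup>2"
proof -
  define e where "e Z = {(y, x, z) \<in> T. y \<in> Z \<and> z \<in> Z}" for Z
  define g where "g Z = real (card (e Z)) - 2 * \<eta> * N\<^sup>2 * real (card Z)" for Z
  have finT: "finite T" using fin TR by (meson finite_SigmaI finite_subset)
  have fine: "finite (e Z)" for Z using finT by (auto simp: e_def intro: finite_subset[of _ T])
  have fp: "finite (g ` Pow R)" "g ` Pow R \<noteq> {}" using fin by auto
  obtain Z where "Z \<in> Pow R" "Max (g ` Pow R) = g Z" using Max_in[OF fp] by blast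
  then have Z: "Z \<in> Pow R" "\<And>Y. Y \<in> Pow R \<Longrightarrow> g Y \<le> g Z"
    using Max_ge[OF fp(1)] by (blast, metis imageI)
  have eR: "e R = T" using TR by (auto simp: e_def)
  have "g R > 0" using big by (simp add: g_def eR)
  then have gZ: "g Z > 0" using Z(2)[of R] by auto
  have "e {} = {}" by (auto simp: e_def)
  then have "Z \<noteq> {}" using gZ by (auto simp: g_def)
  moreover have "real (card {(x, z). z \<in> Z \<and> (y, x, z) \<in> T}) \<ge> \<eta> * N\<^sup>2" if y: "y \<in> Z" for y
  proof -
    let ?D = "{(x, z). z \<in> Z \<and> (y, x, z) \<in> T}"
    have "?D \<subseteq> snd ` T"
    proof safe
      fix a b assume "(y, a, b) \<in> T"
      then have "snd (y, a, b) \<in> snd ` T" by (rule imageI)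
      then show "(a, b) \<in> snd ` T" by simp
    qed
    then have finD: "finite ?D" using finT by (meson finite_imageI finite_subset)
    have "e Z \<subseteq> e (Z - {y}) \<union> ((\<lambda>(x, z). (y, x, z)) ` ?D \<union> (\<lambda>(x, z). (z, x, y)) ` ?D)"
    proof
      fix q assume q: "q \<in> e Z"
      obtain a b d where abd: "q = (a, b, d)" by (cases q)
      then have *: "(a, b, d) \<in> T" "a \<in> Z" "d \<in> Z" "(d, b, a) \<in> T" using q sym by (auto simp: e_def)
      consider "a \<noteq> y \<and> d \<noteq> y" | "a = y" | "d = y" by blast
      then show "q \<in> e (Z - {y}) \<union> ((\<lambda>(x, z). (y, x, z)) ` ?D \<union> (\<lambda>(x, z). (z, x, y)) ` ?D)"
      proof cases
        case 1 then show ?thesis using * abd by (simp add: e_def)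
      next
        case 2 then have "q = (\<lambda>(x, z). (y, x, z)) (b, d)" "(b, d) \<in> ?D" using * abd by auto
        then show ?thesis by blast
      next
        case 3 then have "q = (\<lambda>(x, z). (z, x, y)) (b, a)" "(b, a) \<in> ?D" using * abd by auto
        then show ?thesis by blast
      qed
    qed
    then have "card (e Z) \<le> card (e (Z - {y}) \<union> ((\<lambda>(x, z). (y, x, z)) ` ?D \<union> (\<lambda>(x, z). (z, x, y)) ` ?D))"
      using fine finD by (intro card_mono) auto
    also have "\<dots> \<le> card (e (Z - {y})) + (card ?D + card ?D)"
      by (rule order_trans[OF card_Un_le add_left_mono[OF order_trans[OF card_Un_le add_mono[OF card_image_le[OF finD] card_image_le[OF finD]]]]])
    finally have 1: "real (card (e Z)) \<le> real (card (e (Z - {y}))) + 2 * real (card ?D)" by linarith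
    have 2: "g (Z - {y}) \<le> g Z" using Z(1) by (intro Z(2)) auto
    have "finite Z" using Z(1) fin by (auto intro: finite_subset)
    then have "card Z = Suc (card (Z - {y}))" using y by (metis card.remove)
    then have "real (card Z) = real (card (Z - {y})) + 1" by simp
    then show ?thesis using 1 2 by (simp add: g_def algebra_simps)
  qed
  ultimately show thesis using that Z(1) by auto
qed

text \<open>The path grows greedily with its last vertex in \<open>Z\<close>; forbidden are only one
  color and the pairs that meet the path. Summing \<open>wt\<close> over the t edges counts every
  middle vertex and every inner joint twice, but the two ends of the path once. These weigh at most
  \<theta> each, whence t + 2 instead of t.\<close>

lemma dense_path:
  fixes T :: "('a \<times> 'a \<times> 'a) set" and \<eta> c :: real
  assumes fin: "finite R" and TR: "T \<subseteq> R \<times> R \<times> R"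
    and E3: "\<And>e. e \<in> E \<Longrightarrow> card e = 3"
    and TE: "\<And>y x z. (y, x, z) \<in> T \<Longrightarrow> {y, x, z} \<in> E"
    and sym: "\<And>y x z. (y, x, z) \<in> T \<Longrightarrow> (z, x, y) \<in> T"
    and wt: "\<And>y x z. (y, x, z) \<in> T \<Longrightarrow> 2 * w x + w y + w z \<le> (\<theta>::real)"
    and w0: "\<And>x. x \<in> R \<Longrightarrow> w x \<ge> 0"
    and big: "real (card T) > 2 * \<eta> * (real (card R)) ^ 3"
    and col: "\<And>u i. u \<in> R \<Longrightarrow> real (card (color_link E \<phi> R u i)) \<le> c * (real (card R))\<^sup>2"
    and large: "c * (real (card R))\<^sup>2 + 2 * (2 * real t + 1) * real (card R) < \<eta> * (real (card R))\<^sup>2"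
    and t1: "t \<ge> 1"
  shows "\<exists>xs. proper_walk E \<phi> xs \<and> distinct xs \<and> length xs = 2 * t + 1 \<and> set xs \<subseteq> R \<and>
            (\<Sum>x\<in>set xs. w x) \<le> (real t + 2) * \<theta> / 2"
proof -
  have big': "real (card T) > 2 * \<eta> * (real (card R))\<^sup>2 * real (card R)"
    using big by (simp add: power3_eq_cube power2_eq_square mult.assoc)
  obtain Z where Z: "Z \<subseteq> R" "Z \<noteq> {}"
    "\<And>y. y \<in> Z \<Longrightarrow> real (card {(x, z). z \<in> Z \<and> (y, x, z) \<in> T}) \<ge> \<eta> * (real (card R))\<^sup>2"
    using min_degree_subset[OF fin TR sym big'] by blast
  have "\<exists>xs. proper_walk E \<phi> xs \<and> distinct xs \<and> length xs = 2 * k + 1 \<and> set xs \<subseteq> R \<and> last xs \<in> Z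
     \<and> 2 * (\<Sum>x\<in>set xs. w x) \<le> real k * \<theta> + w (hd xs) + w (last xs) \<and> (k \<ge> 1 \<longrightarrow> w (last xs) \<le> \<theta> \<and> w (hd xs) \<le> \<theta>)" if "k \<le> t" for k
    using that
  proof (induction k)
    case 0
    obtain z where "z \<in> Z" using Z(2) by auto
    then show ?case using Z(1) by (intro exI[of _ "[z]"]) (auto simp: proper_walk_def)
  next
    case (Suc k)
    then obtain xs where xs: "proper_walk E \<phi> xs" "distinct xs" "length xs = 2 * k + 1" "set xs \<subseteq> R" "last xs \<in> Z"
       "2 * (\<Sum>x\<in>set xs. w x) \<le> real k * \<theta> + w (hd xs) + w (last xs)"
       "k \<ge> 1 \<Longrightarrow> w (last xs) \<le> \<theta> \<and> w (hd xs) \<le> \<theta>" by auto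
    have ne: "xs \<noteq> []" using xs(3) by auto
    let ?y = "last xs"
    let ?i = "\<phi> (last (edges xs))"
    let ?D = "{(x, z). z \<in> Z \<and> (?y, x, z) \<in> T}"
    let ?B = "color_link E \<phi> R ?y ?i \<union> (set xs \<times> R \<union> R \<times> set xs)"
    have "\<not> ?D \<subseteq> ?B"
    proof
      assume "?D \<subseteq> ?B"
      then have "card ?D \<le> card ?B" using fin by (intro card_mono) (auto simp: finite_color_link)
      also have "\<dots> \<le> card (color_link E \<phi> R ?y ?i) + (card (set xs \<times> R) + card (R \<times> set xs))"
        by (meson add_mono card_Un_le le_refl order_trans)
      also have "card (set xs \<times> R) + card (R \<times> set xs) = 2 * (2 * k + 1) * card R"
        using xs by (simp add: card_cartesian_product distinct_card)
      finally have "real (card ?D) \<le> real (card (color_link E \<phi> R ?y ?i) + 2 * (2 * k + 1) * card R)"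
        using of_nat_mono by blast
      also have "\<dots> = real (card (color_link E \<phi> R ?y ?i)) + 2 * (2 * real k + 1) * real (card R)" by (simp add: algebra_simps)
      also have "\<dots> \<le> c * (real (card R))\<^sup>2 + 2 * (2 * real t + 1) * real (card R)"
        using xs Z(1) Suc.prems by (intro add_mono col mult_right_mono) auto
      also have "\<dots> < \<eta> * (real (card R))\<^sup>2" by (rule large)
      finally show False using Z(3)[OF xs(5)] by linarith
    qed
    then obtain x z where xz: "z \<in> Z" "(?y, x, z) \<in> T" "(x, z) \<notin> ?B" by auto
    have R: "x \<in> R" "z \<in> R" "?y \<in> R" using TR xz by auto
    have E: "{?y, x, z} \<in> E" using TE xz by auto
    have d: "x \<notin> set xs" "z \<notin> set xs" "x \<noteq> z"
      using xz R card3_distinct[OF E3[OF E]] by auto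
    have c: "?i \<noteq> \<phi> {?y, x, z}" using xz R E by (auto simp: color_link_def)
    have w: "2 * w x + w ?y + w z \<le> \<theta>" using wt xz by auto
    have w3: "w x \<ge> 0" "w ?y \<ge> 0" "w z \<ge> 0" using w0 R by auto
    have "proper_walk E \<phi> (xs @ [x, z])" using proper_walk_snoc(1)[OF xs(1) E] c by auto
    moreover have "2 * (\<Sum>v\<in>set (xs @ [x, z]). w v) \<le> real (Suc k) * \<theta> + w (hd (xs @ [x,z])) + w (last (xs @ [x,z]))"
      using d xs(6) w ne by (simp add: algebra_simps)
    moreover have "w (hd (xs @ [x,z])) \<le> \<theta>"
    proof (cases "k \<ge> 1")
      case False
      then have "length xs = 1" using xs(3) by simp
      then have "hd xs = last xs" by (cases xs) auto
      then show ?thesis using w w3 ne by auto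
    qed (use xs(7) ne in auto)
    moreover have "w (last (xs @ [x,z])) \<le> \<theta>" using w w3 by auto
    ultimately show ?case using xs d R xz by (intro exI[of _ "xs @ [x, z]"]) auto
  qed
  from this[of t] t1 obtain xs where xs: "proper_walk E \<phi> xs" "distinct xs" "length xs = 2 * t + 1" "set xs \<subseteq> R"
       "2 * (\<Sum>x\<in>set xs. w x) \<le> real t * \<theta> + w (hd xs) + w (last xs)"
       "w (last xs) \<le> \<theta>" "w (hd xs) \<le> \<theta>" by auto
  then have "(\<Sum>x\<in>set xs. w x) \<le> (real t + 2) * \<theta> / 2" by (simp add: field_simps)
  then show ?thesis using xs by auto
qed

text \<open>The origin of 7/16 = 1 - 9/16 in the tiling. \<open>I\<close> and \<open>J\<close> are
  the sizes of two nested initial segments B \<subseteq> A of the vertices sorted by weight, and the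
  left side is the size of A \<times> B \<union> B \<times> A. The worst case is I = J =
  3N/4.\<close>

lemma two_corner_area:
  fixes I J N :: real
  assumes "0 \<le> J" "J \<le> I" "I \<le> N" "I + J \<ge> 3 * N / 2"
  shows "2 * I * J - J\<^sup>2 \<ge> 9 / 16 * N\<^sup>2"
proof (cases "J \<ge> 3 * N / 4")
  case True
  have "J * J \<le> I * J" using assms by (intro mult_right_mono) auto
  moreover have "(3 * N / 4) * (3 * N / 4) \<le> J * J" using True assms by (intro mult_mono) auto
  ultimately show ?thesis by (simp add: power2_eq_square)
next
  case False
  have "0 \<le> (4 * J - N) * (3 * N - 4 * J)" using False assms by (intro mult_nonneg_nonneg) auto
  moreover have "(3 * N - 2 * J) * J \<le> (2 * I) * J" using assms by (intro mult_right_mono) auto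
  ultimately show ?thesis by (simp add: power2_eq_square algebra_simps)
qed

text \<open>With the vertices sorted by weight, the two indices come from pairing the heaviest \<open>K\<close>
  vertices with each other; if no such pair were light, the total weight would be too large.\<close>

lemma light_pair_index:
  fixes W :: "nat \<Rightarrow> real"
  assumes mono: "\<And>i j. i \<le> j \<Longrightarrow> j < N \<Longrightarrow> W i \<le> W j"
    and W0: "\<And>i. i < N \<Longrightarrow> W i \<ge> 0"
    and tot: "(\<Sum>i<N. W i) = real N * \<mu>"
    and eps: "0 < \<epsilon>" "\<epsilon> \<le> 1" and D: "1 \<le> D" "real D + 1 \<le> \<epsilon> * real N / 2" and K: "K = (N + 1) div 2"
  obtains i j where "j \<le> i" "i < N" "i + j = 2 * N - K - 1"
    "2 * W (D - 1) + W i + W j \<le> 4 * (1 + \<epsilon>) * \<mu>"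
proof -
  define a where "a = W (D - 1)"
  define \<theta> where "\<theta> = 4 * (1 + \<epsilon>) * \<mu>"
  have "\<epsilon> * real N \<le> real N" using eps by (intro mult_left_le_one_le) auto
  then have "2 * (real D + 1) \<le> real N" using D(2) by argo
  then have "real (2 * (D + 1)) \<le> real N" by simp
  then have D2: "2 * (D + 1) \<le> N" by (simp only: of_nat_le_iff)
  then have K2: "2 * K \<le> N + 1" "N \<le> 2 * K" "K \<le> N" "D \<le> N - K" "1 \<le> K" using K by auto
  have a0: "a \<ge> 0" unfolding a_def using D2 by (intro W0) auto
  have high: "real (m - D) * a \<le> (\<Sum>i\<in>{D..<m}. W i)" if "m \<le> N" for m
  proof -
    have "(\<Sum>i\<in>{D..<m}. a) \<le> (\<Sum>i\<in>{D..<m}. W i)"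
      unfolding a_def using that D2 by (intro sum_mono mono) auto
    then show ?thesis by simp
  qed
  \<comment> \<open>The K heaviest indices are paired by reflection, so the two indices always add
    up to 2N - K - 1. With K about N/2, the corresponding initial segments have sizes whose sum is
    at least 3N/2.\<close>
  have ev: "\<exists>k<K. 2 * a + W (N - 1 - k) + W (N - K + k) \<le> \<theta>"
  proof (rule ccontr)
    assume "\<not> ?thesis"
    then have "\<And>k. k < K \<Longrightarrow> \<theta> < 2 * a + W (N - 1 - k) + W (N - K + k)" by force
    then have "(\<Sum>k<K. \<theta>) < (\<Sum>k<K. 2 * a + W (N - 1 - k) + W (N - K + k))"
      using K2 by (intro sum_strict_mono) (auto simp: lessThan_empty_iff)
    also have "\<dots> = real K * (2 * a) + (\<Sum>k<K. W (N - 1 - k)) + (\<Sum>k<K. W (N - K + k))"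
      by (simp add: sum.distrib)
    also have "(\<Sum>k<K. W (N - 1 - k)) = (\<Sum>i\<in>{N-K..<N}. W i)"
      by (rule sum.reindex_bij_witness[of _ "\<lambda>i. N - 1 - i" "\<lambda>k. N - 1 - k"]) (use K2 in auto)
    also have "(\<Sum>k<K. W (N - K + k)) = (\<Sum>i\<in>{N-K..<N}. W i)"
      by (rule sum.reindex_bij_witness[of _ "\<lambda>i. i - (N - K)" "\<lambda>k. N - K + k"]) (use K2 in auto)
    finally have 1: "real K * \<theta> < 2 * (real K * a) + 2 * (\<Sum>i\<in>{N-K..<N}. W i)" by simp
    have "(\<Sum>i<N. W i) = (\<Sum>i\<in>{..<D}. W i) + (\<Sum>i\<in>{D..<N-K}. W i) + (\<Sum>i\<in>{N-K..<N}. W i)"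
      using K2 by (simp add: lessThan_atLeast0 sum.atLeastLessThan_concat)
    moreover have "(\<Sum>i\<in>{..<D}. W i) \<ge> 0" using K2 by (intro sum_nonneg W0) auto
    moreover have "real (N - K - D) * a \<le> (\<Sum>i\<in>{D..<N-K}. W i)" by (rule high) simp
    moreover have "real (N - K - D) = real N - real K - real D" using K2 by auto
    ultimately have 2: "real N * \<mu> > (real N - real K - real D) * a + real K * \<theta> / 2 - real K * a"
      using 1 tot by (simp add: algebra_simps)
    have "(\<Sum>i<N. W i) \<ge> 0" by (intro sum_nonneg W0) auto
    then have mu0: "\<mu> \<ge> 0" using tot D2 by (simp add: zero_le_mult_iff)
    have "(\<Sum>i\<in>{D..<N}. W i) \<le> (\<Sum>i<N. W i)" by (intro sum_mono2) (auto intro: W0)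
    then have "real (N - D) * a \<le> real N * \<mu>" using high[of N] tot by simp
    \<comment> \<open>At least half of the vertices weigh at least \<open>a\<close>, so
      \<open>a\<close> is at most twice the average. This bounds the error made by neglecting the D
      lightest vertices.\<close>
    moreover have "real N / 2 * a \<le> real (N - D) * a" using D2 a0 by (intro mult_right_mono) auto
    ultimately have "real N * a \<le> real N * (2 * \<mu>)" by simp
    then have a2: "a \<le> 2 * \<mu>" using D2 by simp
    have "(real D + 1) * a \<le> (\<epsilon> * real N / 2) * (2 * \<mu>)"
      using D a2 a0 mu0 eps by (intro mult_mono) auto
    moreover have "real N / 2 * (\<theta> / 2) \<le> real K * (\<theta> / 2)"
      using K2 mu0 eps by (intro mult_right_mono) (auto simp: \<theta>_def)
    moreover have "(real N - 2 * real K) * a \<ge> (-1) * a"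
      using K2 a0 by (intro mult_right_mono) auto
    ultimately show False using 2 unfolding \<theta>_def by argo
  qed
  then obtain k where k: "k < K" "2 * a + W (N - 1 - k) + W (N - K + k) \<le> \<theta>" by auto
  show thesis
  proof (cases "N - K + k \<le> N - 1 - k")
    case True
    show ?thesis by (rule that[of "N - K + k" "N - 1 - k"]) (use True k K2 in \<open>auto simp: a_def \<theta>_def\<close>)
  next
    case False
    show ?thesis by (rule that[of "N - 1 - k" "N - K + k"]) (use False k K2 in \<open>auto simp: a_def \<theta>_def\<close>)
  qed
qed

text \<open>\<open>?G\<close> fills 9/16 of all pairs and a link fills 7/16 + \<gamma>, so they
  share at least \<gamma> N^2 pairs, and each of these completes a light triple. Admitting about
  \<epsilon> N / 4 lightest vertices as \<open>x\<close>, instead of a single one, makes the number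
  of triples cubic at the cost of the factor 1 + \<epsilon>.\<close>

lemma many_light_triples:
  fixes w :: "'a \<Rightarrow> real" and \<gamma> \<epsilon> :: real
  assumes fin: "finite R"
    and w0: "\<And>x. x \<in> R \<Longrightarrow> w x \<ge> 0"
    and deg: "\<And>u. u \<in> R \<Longrightarrow> real (card (link E R u)) \<ge> (7 / 16 + \<gamma>) * (real (card R))\<^sup>2"
    and eps: "0 < \<epsilon>" "\<epsilon> \<le> 1" and gam: "0 < \<gamma>" and large: "real (card R) \<ge> 8 / \<epsilon>"
    and mu: "\<mu> = (\<Sum>x\<in>R. w x) / real (card R)"
  shows "real (card {(y, x, z). y \<in> R \<and> x \<in> R \<and> z \<in> R \<and> {y, x, z} \<in> E \<and>
     2 * w x + w y + w z \<le> 4 * (1 + \<epsilon>) * \<mu>}) \<ge> \<epsilon> * \<gamma> / 8 * (real (card R)) ^ 3"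
    (is "real (card ?T) \<ge> _")
proof -
  define N where "N = card R"
  define \<theta> where "\<theta> = 4 * (1 + \<epsilon>) * \<mu>"
  define D where "D = nat \<lfloor>\<epsilon> * real N / 4\<rfloor>"
  have N8: "\<epsilon> * real N \<ge> 8" using large eps by (simp add: N_def field_simps)
  then have Npos: "N > 0" by (auto intro: gr0I)
  have D: "real D \<le> \<epsilon> * real N / 4" "real D > \<epsilon> * real N / 4 - 1"
    using N8 unfolding D_def by (auto simp: of_nat_nat) linarith+
  define xs where "xs = sort_key w (SOME l. set l = R \<and> distinct l)"
  have "set (SOME l. set l = R \<and> distinct l) = R \<and> distinct (SOME l. set l = R \<and> distinct l)"
    using finite_distinct_list[OF fin] by (rule someI_ex)
  then have xs: "set xs = R" "distinct xs" "sorted (map w xs)" by (auto simp: xs_def)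
  have len: "length xs = N" using xs distinct_card N_def by metis
  define W where "W i = w (xs ! i)" for i
  have mono: "W i \<le> W j" if "i \<le> j" "j < N" for i j
    using sorted_nth_mono[OF xs(3), of i j] that len by (simp add: W_def)
  have "(\<Sum>i<N. W i) = (\<Sum>x\<in>R. w x)"
    unfolding W_def using xs len by (intro sum.reindex_bij_betw bij_betw_nth) auto
  then have tot: "(\<Sum>i<N. W i) = real N * \<mu>" using Npos by (simp add: mu N_def)
  have W0: "W i \<ge> 0" if "i < N" for i
    unfolding W_def using that xs len by (intro w0) (metis nth_mem)
  have D1: "1 \<le> D" "real D + 1 \<le> \<epsilon> * real N / 2" using D N8 by linarith+
  obtain i j where ij: "j \<le> i" "i < N" "i + j = 2 * N - (N + 1) div 2 - 1"
    "2 * W (D - 1) + W i + W j \<le> \<theta>"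
    using light_pair_index[OF mono W0 tot eps D1 refl] unfolding \<theta>_def by blast
  define A where "A = set (take (Suc i) xs)"
  define B where "B = set (take (Suc j) xs)"
  define S where "S = set (take D xs)"
  have "\<epsilon> * real N \<le> 1 * real N" using eps by (intro mult_right_mono) auto
  then have DN: "D \<le> N" using D1 by linarith
  have card: "card A = Suc i" "card B = Suc j" "card S = D"
    using ij xs len DN by (auto simp: A_def B_def S_def distinct_card)
  have sub: "B \<subseteq> A" "A \<subseteq> R" "S \<subseteq> R"
    using ij xs by (auto simp: A_def B_def S_def intro: set_take_subset_set_take[THEN subsetD] dest: in_set_takeD)
  have wle: "w x \<le> W k" if x: "x \<in> set (take (Suc k) xs)" and k: "k < N" for x k
  proof -
    obtain l where "l < length (take (Suc k) xs)" "take (Suc k) xs ! l = x"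
      using x by (meson in_set_conv_nth)
    then show ?thesis using mono[of l k] k by (auto simp: W_def)
  qed
  have finAB: "finite A" "finite B" "finite S" by (auto simp: A_def B_def S_def)
  let ?G = "A \<times> B \<union> B \<times> A"
  have "card (A \<times> B \<union> B \<times> A) + card (A \<times> B \<inter> B \<times> A) = card (A \<times> B) + card (B \<times> A)"
    using finAB by (intro card_Un_Int[symmetric]) auto
  moreover have "A \<times> B \<inter> B \<times> A = B \<times> B" using sub by auto
  ultimately have "card ?G + Suc j * Suc j = 2 * (Suc i * Suc j)"
    using card by (simp add: card_cartesian_product)
  then have "real (card ?G) + real (Suc j) * real (Suc j) = 2 * (real (Suc i) * real (Suc j))"
    by (metis of_nat_add of_nat_mult of_nat_numeral)
  then have cG: "real (card ?G) = 2 * real (Suc i) * real (Suc j) - (real (Suc j))\<^sup>2"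
    by (simp add: power2_eq_square algebra_simps)
  have G916: "real (card ?G) \<ge> 9 / 16 * (real N)\<^sup>2"
    unfolding cG by (rule two_corner_area) (use ij in auto)
  have each: "real (card (link E R x \<inter> ?G)) \<ge> \<gamma> * (real N)\<^sup>2" if "x \<in> S" for x
  proof -
    have "card (link E R x) + card ?G = card (link E R x \<union> ?G) + card (link E R x \<inter> ?G)"
      using fin finAB by (intro card_Un_Int) (auto simp: finite_link)
    moreover have "card (link E R x \<union> ?G) \<le> card (R \<times> R)"
      using fin sub link_subset[of E R x] by (intro card_mono) auto
    ultimately have "card (link E R x) + card ?G \<le> N * N + card (link E R x \<inter> ?G)"
      by (simp add: card_cartesian_product N_def)
    then have "real (card (link E R x) + card ?G) \<le> real (N * N + card (link E R x \<inter> ?G))" by linarith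
    moreover have "real (card (link E R x)) \<ge> (7 / 16 + \<gamma>) * (real N)\<^sup>2"
      using deg that sub unfolding N_def by auto
    ultimately show ?thesis using G916 by (simp add: power2_eq_square algebra_simps)
  qed
  let ?P = "SIGMA x:S. link E R x \<inter> ?G"
  have PT: "(y, x, z) \<in> ?T" if x: "x \<in> S" and yz: "(y, z) \<in> link E R x" "(y, z) \<in> ?G" for x y z
  proof -
    have "x \<in> set (take (Suc (D - 1)) xs)" using x D1 by (simp add: S_def)
    then have wx: "w x \<le> W (D - 1)" using DN D1 by (intro wle) auto
    have "y \<in> A \<and> z \<in> B \<or> y \<in> B \<and> z \<in> A" using yz by auto
    then have "w y \<le> W i \<and> w z \<le> W j \<or> w z \<le> W i \<and> w y \<le> W j"
      using wle ij by (auto simp: A_def B_def)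
    then have "2 * w x + w y + w z \<le> 4 * (1 + \<epsilon>) * \<mu>" using wx ij(4) \<theta>_def by argo
    then show ?thesis using x yz sub by (auto simp: link_def insert_commute)
  qed
  have "(\<lambda>(x, y, z). (y, x, z)) ` ?P \<subseteq> ?T"
  proof (intro subsetI, elim imageE)
    fix q p assume p: "p \<in> ?P" "q = (\<lambda>(x, y, z). (y, x, z)) p"
    obtain x y z where xyz: "p = (x, y, z)" by (cases p)
    have "x \<in> S" "(y, z) \<in> link E R x \<inter> ?G" using p(1) unfolding xyz by (simp_all only: mem_Sigma_iff)
    then have "(y, x, z) \<in> ?T" by (intro PT) (simp_all only: Int_iff)
    moreover have "q = (y, x, z)" using p(2) xyz by simp
    ultimately show "q \<in> ?T" by (simp only:)
  qed
  moreover have finT: "finite ?T"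
    by (rule finite_subset[of _ "R \<times> R \<times> R"]) (use fin in auto)
  ultimately have "card ((\<lambda>(x, y, z). (y, x, z)) ` ?P) \<le> card ?T" by (intro card_mono)
  moreover have "card ((\<lambda>(x, y, z). (y, x, z)) ` ?P) = card ?P"
    by (intro card_image) (auto simp: inj_on_def)
  moreover have "card ?P = (\<Sum>x\<in>S. card (link E R x \<inter> ?G))"
    using finAB by (intro card_SigmaI) auto
  ultimately have "(\<Sum>x\<in>S. card (link E R x \<inter> ?G)) \<le> card ?T" by argo
  then have "real (\<Sum>x\<in>S. card (link E R x \<inter> ?G)) \<le> real (card ?T)" by (simp only: of_nat_le_iff)
  then have "real (card ?T) \<ge> (\<Sum>x\<in>S. real (card (link E R x \<inter> ?G)))" by (simp only: of_nat_sum)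
  moreover have "(\<Sum>x\<in>S. real (card (link E R x \<inter> ?G))) \<ge> (\<Sum>x\<in>S. \<gamma> * (real N)\<^sup>2)"
    by (intro sum_mono each)
  moreover have "(\<Sum>x\<in>S. \<gamma> * (real N)\<^sup>2) = real D * (\<gamma> * (real N)\<^sup>2)" using card by simp
  moreover have "real D * (\<gamma> * (real N)\<^sup>2) \<ge> (\<epsilon> * real N / 8) * (\<gamma> * (real N)\<^sup>2)"
    using D N8 gam by (intro mult_right_mono) auto
  ultimately have "real (card ?T) \<ge> (\<epsilon> * real N / 8) * (\<gamma> * (real N)\<^sup>2)" by linarith
  then show ?thesis by (simp add: N_def power2_eq_square power3_eq_cube algebra_simps)
qed

text \<open>The factor 2 (t + 2) exceeds the number 2t + 1 of vertices by only 3, so a long path has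
  average weight hardly above the average over \<open>R\<close>.\<close>

lemma light_path:
  fixes w :: "'a \<Rightarrow> real" and \<gamma> \<epsilon> c :: real
  assumes fin: "finite R" and E3: "\<And>e. e \<in> E \<Longrightarrow> card e = 3"
    and w0: "\<And>x. x \<in> R \<Longrightarrow> w x \<ge> 0"
    and deg: "\<And>u. u \<in> R \<Longrightarrow> real (card (link E R u)) \<ge> (7 / 16 + \<gamma>) * (real (card R))\<^sup>2"
    and col: "\<And>u i. u \<in> R \<Longrightarrow> real (card (color_link E \<phi> R u i)) \<le> c * (real (card R))\<^sup>2"
    and eps: "0 < \<epsilon>" "\<epsilon> \<le> 1" and gam: "0 < \<gamma>" and t1: "t \<ge> 1"
    and c: "c \<le> \<epsilon> * \<gamma> / 40" and large: "real (card R) > 40 * (4 * real t + 2) / (\<epsilon> * \<gamma>)" "real (card R) \<ge> 8 / \<epsilon>"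
  shows "\<exists>xs. proper_walk E \<phi> xs \<and> distinct xs \<and> length xs = 2 * t + 1 \<and> set xs \<subseteq> R \<and>
            (\<Sum>x\<in>set xs. w x) \<le> 2 * (real t + 2) * (1 + \<epsilon>) * ((\<Sum>x\<in>R. w x) / real (card R))"
proof -
  define \<mu> where "\<mu> = (\<Sum>x\<in>R. w x) / real (card R)"
  define N where "N = real (card R)"
  let ?T = "{(y, x, z). y \<in> R \<and> x \<in> R \<and> z \<in> R \<and> {y, x, z} \<in> E \<and>
     2 * w x + w y + w z \<le> 4 * (1 + \<epsilon>) * \<mu>}"
  have eg: "\<epsilon> * \<gamma> > 0" using eps gam by simp
  have "40 * (4 * real t + 2) / (\<epsilon> * \<gamma>) > 0" using eg by (intro divide_pos_pos) auto
  then have Npos: "N > 0" using large unfolding N_def by linarith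
  have "real (card ?T) \<ge> \<epsilon> * \<gamma> / 8 * N ^ 3"
    unfolding N_def by (rule many_light_triples[OF fin w0 deg eps gam large(2) \<mu>_def])
  moreover have "\<epsilon> * \<gamma> / 8 * N ^ 3 > 2 * (\<epsilon> * \<gamma> / 20) * N ^ 3"
    using eg Npos by (intro mult_strict_right_mono) auto
  ultimately have big: "real (card ?T) > 2 * (\<epsilon> * \<gamma> / 20) * N ^ 3" by linarith
  have "40 * (4 * real t + 2) < N * (\<epsilon> * \<gamma>)"
    using large(1) eg by (simp add: N_def pos_divide_less_eq)
  then have "40 * (4 * real t + 2) * N < N * (\<epsilon> * \<gamma>) * N" using Npos by (intro mult_strict_right_mono)
  then have "2 * (2 * real t + 1) * N < (\<epsilon> * \<gamma> / 40) * N\<^sup>2" by (simp add: power2_eq_square algebra_simps)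
  moreover have "c * N\<^sup>2 \<le> (\<epsilon> * \<gamma> / 40) * N\<^sup>2" using c by (intro mult_right_mono) auto
  ultimately have l: "c * N\<^sup>2 + 2 * (2 * real t + 1) * N < (\<epsilon> * \<gamma> / 20) * N\<^sup>2" by linarith
  have "\<exists>xs. proper_walk E \<phi> xs \<and> distinct xs \<and> length xs = 2 * t + 1 \<and> set xs \<subseteq> R \<and>
            (\<Sum>x\<in>set xs. w x) \<le> (real t + 2) * (4 * (1 + \<epsilon>) * \<mu>) / 2"
    by (rule dense_path[where T = ?T and w = w and c = c and \<eta> = "\<epsilon> * \<gamma> / 20", OF fin _ E3 _ _ _ w0 big[unfolded N_def] col l[unfolded N_def] t1])
      (auto simp: insert_commute)
  moreover have "(real t + 2) * (4 * (1 + \<epsilon>) * \<mu>) / 2 = 2 * (real t + 2) * (1 + \<epsilon>) * \<mu>" by (simp add: algebra_simps)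
  ultimately show ?thesis unfolding \<mu>_def by metis
qed

section \<open>Tiling with long properly colored paths\<close>

definition density :: "'a set set \<Rightarrow> 'a set \<Rightarrow> 'a \<Rightarrow> real" where
  "density E R u = real (card (link E R u)) / (real (card R))\<^sup>2"

text \<open>A pessimistic estimator for the lowest relative degree: a vertex of relative degree \<open>d\<close> alone
  contributes \<open>exp (- \<kappa> d)\<close>.  Up to scaling, \<open>loss_weight\<close> below is the first-order effect on the
  potential of the pairs that the removal of a vertex takes from the links.\<close>

definition potential :: "real \<Rightarrow> 'a set set \<Rightarrow> 'a set \<Rightarrow> real" where
  "potential \<kappa> E R = (\<Sum>u\<in>R. exp (- \<kappa> * density E R u))"

definition loss_weight :: "real \<Rightarrow> 'a set set \<Rightarrow> 'a set \<Rightarrow> 'a \<Rightarrow> real" where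
  "loss_weight \<kappa> E R a = (\<Sum>u\<in>R. exp (- \<kappa> * density E R u) * real (codeg_on E R u a))"

lemma card_link_diff:
  assumes fin: "finite R" and T: "T \<subseteq> R"
  shows "card (link E R u) \<le> card (link E (R - T) u) + 2 * (\<Sum>a\<in>T. codeg_on E R u a)"
proof -
  let ?A = "{(a, b) \<in> link E R u. a \<in> T}" and ?B = "{(a, b) \<in> link E R u. b \<in> T}"
  have finA: "finite ?A" by (rule finite_subset[OF _ finite_link[OF fin, of E u]]) auto
  have B: "?B = prod.swap ` ?A"
    by (auto simp: link_def insert_commute image_iff)
  have "link E R u \<subseteq> link E (R - T) u \<union> (?A \<union> ?B)" by (auto simp: link_def)
  then have "card (link E R u) \<le> card (link E (R - T) u \<union> (?A \<union> ?B))"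
    using finA B fin by (intro card_mono) (auto simp: finite_link)
  also have "\<dots> \<le> card (link E (R - T) u) + (card ?A + card ?B)"
    by (rule order_trans[OF card_Un_le add_left_mono[OF card_Un_le]])
  also have "card ?B = card ?A" unfolding B by (rule card_image) auto
  finally show ?thesis using sum_codeg_on[OF fin T, of E u] by simp
qed

lemma density_bounds:
  assumes "finite R"
  shows "density E R u \<le> 1" "density E R u \<ge> 0"
proof -
  have "card (link E R u) \<le> card (R \<times> R)" using assms by (intro card_mono link_subset) auto
  then have "real (card (link E R u)) \<le> real (card R * card R)" by (simp only: card_cartesian_product of_nat_le_iff)
  then show "density E R u \<le> 1" by (cases "card R = 0") (auto simp: density_def power2_eq_square)
qed (simp add: density_def)

lemma exp_le_quadratic:
  fixes y :: real
  assumes "\<bar>y\<bar> \<le> 1"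
  shows "exp y \<le> 1 + y + y\<^sup>2"
proof (cases "y \<ge> 0")
  case True
  then show ?thesis using exp_bound[of y] assms by simp
next
  case False
  define z where "z = - y"
  have z: "0 < z" "z \<le> 1" using False assms by (auto simp: z_def)
  have "1 + z + z\<^sup>2 / 2 \<le> exp z" using exp_lower_Taylor_quadratic[of z] z by simp
  moreover have "(1 + z + z\<^sup>2 / 2) * (1 - z + z\<^sup>2) \<ge> 1"
  proof -
    have "(1 + z + z\<^sup>2 / 2) * (1 - z + z\<^sup>2) = 1 + z * z / 2 + z * z * z / 2 + z * z * z * z / 2"
      by (simp add: power2_eq_square field_simps)
    then show ?thesis using z by simp
  qed
  moreover have "1 - z + z\<^sup>2 > 0" using z by (smt (verit) zero_less_power)
  ultimately have "exp z * (1 - z + z\<^sup>2) \<ge> 1" by (smt (verit) mult_right_mono)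
  then have "exp (- z) \<le> 1 - z + z\<^sup>2" by (simp add: exp_minus field_simps)
  then show ?thesis by (simp add: z_def)
qed

text \<open>Two effects nearly cancel. Removing \<open>T\<close> takes at most \<open>D\<close>
  pairs from the link, but it also shrinks the normalizing square by the factor (1 - x)^2, which
  raises the density by about 2x times itself. \<open>h\<close> is the balance; 1 + 2x and 1 + 3x
  enclose 1/(1 - x)^2, and each is used where it errs on the safe side.\<close>

lemma density_diff:
  fixes E :: "'a set set" and u :: 'a
  assumes fin: "finite R" and T: "T \<subseteq> R" "card T = p" and N: "N = real (card R)"
    and x: "x = real p / N" "x \<le> 1 / 10" and p: "p \<ge> 1"
  defines "D \<equiv> 2 * (\<Sum>a\<in>T. real (codeg_on E R u a))"
  defines "h \<equiv> D / N\<^sup>2 * (1 + 3 * x) - 2 * x * density E R u"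
  shows "density E (R - T) u \<ge> density E R u - h" "\<bar>h\<bar> \<le> 3 * x"
proof -
  have "card T \<le> card R" using fin T(1) by (intro card_mono)
  then have N1: "N \<ge> 1" using T(2) p N by simp
  have x0: "x > 0" using x p N1 by simp
  have cardR': "real (card (R - T)) = N * (1 - x)"
  proof -
    have "card (R - T) = card R - card T" using fin T by (intro card_Diff_subset) (auto intro: finite_subset)
    then have "real (card (R - T)) = N - real p" using T(2) N \<open>card T \<le> card R\<close> by simp
    then show ?thesis using N1 x by (simp add: field_simps)
  qed
  have D0: "D \<ge> 0" unfolding D_def by (simp add: sum_nonneg)
  have "codeg_on E R u a \<le> card R" for a unfolding codeg_on_def using fin by (intro card_mono) auto
  then have "(\<Sum>a\<in>T. real (codeg_on E R u a)) \<le> (\<Sum>a\<in>T. N)" by (intro sum_mono) (simp add: N)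
  then have "D \<le> 2 * real p * N" using T(2) by (simp add: D_def)
  moreover have "real p = x * N" using x N1 by simp
  ultimately have "D \<le> 2 * (x * N) * N" by metis
  then have DN: "D / N\<^sup>2 \<le> 2 * x" using N1 by (simp add: power2_eq_square field_simps)
  have d1: "density E R u \<le> 1" "density E R u \<ge> 0" using density_bounds[OF fin] by auto
  have "real (card (link E R u)) \<le> real (card (link E (R - T) u) + 2 * (\<Sum>a\<in>T. codeg_on E R u a))"
    using card_link_diff[OF fin T(1)] of_nat_mono by blast
  then have L: "real (card (link E (R - T) u)) \<ge> real (card (link E R u)) - D" by (simp add: D_def)
  have q: "(1 - x)\<^sup>2 > 0" "1 / (1 - x)\<^sup>2 \<ge> 1 + 2 * x" "1 / (1 - x)\<^sup>2 \<le> 1 + 3 * x"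
  proof -
    show q0: "(1 - x)\<^sup>2 > 0" using x by auto
    have "(1 + 2 * x) * (1 - x)\<^sup>2 = 1 - x * x * (3 - 2 * x)" by (simp add: power2_eq_square algebra_simps)
    moreover have "x * x * (3 - 2 * x) \<ge> 0" using x(2) x0 by (intro mult_nonneg_nonneg) auto
    ultimately show "1 / (1 - x)\<^sup>2 \<ge> 1 + 2 * x" using q0 by (simp add: field_simps)
    have "(1 + 3 * x) * (1 - x)\<^sup>2 = 1 + x * (1 - 5 * x + 3 * (x * x))" by (simp add: power2_eq_square algebra_simps)
    moreover have "x * (1 - 5 * x + 3 * (x * x)) \<ge> 0" using x(2) x0 by (intro mult_nonneg_nonneg add_nonneg_nonneg) auto
    ultimately show "1 / (1 - x)\<^sup>2 \<le> 1 + 3 * x" using q0 by (simp add: field_simps)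
  qed
  have "density E (R - T) u = real (card (link E (R - T) u)) / (N * (1 - x))\<^sup>2"
    by (simp add: density_def cardR')
  also have "\<dots> = (real (card (link E (R - T) u)) / N\<^sup>2) * (1 / (1 - x)\<^sup>2)" by (simp add: power_mult_distrib)
  also have "\<dots> \<ge> ((real (card (link E R u)) - D) / N\<^sup>2) * (1 / (1 - x)\<^sup>2)"
    using L q by (intro mult_right_mono divide_right_mono) auto
  also have "((real (card (link E R u)) - D) / N\<^sup>2) * (1 / (1 - x)\<^sup>2) =
      density E R u * (1 / (1 - x)\<^sup>2) - D / N\<^sup>2 * (1 / (1 - x)\<^sup>2)"
    unfolding density_def N by (simp add: diff_divide_distrib left_diff_distrib)
  finally have "density E (R - T) u \<ge> density E R u * (1 / (1 - x)\<^sup>2) - D / N\<^sup>2 * (1 / (1 - x)\<^sup>2)" .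
  moreover have "density E R u * (1 / (1 - x)\<^sup>2) \<ge> density E R u * (1 + 2 * x)"
    using d1 q by (intro mult_left_mono) auto
  moreover have "D / N\<^sup>2 * (1 / (1 - x)\<^sup>2) \<le> D / N\<^sup>2 * (1 + 3 * x)"
    using D0 q by (intro mult_left_mono) auto
  ultimately show "density E (R - T) u \<ge> density E R u - h" by (simp add: h_def algebra_simps)
  have "D / N\<^sup>2 * (1 + 3 * x) \<le> 2 * x * (3 / 2)" using DN x x0 D0 by (intro mult_mono) auto
  moreover have "D / N\<^sup>2 * (1 + 3 * x) \<ge> 0" using D0 x0 by simp
  moreover have "2 * x * density E R u \<le> 2 * x * 1" using d1 x0 by (intro mult_left_mono) auto
  moreover have "2 * x * density E R u \<ge> 0" using d1 x0 by simp
  ultimately show "\<bar>h\<bar> \<le> 3 * x" unfolding h_def abs_le_iff using x0 by argo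
qed

text \<open>By \<open>light\<close>, the \<psi>-weighted loss of pairs is at most 2 (1 + \<epsilon>)
  x M after division by N^2, while the renormalization returns 2 x M. The first-order terms cancel
  up to \<epsilon>, so the exponent consists of a term with \<epsilon> and one quadratic in \<kappa>
  x.\<close>

lemma potential_diff:
  assumes fin: "finite R" and T: "T \<subseteq> R" "card T = p" and N: "N = real (card R)"
    and x: "x = real p / N" "x \<le> 1 / 10" and p: "p \<ge> 1"
    and lam: "\<kappa> \<ge> 1" "3 * \<kappa> * x \<le> 1" and eps: "0 \<le> \<epsilon>" "\<epsilon> \<le> 1"
    and light: "(\<Sum>a\<in>T. loss_weight \<kappa> E R a) \<le> (1 + \<epsilon>) * x * (\<Sum>a\<in>R. loss_weight \<kappa> E R a)"
  shows "potential \<kappa> E (R - T) \<le> potential \<kappa> E R * exp (2 * \<kappa> * \<epsilon> * x + 21 * \<kappa>\<^sup>2 * x\<^sup>2)"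
proof -
  have "card T \<le> card R" using fin T(1) by (intro card_mono)
  then have N1: "N \<ge> 1" using T(2) p N by simp
  have x0: "x > 0" using x p N1 by simp
  define D where "D u = 2 * (\<Sum>a\<in>T. real (codeg_on E R u a))" for u
  define h where "h u = D u / N\<^sup>2 * (1 + 3 * x) - 2 * x * density E R u" for u
  define \<psi> where "\<psi> u = exp (- \<kappa> * density E R u)" for u
  define P where "P = potential \<kappa> E R"
  have P: "P = (\<Sum>u\<in>R. \<psi> u)" by (simp add: P_def potential_def \<psi>_def)
  have psi0: "\<psi> u > 0" for u by (simp add: \<psi>_def)
  have dd: "density E (R - T) u \<ge> density E R u - h u" "\<bar>h u\<bar> \<le> 3 * x" for u
    using density_diff[OF fin T N x p, of E u] by (auto simp: h_def D_def)
  have tm: "exp (- \<kappa> * density E (R - T) u) \<le> \<psi> u * (1 + \<kappa> * h u + 9 * \<kappa>\<^sup>2 * x\<^sup>2)" for u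
  proof -
    have "\<kappa> * (density E R u - h u) \<le> \<kappa> * density E (R - T) u" using dd lam by (intro mult_left_mono) auto
    then have "- \<kappa> * density E (R - T) u \<le> - \<kappa> * density E R u + \<kappa> * h u" by (simp add: algebra_simps)
    then have e1: "exp (- \<kappa> * density E (R - T) u) \<le> \<psi> u * exp (\<kappa> * h u)"
      unfolding \<psi>_def exp_add[symmetric] by simp
    have "\<bar>\<kappa> * h u\<bar> \<le> \<kappa> * (3 * x)" unfolding abs_mult using dd lam by (intro mult_mono) auto
    then have b: "\<bar>\<kappa> * h u\<bar> \<le> 3 * \<kappa> * x" by simp
    have "exp (\<kappa> * h u) \<le> 1 + \<kappa> * h u + (\<kappa> * h u)\<^sup>2" using b lam by (intro exp_le_quadratic) linarith
    also have "(\<kappa> * h u)\<^sup>2 \<le> (3 * \<kappa> * x)\<^sup>2" using b by (metis abs_ge_zero power2_abs power_mono)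
    also have "(3 * \<kappa> * x)\<^sup>2 = 9 * \<kappa>\<^sup>2 * x\<^sup>2" by (simp add: power_mult_distrib)
    finally have "exp (\<kappa> * h u) \<le> 1 + \<kappa> * h u + 9 * \<kappa>\<^sup>2 * x\<^sup>2" by simp
    then have "\<psi> u * exp (\<kappa> * h u) \<le> \<psi> u * (1 + \<kappa> * h u + 9 * \<kappa>\<^sup>2 * x\<^sup>2)"
      using psi0[of u] by (intro mult_left_mono) auto
    then show ?thesis using e1 by simp
  qed
  have "potential \<kappa> E (R - T) \<le> (\<Sum>u\<in>R. exp (- \<kappa> * density E (R - T) u))"
    unfolding potential_def using fin by (intro sum_mono2) auto
  also have "\<dots> \<le> (\<Sum>u\<in>R. \<psi> u * (1 + \<kappa> * h u + 9 * \<kappa>\<^sup>2 * x\<^sup>2))" by (intro sum_mono tm)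
  also have "\<dots> = P * (1 + 9 * \<kappa>\<^sup>2 * x\<^sup>2) + \<kappa> * (\<Sum>u\<in>R. \<psi> u * h u)"
    unfolding P sum_distrib_left sum_distrib_right sum.distrib[symmetric]
    by (intro sum.cong) (auto simp: algebra_simps)
  finally have 1: "potential \<kappa> E (R - T) \<le> P * (1 + 9 * \<kappa>\<^sup>2 * x\<^sup>2) + \<kappa> * (\<Sum>u\<in>R. \<psi> u * h u)" .
  define M where "M = (\<Sum>u\<in>R. \<psi> u * density E R u)"
  have "density E R u \<le> 1" for u using density_bounds[OF fin] by auto
  then have MP: "M \<le> P" unfolding M_def P using psi0 by (intro sum_mono) (simp add: less_imp_le)
  have M0: "M \<ge> 0" unfolding M_def density_def using psi0 by (intro sum_nonneg mult_nonneg_nonneg) (auto simp: less_imp_le)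
  \<comment> \<open>Double counting: the loss weights add up to the \<psi>-weighted sizes of all
    links, which makes their average comparable with the gain 2 x M.\<close>
  have tot: "(\<Sum>a\<in>R. loss_weight \<kappa> E R a) = N\<^sup>2 * M"
  proof -
    have "(\<Sum>a\<in>R. loss_weight \<kappa> E R a) = (\<Sum>u\<in>R. \<psi> u * (\<Sum>a\<in>R. real (codeg_on E R u a)))"
      unfolding loss_weight_def \<psi>_def sum_distrib_left by (rule sum.swap)
    also have "\<dots> = (\<Sum>u\<in>R. \<psi> u * real (card (link E R u)))"
    proof (intro sum.cong refl)
      fix u
      have "{(a, b) \<in> link E R u. a \<in> R} = link E R u" by (auto simp: link_def)
      then have "(\<Sum>a\<in>R. real (codeg_on E R u a)) = real (card (link E R u))"
        using sum_codeg_on[OF fin subset_refl, of E u] by (metis of_nat_sum)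
      then show "\<psi> u * (\<Sum>a\<in>R. real (codeg_on E R u a)) = \<psi> u * real (card (link E R u))" by simp
    qed
    also have "\<dots> = N\<^sup>2 * M" unfolding M_def sum_distrib_left density_def using N1 N by (intro sum.cong) auto
    finally show ?thesis .
  qed
  have "(\<Sum>u\<in>R. \<psi> u * D u) = 2 * (\<Sum>a\<in>T. loss_weight \<kappa> E R a)"
    unfolding loss_weight_def \<psi>_def[symmetric] D_def sum_distrib_left
    by (subst sum.swap) (auto intro!: sum.cong)
  also have "\<dots> \<le> 2 * ((1 + \<epsilon>) * x * (N\<^sup>2 * M))" using light tot by simp
  finally have D: "(\<Sum>u\<in>R. \<psi> u * D u) / N\<^sup>2 \<le> 2 * (1 + \<epsilon>) * x * M" using N1 by (simp add: field_simps)
  have "(\<Sum>u\<in>R. \<psi> u * h u) = (1 + 3 * x) * ((\<Sum>u\<in>R. \<psi> u * D u) / N\<^sup>2) - 2 * x * M"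
    unfolding h_def M_def sum_distrib_left sum_divide_distrib sum_subtractf[symmetric]
    by (intro sum.cong) (auto simp: algebra_simps add_divide_distrib)
  also have "\<dots> \<le> (1 + 3 * x) * (2 * (1 + \<epsilon>) * x * M) - 2 * x * M"
    using D x0 by (intro diff_right_mono mult_left_mono) auto
  also have "\<dots> = 2 * x * M * (\<epsilon> + 3 * x + 3 * x * \<epsilon>)" by (simp add: algebra_simps)
  also have "\<dots> \<le> 2 * x * P * (\<epsilon> + 6 * x)"
  proof (intro mult_mono)
    show "\<epsilon> + 3 * x + 3 * x * \<epsilon> \<le> \<epsilon> + 6 * x" using mult_left_mono[OF eps(2), of "3 * x"] x0 by simp
  qed (use MP M0 x0 eps in auto)
  finally have "\<kappa> * (\<Sum>u\<in>R. \<psi> u * h u) \<le> \<kappa> * (2 * x * P * (\<epsilon> + 6 * x))" using lam by (intro mult_left_mono) auto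
  then have "potential \<kappa> E (R - T) \<le> P * (1 + (2 * \<kappa> * \<epsilon> * x + 12 * \<kappa> * x\<^sup>2 + 9 * \<kappa>\<^sup>2 * x\<^sup>2))"
    using 1 by (simp add: algebra_simps power2_eq_square)
  also have "\<dots> \<le> P * (1 + (2 * \<kappa> * \<epsilon> * x + 21 * \<kappa>\<^sup>2 * x\<^sup>2))"
  proof -
    have "\<kappa> * x\<^sup>2 \<le> \<kappa>\<^sup>2 * x\<^sup>2" using lam by (intro mult_right_mono) (auto simp: power2_eq_square)
    then show ?thesis using MP M0 by (intro mult_left_mono) auto
  qed
  also have "\<dots> \<le> P * exp (2 * \<kappa> * \<epsilon> * x + 21 * \<kappa>\<^sup>2 * x\<^sup>2)"
    using MP M0 by (intro mult_left_mono exp_ge_add_one_self) auto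
  finally show ?thesis by (simp add: P_def)
qed


section \<open>Iterated removal of light paths\<close>

lemma color_link_mono: "R \<subseteq> R' \<Longrightarrow> color_link E \<phi> R u i \<subseteq> color_link E \<phi> R' u i"
  by (auto simp: color_link_def)

lemma tiling_step:
  fixes \<gamma> \<epsilon> \<kappa> c n :: real
  assumes fin: "finite R" and E3: "\<And>e. e \<in> E \<Longrightarrow> card e = 3"
    and deg: "\<And>u. u \<in> R \<Longrightarrow> density E R u \<ge> 7 / 16 + \<gamma>"
    and col: "\<And>u i. u \<in> R \<Longrightarrow> real (card (color_link E \<phi> R u i)) \<le> c * (real (card R))\<^sup>2"
    and eps: "0 < \<epsilon>" "\<epsilon> \<le> 1" and gam: "0 < \<gamma>" and t: "real t \<ge> 2 / \<epsilon>"
    and c: "c \<le> \<epsilon> * \<gamma> / 160" and large: "real (card R) > 160 * (4 * real t + 2) / (\<epsilon> * \<gamma>)" "real (card R) \<ge> 32 / \<epsilon>"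
    and x: "x = real (2 * t + 1) / real (card R)" "x \<le> 1 / 10"
    and kap: "\<kappa> \<ge> 1" "3 * \<kappa> * x \<le> 1"
  obtains xs where "proper_walk E \<phi> xs" "distinct xs" "length xs = 2 * t + 1" "set xs \<subseteq> R"
    "potential \<kappa> E (R - set xs) \<le> potential \<kappa> E R * exp (2 * \<kappa> * \<epsilon> * x + 21 * \<kappa>\<^sup>2 * x\<^sup>2)"
proof -
  have "2 / \<epsilon> > 0" using eps by simp
  then have t1: "t \<ge> 1" using t by linarith
  have "32 / \<epsilon> > 0" using eps by simp
  then have R0: "real (card R) > 0" using large by linarith
  have te: "real t * \<epsilon> \<ge> 2" using t eps by (simp add: field_simps)
  have w0: "loss_weight \<kappa> E R a \<ge> 0" for a unfolding loss_weight_def by (intro sum_nonneg) auto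
  have deg': "real (card (link E R u)) \<ge> (7 / 16 + \<gamma>) * (real (card R))\<^sup>2" if "u \<in> R" for u
    using deg[OF that] R0 by (simp add: density_def field_simps)
  have "c \<le> \<epsilon> / 4 * \<gamma> / 40" using c by simp
  moreover have "real (card R) > 40 * (4 * real t + 2) / (\<epsilon> / 4 * \<gamma>)" using large by (simp add: field_simps)
  moreover have "real (card R) \<ge> 8 / (\<epsilon> / 4)" using large by simp
  moreover have "0 < \<epsilon> / 4" "\<epsilon> / 4 \<le> 1" using eps by auto
  ultimately obtain xs where xs: "proper_walk E \<phi> xs" "distinct xs" "length xs = 2 * t + 1" "set xs \<subseteq> R"
     "(\<Sum>a\<in>set xs. loss_weight \<kappa> E R a) \<le>
        2 * (real t + 2) * (1 + \<epsilon> / 4) * ((\<Sum>a\<in>R. loss_weight \<kappa> E R a) / real (card R))"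
    using light_path[where w = "loss_weight \<kappa> E R" and \<epsilon> = "\<epsilon> / 4", OF fin E3 w0 deg' col _ _ gam t1] by blast
  \<comment> \<open>The right side exceeds the left by 3 \<epsilon> t / 2 - 3. This is the reason
    for t \<ge> 2/\<epsilon> and for applying \<open>light_path\<close> with \<epsilon>/4.\<close>
  have "2 * (real t + 2) * (1 + \<epsilon> / 4) \<le> (1 + \<epsilon>) * real (2 * t + 1)"
    using te eps by (simp add: algebra_simps)
  then have "2 * (real t + 2) * (1 + \<epsilon> / 4) * ((\<Sum>a\<in>R. loss_weight \<kappa> E R a) / real (card R))
     \<le> (1 + \<epsilon>) * real (2 * t + 1) * ((\<Sum>a\<in>R. loss_weight \<kappa> E R a) / real (card R))"
    using w0 by (intro mult_right_mono divide_nonneg_nonneg sum_nonneg) auto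
  also have "\<dots> = (1 + \<epsilon>) * x * (\<Sum>a\<in>R. loss_weight \<kappa> E R a)" by (simp add: x)
  finally have "(\<Sum>a\<in>set xs. loss_weight \<kappa> E R a) \<le> (1 + \<epsilon>) * x * (\<Sum>a\<in>R. loss_weight \<kappa> E R a)"
    using xs(5) by linarith
  moreover have "card (set xs) = 2 * t + 1" using xs distinct_card by metis
  ultimately have "potential \<kappa> E (R - set xs) \<le> potential \<kappa> E R * exp (2 * \<kappa> * \<epsilon> * x + 21 * \<kappa>\<^sup>2 * x\<^sup>2)"
    using eps kap x by (intro potential_diff[OF fin xs(4) _ refl]) auto
  then show thesis using that xs by blast
qed

lemma length_concat_const: "(\<And>P. P \<in> set Ps \<Longrightarrow> length P = p) \<Longrightarrow> length (concat Ps) = length Ps * p"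
  by (induction Ps) auto

text \<open>\<open>x\<close> is the proportion that one path would take from \<zeta> n vertices. At
  least that many are left in every round, so one exponent serves for all rounds. The factor
  \<zeta>^2 in the bound on \<open>c\<close> has the same origin: color degrees are bounded relative
  to \<open>R\<close>, but needed relative to what remains.\<close>

lemma tiling_iterate:
  fixes \<gamma> \<epsilon> \<zeta> \<kappa> c :: real
  assumes fin: "finite R" and E3: "\<And>e. e \<in> E \<Longrightarrow> card e = 3"
    and deg: "\<And>u. u \<in> R \<Longrightarrow> density E R u \<ge> 7 / 16 + \<gamma>"
    and n: "n = real (card R)" and p: "p = 2 * t + 1"
    and col: "\<And>u i. u \<in> R \<Longrightarrow> real (card (color_link E \<phi> R u i)) \<le> c * n\<^sup>2"
    and eps: "0 < \<epsilon>" "\<epsilon> \<le> 1" and zeta: "0 < \<zeta>" and gam: "0 < \<gamma>" and t: "real t \<ge> 2 / \<epsilon>"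
    and c: "c \<le> \<zeta>\<^sup>2 * (\<epsilon> * \<gamma> / 320)" and large: "\<zeta> * n > 320 * (4 * real t + 2) / (\<epsilon> * \<gamma>)" "\<zeta> * n \<ge> 32 / \<epsilon>"
    and x: "x = real p / (\<zeta> * n)" "x \<le> 1 / 10"
    and kap: "\<kappa> \<ge> 1" "3 * \<kappa> * x \<le> 1"
    and loss: "ln n / \<kappa> + n / real p * (2 * \<epsilon> * x + 21 * \<kappa> * x\<^sup>2) \<le> \<gamma> / 2"
    and k: "real (k * p) \<le> (1 - \<zeta>) * n"
  shows "\<exists>Ps. length Ps = k \<and> (\<forall>P\<in>set Ps. proper_walk E \<phi> P \<and> length P = p) \<and> distinct (concat Ps) \<and>
     set (concat Ps) \<subseteq> R \<and>
     potential \<kappa> E (R - set (concat Ps)) \<le> n * exp (- \<kappa> * (7 / 16 + \<gamma>)) * exp (real k * (2 * \<kappa> * \<epsilon> * x + 21 * \<kappa>\<^sup>2 * x\<^sup>2))"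
  using k
proof (induction k)
  case 0
  have "potential \<kappa> E R \<le> (\<Sum>u\<in>R. exp (- \<kappa> * (7 / 16 + \<gamma>)))"
    unfolding potential_def using deg kap by (intro sum_mono) simp
  then show ?case by (simp add: n)
next
  case (Suc k)
  define \<delta> where "\<delta> = 2 * \<kappa> * \<epsilon> * x + 21 * \<kappa>\<^sup>2 * x\<^sup>2"
  have "real (k * p) \<le> real (Suc k * p)" by simp
  then have kp: "real (k * p) \<le> (1 - \<zeta>) * n" using Suc.prems by linarith
  then obtain Ps where Ps: "length Ps = k" "\<And>P. P \<in> set Ps \<Longrightarrow> proper_walk E \<phi> P \<and> length P = p" "distinct (concat Ps)"
     "set (concat Ps) \<subseteq> R"
     "potential \<kappa> E (R - set (concat Ps)) \<le> n * exp (- \<kappa> * (7 / 16 + \<gamma>)) * exp (real k * \<delta>)"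
    using Suc.IH unfolding \<delta>_def by blast
  define Q where "Q = R - set (concat Ps)"
  have "length (concat Ps) = k * p"
    using Ps(1,2) length_concat_const by metis
  then have "card (set (concat Ps)) = k * p" using Ps(3) by (metis distinct_card)
  moreover have "card Q = card R - card (set (concat Ps))" unfolding Q_def using Ps(4) by (intro card_Diff_subset) auto
  moreover have "card (set (concat Ps)) \<le> card R" using Ps(4) fin by (intro card_mono)
  ultimately have cardQ: "real (card Q) = n - real (k * p)" using n by simp
  then have Qz: "real (card Q) \<ge> \<zeta> * n" using kp by (simp add: algebra_simps)
  have "320 * (4 * real t + 2) / (\<epsilon> * \<gamma>) > 0" using eps gam by (intro divide_pos_pos) auto
  then have zn0: "\<zeta> * n > 0" using large by linarith
  then have n0: "n > 0" using zeta by (simp add: zero_less_mult_iff)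
  have Q0: "real (card Q) > 0" using Qz zn0 by linarith
  have p1: "p \<ge> 1" using p by simp
  have x0: "x > 0" using x(1) zn0 p1 by simp
  have delta0: "\<delta> \<ge> 0" unfolding \<delta>_def using kap eps x0 by (intro add_nonneg_nonneg mult_nonneg_nonneg) auto
  have finQ: "finite Q" using fin by (simp add: Q_def)
  have QR: "Q \<subseteq> R" by (auto simp: Q_def)
  have kn: "real k \<le> n / real p"
  proof -
    have "real k * real p \<le> n" using cardQ Q0 by simp
    then show ?thesis using p1 by (simp add: field_simps)
  qed
  \<comment> \<open>A single vertex of density below 7/16 + \<gamma>/2 would contribute more than
    the bound on the whole potential; \<open>loss\<close> expresses this comparison.\<close>
  have degQ: "density E Q u \<ge> 7 / 16 + \<gamma> / 2" if u: "u \<in> Q" for u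
  proof -
    have "exp (- \<kappa> * density E Q u) \<le> potential \<kappa> E Q"
      unfolding potential_def using finQ u by (intro member_le_sum) auto
    also have "\<dots> \<le> exp (ln n) * exp (- \<kappa> * (7 / 16 + \<gamma>)) * exp (real k * \<delta>)" using Ps(5) n0 by (simp add: Q_def)
    also have "\<dots> = exp (ln n + - \<kappa> * (7 / 16 + \<gamma>) + real k * \<delta>)" by (simp only: exp_add)
    finally have "- \<kappa> * density E Q u \<le> ln n + - \<kappa> * (7 / 16 + \<gamma>) + real k * \<delta>" by (simp only: exp_le_cancel_iff)
    moreover have "real k * \<delta> \<le> n / real p * \<delta>" using kn delta0 by (intro mult_right_mono)
    ultimately have "\<kappa> * (7 / 16 + \<gamma>) \<le> \<kappa> * density E Q u + (ln n + n / real p * \<delta>)" by linarith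
    also have "ln n + n / real p * \<delta> = \<kappa> * (ln n / \<kappa> + n / real p * (2 * \<epsilon> * x + 21 * \<kappa> * x\<^sup>2))"
      using kap by (simp add: \<delta>_def distrib_left power2_eq_square mult_ac)
    also have "\<dots> \<le> \<kappa> * (\<gamma> / 2)" using loss kap by (intro mult_left_mono) auto
    finally have "\<kappa> * (7 / 16 + \<gamma>) \<le> \<kappa> * (density E Q u + \<gamma> / 2)" by (simp add: algebra_simps)
    then show ?thesis using kap by simp
  qed
  have colQ: "real (card (color_link E \<phi> Q u i)) \<le> (\<epsilon> * \<gamma> / 320) * (real (card Q))\<^sup>2" if u: "u \<in> Q" for u i
  proof -
    have "card (color_link E \<phi> Q u i) \<le> card (color_link E \<phi> R u i)"
      using fin QR by (intro card_mono color_link_mono finite_color_link)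
    then have "real (card (color_link E \<phi> Q u i)) \<le> c * n\<^sup>2" using col[of u i] u QR by force
    also have "c * n\<^sup>2 \<le> \<zeta>\<^sup>2 * (\<epsilon> * \<gamma> / 320) * n\<^sup>2" using c by (intro mult_right_mono) auto
    also have "\<dots> = (\<epsilon> * \<gamma> / 320) * (\<zeta> * n)\<^sup>2" by (simp add: power_mult_distrib)
    also have "\<dots> \<le> (\<epsilon> * \<gamma> / 320) * (real (card Q))\<^sup>2"
      using Qz zn0 eps gam by (intro mult_left_mono power_mono) auto
    finally show ?thesis .
  qed
  define y where "y = real (2 * t + 1) / real (card Q)"
  have yx: "y \<le> x" unfolding y_def x p using Qz zn0 by (intro divide_left_mono mult_pos_pos Q0 zeta n0) auto
  have y0: "y \<ge> 0" by (simp add: y_def)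
  have "3 * \<kappa> * y \<le> 3 * \<kappa> * x" using yx kap by (intro mult_left_mono) auto
  then have ky: "3 * \<kappa> * y \<le> 1" using kap by linarith
  have y10: "y \<le> 1 / 10" using yx x by linarith
  have "\<epsilon> * \<gamma> / 320 \<le> \<epsilon> * (\<gamma> / 2) / 160" "0 < \<gamma> / 2" using gam by auto
  moreover have "real (card Q) > 160 * (4 * real t + 2) / (\<epsilon> * (\<gamma> / 2))"
    using large(1) Qz by (simp add: field_simps)
  moreover have "real (card Q) \<ge> 32 / \<epsilon>" using large(2) Qz by linarith
  ultimately obtain xs where xs: "proper_walk E \<phi> xs" "distinct xs" "length xs = 2 * t + 1" "set xs \<subseteq> Q"
    "potential \<kappa> E (Q - set xs) \<le> potential \<kappa> E Q * exp (2 * \<kappa> * \<epsilon> * y + 21 * \<kappa>\<^sup>2 * y\<^sup>2)"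
    using tiling_step[OF finQ E3 degQ colQ eps _ t _ _ _ y_def y10 kap(1) ky] by metis
  have "2 * \<kappa> * \<epsilon> * y + 21 * \<kappa>\<^sup>2 * y\<^sup>2 \<le> \<delta>"
    unfolding \<delta>_def using yx y0 kap eps by (intro add_mono mult_left_mono power_mono) auto
  then have pe: "potential \<kappa> E Q * exp (2 * \<kappa> * \<epsilon> * y + 21 * \<kappa>\<^sup>2 * y\<^sup>2)
     \<le> (n * exp (- \<kappa> * (7 / 16 + \<gamma>)) * exp (real k * \<delta>)) * exp \<delta>"
    using Ps(5) n0 by (intro mult_mono) (auto simp: Q_def)
  have "potential \<kappa> E (Q - set xs) \<le> n * exp (- \<kappa> * (7 / 16 + \<gamma>)) * exp (real (Suc k) * \<delta>)"
  proof -
    have "exp (real (Suc k) * \<delta>) = exp (real k * \<delta>) * exp \<delta>"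
      by (simp add: exp_add[symmetric] distrib_right add.commute)
    then show ?thesis using order_trans[OF xs(5) pe] by (simp only: mult.assoc)
  qed
  moreover have "R - set (concat (xs # Ps)) = Q - set xs" by (auto simp: Q_def)
  ultimately show ?case using Ps xs QR p unfolding \<delta>_def
    by (intro exI[of _ "xs # Ps"]) (auto simp: Q_def)
qed


lemma eventually_ln_sqrt:
  assumes "(e::real) > 0"
  shows "eventually (\<lambda>n::nat. ln (real n) / sqrt (real n) < e \<and> sqrt (real n) > S) sequentially"
proof -
  have "((\<lambda>n::nat. ln (real n) / sqrt (real n)) \<longlongrightarrow> 0) sequentially" by real_asymp
  then have "eventually (\<lambda>n::nat. ln (real n) / sqrt (real n) < e) sequentially"
    using assms by (rule order_tendstoD)
  moreover have "filterlim (\<lambda>n::nat. sqrt (real n)) at_top sequentially" by real_asymp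
  then have "eventually (\<lambda>n::nat. sqrt (real n) > S) sequentially" by (simp add: filterlim_at_top_dense)
  ultimately show ?thesis by (rule eventually_conj)
qed

text \<open>\<kappa> is the square root of n. The error ln n / \<kappa> asks for \<kappa> far above
  ln n, and the quadratic error, of order \<kappa>/n for fixed t and \<zeta>, asks for \<kappa> far
  below n.\<close>

lemma path_tiling:
  fixes \<gamma> \<zeta> :: real
  assumes gam: "0 < \<gamma>" "\<gamma> \<le> 1" and zeta: "0 < \<zeta>" "\<zeta> \<le> 1" and t: "real t \<ge> 32 / (\<zeta> * \<gamma>)"
  shows "\<exists>c>0. \<exists>n0. \<forall>(R :: 'a set) E \<phi>. finite R \<longrightarrow> card R \<ge> n0 \<longrightarrow> (\<forall>e\<in>E. card e = 3) \<longrightarrow>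
     (\<forall>u\<in>R. real (card (link E R u)) \<ge> (7 / 16 + \<gamma>) * (real (card R))\<^sup>2) \<longrightarrow>
     (\<forall>u\<in>R. \<forall>i. real (card (color_link E \<phi> R u i)) \<le> c * (real (card R))\<^sup>2) \<longrightarrow>
     (\<exists>Ps. (\<forall>P\<in>set Ps. proper_walk E \<phi> P \<and> length P = 2 * t + 1) \<and> distinct (concat Ps) \<and>
        set (concat Ps) \<subseteq> R \<and> real (card (R - set (concat Ps))) \<le> 2 * \<zeta> * real (card R))"
proof -
  \<comment> \<open>The linear errors of at most n/p rounds add up to 2 \<epsilon> / \<zeta>, which
    this choice makes equal to \<gamma>/8.\<close>
  define \<epsilon> where "\<epsilon> = \<zeta> * \<gamma> / 16"
  define p where "p = 2 * t + 1"
  define c where "c = \<zeta>\<^sup>2 * (\<epsilon> * \<gamma> / 320)"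
  have zg: "\<zeta> * \<gamma> > 0" "\<zeta> * \<gamma> \<le> 1" using gam zeta by (auto intro: mult_le_one)
  have eps: "0 < \<epsilon>" "\<epsilon> \<le> 1" using zg by (auto simp: \<epsilon>_def)
  have te: "real t \<ge> 2 / \<epsilon>" using t by (simp add: \<epsilon>_def)
  have c0: "c > 0" using zeta eps gam by (simp add: c_def)
  define S where "S = 168 * real p / (\<zeta>\<^sup>2 * \<gamma>) + 10 * real p / \<zeta> + 320 * (4 * real t + 2) / (\<epsilon> * \<gamma>) / \<zeta> + 32 / \<epsilon> / \<zeta> + 1"
  have S: "S \<ge> 168 * real p / (\<zeta>\<^sup>2 * \<gamma>)" "S \<ge> 10 * real p / \<zeta>" "S \<ge> 320 * (4 * real t + 2) / (\<epsilon> * \<gamma>) / \<zeta>" "S \<ge> 32 / \<epsilon> / \<zeta>" "S \<ge> 1"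
  proof -
    have "168 * real p / (\<zeta>\<^sup>2 * \<gamma>) \<ge> 0" "10 * real p / \<zeta> \<ge> 0" "320 * (4 * real t + 2) / (\<epsilon> * \<gamma>) / \<zeta> \<ge> 0" "32 / \<epsilon> / \<zeta> \<ge> 0"
      using zeta eps gam by auto
    then show "S \<ge> 168 * real p / (\<zeta>\<^sup>2 * \<gamma>)" "S \<ge> 10 * real p / \<zeta>" "S \<ge> 320 * (4 * real t + 2) / (\<epsilon> * \<gamma>) / \<zeta>" "S \<ge> 32 / \<epsilon> / \<zeta>" "S \<ge> 1"
      unfolding S_def by linarith+
  qed
  have "\<gamma> / 8 > 0" using gam by simp
  from eventually_ln_sqrt[OF this, of S] obtain n0 where
    n0: "\<And>n::nat. n \<ge> n0 \<Longrightarrow> ln (real n) / sqrt (real n) < \<gamma> / 8 \<and> sqrt (real n) > S"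
    unfolding eventually_sequentially by auto
  have main: "\<exists>Ps. (\<forall>P\<in>set Ps. proper_walk E \<phi> P \<and> length P = 2 * t + 1) \<and> distinct (concat Ps) \<and>
        set (concat Ps) \<subseteq> R \<and> real (card (R - set (concat Ps))) \<le> 2 * \<zeta> * real (card R)"
    if fin: "finite R" and large: "card R \<ge> n0" and E3: "\<forall>e\<in>E. card e = 3"
     and deg: "\<forall>u\<in>R. real (card (link E R u)) \<ge> (7 / 16 + \<gamma>) * (real (card R))\<^sup>2"
     and col: "\<forall>u\<in>R. \<forall>i. real (card (color_link E \<phi> R u i)) \<le> c * (real (card R))\<^sup>2" for R :: "'a set" and E \<phi>
  proof -
    define n where "n = real (card R)"
    define s where "s = sqrt n"
    have s: "ln n / s < \<gamma> / 8" "s > S" using n0[OF large] by (auto simp: n_def s_def)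
    have ns: "n = s * s" by (simp add: s_def n_def)
    have s1: "s \<ge> 1" using s S by linarith
    have "s * 1 \<le> s * s" using s1 by (intro mult_left_mono) auto
    then have sn: "s \<le> n" by (simp add: ns)
    then have n1: "n \<ge> 1" using s1 by linarith
    define x where "x = real p / (\<zeta> * n)"
    have p1: "real p \<ge> 1" by (simp add: p_def)
    have l1: "\<zeta> * n > 320 * (4 * real t + 2) / (\<epsilon> * \<gamma>)"
    proof -
      have "n > 320 * (4 * real t + 2) / (\<epsilon> * \<gamma>) / \<zeta>" using S s sn by linarith
      moreover have "A < \<zeta> * n" if "A / \<zeta> < n" for A using that zeta by (simp add: pos_divide_less_eq mult.commute)
      ultimately show ?thesis by blast
    qed
    have l2: "\<zeta> * n \<ge> 32 / \<epsilon>"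
    proof -
      have "n \<ge> 32 / \<epsilon> / \<zeta>" using S s sn by linarith
      moreover have "A \<le> \<zeta> * n" if "A / \<zeta> \<le> n" for A using that zeta by (simp add: pos_divide_le_eq mult.commute)
      ultimately show ?thesis by blast
    qed
    have pz: "10 * real p < s * \<zeta>"
    proof -
      have "10 * real p / \<zeta> < s" using S s by linarith
      then show ?thesis using zeta by (simp add: pos_divide_less_eq)
    qed
    have "s * \<zeta> \<le> n * \<zeta>" using sn zeta by (intro mult_right_mono) auto
    then have pzn: "10 * real p < \<zeta> * n" using pz by (simp add: mult.commute)
    then have x10: "x \<le> 1 / 10" using zeta n1 by (simp add: x_def field_simps)
    have sx: "s * x = real p / (\<zeta> * s)" using s1 by (simp add: x_def ns)
    have kx: "3 * s * x \<le> 1"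
    proof -
      have "real p / (\<zeta> * s) \<le> 1 / 10" using pz zeta s1 by (simp add: field_simps)
      then show ?thesis using sx by simp
    qed
    have loss: "ln n / s + n / real p * (2 * \<epsilon> * x + 21 * s * x\<^sup>2) \<le> \<gamma> / 2"
    proof -
      have "n / real p * x = 1 / \<zeta>" using n1 p1 by (simp add: x_def)
      moreover have "n / real p * (2 * \<epsilon> * x + 21 * s * x\<^sup>2) = (n / real p * x) * (2 * \<epsilon> + 21 * (s * x))"
        by (simp add: power2_eq_square algebra_simps)
      ultimately have "n / real p * (2 * \<epsilon> * x + 21 * s * x\<^sup>2) = 2 * \<epsilon> / \<zeta> + 21 * real p / (\<zeta>\<^sup>2 * s)"
        by (simp only: sx) (simp add: power2_eq_square add_divide_distrib mult.assoc)
      moreover have "2 * \<epsilon> / \<zeta> = \<gamma> / 8" using zeta by (simp add: \<epsilon>_def)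
      moreover have "21 * real p / (\<zeta>\<^sup>2 * s) \<le> \<gamma> / 8"
      proof -
        have "168 * real p / (\<zeta>\<^sup>2 * \<gamma>) < s" using S s by linarith
        then have "168 * real p < s * (\<zeta>\<^sup>2 * \<gamma>)" using zeta gam by (simp add: pos_divide_less_eq)
        then have "21 * real p \<le> \<gamma> / 8 * (\<zeta>\<^sup>2 * s)" by (simp add: algebra_simps)
        then show ?thesis using zeta s1 by (subst pos_divide_le_eq) auto
      qed
      ultimately show ?thesis using s(1) gam by linarith
    qed
    have degd: "density E R u \<ge> 7 / 16 + \<gamma>" if "u \<in> R" for u
      using deg that n1 by (simp add: density_def n_def field_simps)
    \<comment> \<open>Rounding down leaves at most \<zeta> n + p vertices uncovered, and p is below
      \<zeta> n.\<close>
    define k where "k = nat \<lfloor>(1 - \<zeta>) * n / real p\<rfloor>"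
    have "(1 - \<zeta>) * n / real p \<ge> 0" using zeta n1 by simp
    then have k: "real k \<le> (1 - \<zeta>) * n / real p" "real k > (1 - \<zeta>) * n / real p - 1"
      unfolding k_def by (auto simp: of_nat_nat)
    have kp: "real (k * p) \<le> (1 - \<zeta>) * n" using k(1) p1 by (simp add: field_simps)
    have kp2: "real (k * p) > (1 - \<zeta>) * n - real p" using k(2) p1 by (simp add: field_simps)
    have E3': "\<And>e. e \<in> E \<Longrightarrow> card e = 3" using E3 by auto
    have col': "\<And>u i. u \<in> R \<Longrightarrow> real (card (color_link E \<phi> R u i)) \<le> c * n\<^sup>2" using col by (auto simp: n_def)
    have cc: "c \<le> \<zeta>\<^sup>2 * (\<epsilon> * \<gamma> / 320)" by (simp add: c_def)
    obtain Ps where Ps: "length Ps = k" "\<And>P. P \<in> set Ps \<Longrightarrow> proper_walk E \<phi> P \<and> length P = p" "distinct (concat Ps)"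
     "set (concat Ps) \<subseteq> R"
      using tiling_iterate[OF fin E3' degd n_def p_def col' eps zeta(1) gam(1) te cc l1 l2 x_def x10 s1 kx loss kp] by blast
    have "card (set (concat Ps)) = k * p" using Ps length_concat_const distinct_card by metis
    moreover have "card (R - set (concat Ps)) = card R - card (set (concat Ps))" using Ps(4) by (intro card_Diff_subset) auto
    moreover have "card (set (concat Ps)) \<le> card R" using Ps(4) fin by (intro card_mono)
    ultimately have "real (card (R - set (concat Ps))) = n - real (k * p)" using n_def by simp
    also have "\<dots> \<le> 2 * \<zeta> * n" using kp2 pzn by (simp add: algebra_simps)
    finally show ?thesis using Ps unfolding n_def p_def by blast
  qed
  show ?thesis using c0 main by blast
qed

section \<open>Counting tuples\<close>

text \<open>Repetitions are allowed, so that there are exactly n^k tuples and counting factorizes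
  over the coordinates; \<open>card_free\<close> discards the degenerate tuples afterwards.\<close>

definition tuples :: "'a set \<Rightarrow> nat \<Rightarrow> 'a list set" where
  "tuples V k = {xs. set xs \<subseteq> V \<and> length xs = k}"

lemma finite_tuples: "finite V \<Longrightarrow> finite (tuples V k)"
  unfolding tuples_def by (rule finite_lists_length_eq)

lemma card_tuples: "finite V \<Longrightarrow> card (tuples V k) = card V ^ k"
  unfolding tuples_def by (rule card_lists_length_eq)

lemma tuples_update: "xs \<in> tuples V k \<Longrightarrow> v \<in> V \<Longrightarrow> xs[i := v] \<in> tuples V k"
  by (auto simp: tuples_def dest: set_update_subset_insert[THEN subsetD])

lemma tuples_nth: "xs \<in> tuples V k \<Longrightarrow> i < k \<Longrightarrow> xs ! i \<in> V"
  by (auto simp: tuples_def)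

text \<open>Densities multiply along successive choices. The relation between \<open>k\<close> and
  \<open>k'\<close> is a hypothesis so that both lengths can be numerals.\<close>

lemma dense_snoc:
  fixes a b :: real
  assumes fin: "finite V" and b: "b \<ge> 0"
    and P: "real (card {xs \<in> tuples V k. P xs}) \<ge> a * real (card V) ^ k"
    and ext: "\<And>xs. xs \<in> tuples V k \<Longrightarrow> P xs \<Longrightarrow> real (card {v \<in> V. P' (xs @ [v])}) \<ge> b * real (card V)"
    and k: "k' = Suc k"
  shows "real (card {xs \<in> tuples V k'. P' xs}) \<ge> a * b * real (card V) ^ k'"
proof -
  let ?S = "SIGMA xs:{xs \<in> tuples V k. P xs}. {v \<in> V. P' (xs @ [v])}"
  have "(\<lambda>(xs, v). xs @ [v]) ` ?S \<subseteq> {xs \<in> tuples V (Suc k). P' xs}"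
    by (auto simp: tuples_def)
  then have "card ((\<lambda>(xs, v). xs @ [v]) ` ?S) \<le> card {xs \<in> tuples V (Suc k). P' xs}"
    using fin by (intro card_mono) (auto simp: finite_tuples)
  moreover have "card ((\<lambda>(xs, v). xs @ [v]) ` ?S) = card ?S"
    by (intro card_image) (auto simp: inj_on_def)
  moreover have "card ?S = (\<Sum>xs\<in>{xs \<in> tuples V k. P xs}. card {v \<in> V. P' (xs @ [v])})"
    using fin by (intro card_SigmaI) (auto simp: finite_tuples)
  ultimately have "(\<Sum>xs\<in>{xs \<in> tuples V k. P xs}. card {v \<in> V. P' (xs @ [v])}) \<le> card {xs \<in> tuples V (Suc k). P' xs}"
    by argo
  then have "real (\<Sum>xs\<in>{xs \<in> tuples V k. P xs}. card {v \<in> V. P' (xs @ [v])}) \<le> real (card {xs \<in> tuples V (Suc k). P' xs})"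
    by (simp only: of_nat_le_iff)
  moreover have "(\<Sum>xs\<in>{xs \<in> tuples V k. P xs}. b * real (card V)) \<le> real (\<Sum>xs\<in>{xs \<in> tuples V k. P xs}. card {v \<in> V. P' (xs @ [v])})"
    unfolding of_nat_sum by (intro sum_mono ext) auto
  moreover have "(\<Sum>xs\<in>{xs \<in> tuples V k. P xs}. b * real (card V)) = real (card {xs \<in> tuples V k. P xs}) * (b * real (card V))"
    by simp
  moreover have "a * real (card V) ^ k * (b * real (card V)) \<le> real (card {xs \<in> tuples V k. P xs}) * (b * real (card V))"
    using P b by (intro mult_right_mono) auto
  ultimately have "a * real (card V) ^ k * (b * real (card V)) \<le> real (card {xs \<in> tuples V (Suc k). P' xs})" by linarith
  then show ?thesis by (simp add: k mult_ac)
qed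

lemma dense_snoc2:
  fixes a b :: real
  assumes fin: "finite V" and b: "b \<ge> 0"
    and P: "real (card {xs \<in> tuples V k. P xs}) \<ge> a * real (card V) ^ k"
    and ext: "\<And>xs. xs \<in> tuples V k \<Longrightarrow> P xs \<Longrightarrow> real (card {(v, w) \<in> V \<times> V. P' (xs @ [v, w])}) \<ge> b * (real (card V))\<^sup>2"
    and k: "k' = Suc (Suc k)"
  shows "real (card {xs \<in> tuples V k'. P' xs}) \<ge> a * b * real (card V) ^ k'"
proof -
  let ?S = "SIGMA xs:{xs \<in> tuples V k. P xs}. {(v, w) \<in> V \<times> V. P' (xs @ [v, w])}"
  have "(\<lambda>(xs, v, w). xs @ [v, w]) ` ?S \<subseteq> {xs \<in> tuples V (Suc (Suc k)). P' xs}"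
    by (auto simp: tuples_def)
  then have "card ((\<lambda>(xs, v, w). xs @ [v, w]) ` ?S) \<le> card {xs \<in> tuples V (Suc (Suc k)). P' xs}"
    using fin by (intro card_mono) (auto simp: finite_tuples)
  moreover have "card ((\<lambda>(xs, v, w). xs @ [v, w]) ` ?S) = card ?S"
    by (intro card_image) (auto simp: inj_on_def)
  moreover have "finite {(v, w) \<in> V \<times> V. P' (xs @ [v, w])}" for xs
    by (rule finite_subset[of _ "V \<times> V"]) (use fin in auto)
  then have "card ?S = (\<Sum>xs\<in>{xs \<in> tuples V k. P xs}. card {(v, w) \<in> V \<times> V. P' (xs @ [v, w])})"
    using fin by (intro card_SigmaI) (auto simp: finite_tuples)
  ultimately have "(\<Sum>xs\<in>{xs \<in> tuples V k. P xs}. card {(v, w) \<in> V \<times> V. P' (xs @ [v, w])}) \<le> card {xs \<in> tuples V (Suc (Suc k)). P' xs}"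
    by argo
  then have "real (\<Sum>xs\<in>{xs \<in> tuples V k. P xs}. card {(v, w) \<in> V \<times> V. P' (xs @ [v, w])}) \<le> real (card {xs \<in> tuples V (Suc (Suc k)). P' xs})"
    by (simp only: of_nat_le_iff)
  moreover have "(\<Sum>xs\<in>{xs \<in> tuples V k. P xs}. b * (real (card V))\<^sup>2) \<le> real (\<Sum>xs\<in>{xs \<in> tuples V k. P xs}. card {(v, w) \<in> V \<times> V. P' (xs @ [v, w])})"
    unfolding of_nat_sum by (intro sum_mono ext) auto
  moreover have "(\<Sum>xs\<in>{xs \<in> tuples V k. P xs}. b * (real (card V))\<^sup>2) = real (card {xs \<in> tuples V k. P xs}) * (b * (real (card V))\<^sup>2)"
    by simp
  moreover have "a * real (card V) ^ k * (b * (real (card V))\<^sup>2) \<le> real (card {xs \<in> tuples V k. P xs}) * (b * (real (card V))\<^sup>2)"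
    using P b by (intro mult_right_mono) auto
  ultimately have "a * real (card V) ^ k * (b * (real (card V))\<^sup>2) \<le> real (card {xs \<in> tuples V (Suc (Suc k)). P' xs})" by linarith
  then show ?thesis by (simp add: k mult_ac power2_eq_square)
qed

text \<open>Double counting: a tuple \<open>ys\<close> in \<open>B\<close> and a value
  \<open>p\<close> are recovered from the tuple with \<open>p\<close> in place \<open>i\<close>
  together with the old entry. The factor \<open>card V\<close> on the left stands in for the
  exponent k - 1 on the right.\<close>

lemma sparse_coordinate:
  assumes fin: "finite V" and B: "B \<subseteq> tuples V k" and i: "i < k"
    and le: "\<And>xs. xs \<in> tuples V k \<Longrightarrow> card {v \<in> V. xs[i := v] \<in> B} \<le> b"
  shows "card B * card V \<le> b * card V ^ k"
proof -
  let ?S = "SIGMA xs:tuples V k. {v \<in> V. xs[i := v] \<in> B}"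
  let ?f = "\<lambda>(ys, p). (ys[i := p], ys ! i)"
  have finB: "finite B" using B fin finite_tuples finite_subset by metis
  have "inj_on ?f (B \<times> V)"
  proof (rule inj_onI, clarify)
    fix ys p ys' p' assume *: "ys \<in> B" "ys' \<in> B" "ys[i := p] = ys'[i := p']" "ys ! i = ys' ! i"
    then have l: "length ys = k" "length ys' = k" using B by (auto simp: tuples_def)
    have "(ys[i := p])[i := ys ! i] = (ys'[i := p'])[i := ys' ! i]" using * by simp
    moreover have "ys[i := p] ! i = ys'[i := p'] ! i" using * by simp
    ultimately show "ys = ys' \<and> p = p'" using l i by simp
  qed
  moreover have "?f ` (B \<times> V) \<subseteq> ?S"
  proof (rule image_subsetI)
    fix y assume "y \<in> B \<times> V"
    then obtain ys p where y: "y = (ys, p)" "ys \<in> B" "p \<in> V" by auto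
    then have "ys \<in> tuples V k" using B by auto
    then show "?f y \<in> ?S"
      using y i by (simp add: tuples_update tuples_nth)
  qed
  moreover have "finite ?S" using fin by (auto simp: finite_tuples)
  ultimately have "card (B \<times> V) \<le> card ?S" by (intro card_inj_on_le)
  also have "card ?S = (\<Sum>xs\<in>tuples V k. card {v \<in> V. xs[i := v] \<in> B})"
    using fin by (intro card_SigmaI) (auto simp: finite_tuples)
  also have "\<dots> \<le> (\<Sum>xs\<in>tuples V k. b)" by (intro sum_mono le)
  finally show ?thesis using fin by (simp add: card_cartesian_product card_tuples mult.commute)
qed

lemma sparse_two_coordinates:
  fixes b :: real
  assumes fin: "finite V" and V0: "card V > 0" and B: "B \<subseteq> tuples V k" and ij: "i < k" "j < k" "i \<noteq> j"
    and le: "\<And>xs. xs \<in> tuples V k \<Longrightarrow> real (card {(v, w) \<in> V \<times> V. xs[i := v, j := w] \<in> B}) \<le> b * (real (card V))\<^sup>2"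
  shows "real (card B) \<le> b * real (card V) ^ k"
proof -
  let ?F = "\<lambda>xs. {(v, w) \<in> V \<times> V. xs[i := v, j := w] \<in> B}"
  let ?S = "SIGMA xs:tuples V k. ?F xs"
  let ?f = "\<lambda>(ys, p, q). (ys[i := p, j := q], ys ! i, ys ! j)"
  have finB: "finite B" using B fin finite_tuples finite_subset by metis
  have bk: "(ys[i := p, j := q])[i := ys ! i, j := ys ! j] = ys" for ys :: "'a list" and p q
    using ij by (simp add: list_update_swap[of i j])
  have "inj_on ?f (B \<times> (V \<times> V))"
  proof (rule inj_onI)
    fix y y' assume y: "y \<in> B \<times> (V \<times> V)" "y' \<in> B \<times> (V \<times> V)" "?f y = ?f y'"
    obtain ys p q ys' p' q' where y': "y = (ys, p, q)" "y' = (ys', p', q')" by (cases y, cases y') auto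
    then have *: "ys \<in> B" "ys' \<in> B" "ys[i := p, j := q] = ys'[i := p', j := q']" "ys ! i = ys' ! i" "ys ! j = ys' ! j"
      using y by auto
    then have l: "length ys = k" "length ys' = k" using B by (auto simp: tuples_def)
    have "ys = ys'" using bk[of ys p q] bk[of ys' p' q'] * by metis
    moreover have "ys[i := p, j := q] ! i = ys'[i := p', j := q'] ! i" "ys[i := p, j := q] ! j = ys'[i := p', j := q'] ! j"
      using * by simp_all
    ultimately show "y = y'" using l ij y' by simp
  qed
  moreover have "?f ` (B \<times> (V \<times> V)) \<subseteq> ?S"
  proof (rule image_subsetI)
    fix y assume "y \<in> B \<times> (V \<times> V)"
    then obtain ys p q where y: "y = (ys, p, q)" "ys \<in> B" "p \<in> V" "q \<in> V" by auto
    then have "ys \<in> tuples V k" using B by auto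
    then show "?f y \<in> ?S"
      using y ij by (simp add: tuples_update tuples_nth bk)
  qed
  moreover have finF: "finite (?F xs)" for xs
    by (rule finite_subset[of _ "V \<times> V"]) (use fin in auto)
  moreover have finS: "finite ?S" using fin finF by (intro finite_SigmaI finite_tuples)
  ultimately have "card (B \<times> (V \<times> V)) \<le> card ?S" by (intro card_inj_on_le)
  also have "card ?S = (\<Sum>xs\<in>tuples V k. card (?F xs))"
    using fin finF by (intro card_SigmaI finite_tuples ballI)
  finally have "real (card (B \<times> (V \<times> V))) \<le> (\<Sum>xs\<in>tuples V k. real (card (?F xs)))"
    by (simp only: of_nat_sum[symmetric] of_nat_le_iff)
  also have "\<dots> \<le> (\<Sum>xs\<in>tuples V k. b * (real (card V))\<^sup>2)" by (intro sum_mono le)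
  also have "\<dots> = b * real (card V) ^ k * (real (card V))\<^sup>2" using fin by (simp add: card_tuples)
  finally have "real (card B) * (real (card V))\<^sup>2 \<le> b * real (card V) ^ k * (real (card V))\<^sup>2"
    by (simp add: card_cartesian_product power2_eq_square)
  then show ?thesis using V0 by simp
qed

text \<open>With all entries but two fixed, the third vertex \<open>g xs\<close> and the color
  \<open>\<chi> xs\<close> are determined, so the two free entries form a pair of a single color
  link. To compare two edges in this way, one of them must have two free vertices off the
  other.\<close>

lemma sparse_clash:
  fixes b :: real
  assumes fin: "finite V" and V0: "card V > 0" and ij: "i < k" "j < k" "i \<noteq> j"
    and col: "\<And>u c. u \<in> V \<Longrightarrow> real (card (color_link E \<phi> V u c)) \<le> b * (real (card V))\<^sup>2"
    and g: "\<And>xs. xs \<in> tuples V k \<Longrightarrow> g xs \<in> V"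
    and inv: "\<And>xs v w. g (xs[i := v, j := w]) = g xs" "\<And>xs v w. \<chi> (xs[i := v, j := w]) = \<chi> xs"
  shows "real (card {xs \<in> tuples V k. {g xs, xs ! i, xs ! j} \<in> E \<and> \<phi> {g xs, xs ! i, xs ! j} = \<chi> xs}) \<le> b * real (card V) ^ k"
    (is "real (card ?B) \<le> _")
proof (rule sparse_two_coordinates[OF fin V0 _ ij])
  fix xs assume xs: "xs \<in> tuples V k"
  then have l: "length xs = k" by (simp add: tuples_def)
  have "{(v, w) \<in> V \<times> V. xs[i := v, j := w] \<in> ?B} \<subseteq> color_link E \<phi> V (g xs) (\<chi> xs)"
    using l ij by (auto simp: color_link_def inv)
  then have "card {(v, w) \<in> V \<times> V. xs[i := v, j := w] \<in> ?B} \<le> card (color_link E \<phi> V (g xs) (\<chi> xs))"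
    using fin by (intro card_mono finite_color_link)
  then show "real (card {(v, w) \<in> V \<times> V. xs[i := v, j := w] \<in> ?B}) \<le> b * (real (card V))\<^sup>2"
    using col[OF g[OF xs], of "\<chi> xs"] by linarith
qed auto

lemma card_hitting:
  assumes fin: "finite V" and k: "i < k" and U: "finite U"
  shows "card {xs \<in> tuples V k. xs ! i \<in> U} * card V \<le> card U * card V ^ k"
proof (rule sparse_coordinate[OF fin _ k])
  fix xs assume "xs \<in> tuples V k"
  then have "{v \<in> V. xs[i := v] \<in> {xs \<in> tuples V k. xs ! i \<in> U}} \<subseteq> U" using k by (auto simp: tuples_def)
  then show "card {v \<in> V. xs[i := v] \<in> {xs \<in> tuples V k. xs ! i \<in> U}} \<le> card U" using U by (intro card_mono)
qed auto

lemma card_coincident: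
  assumes fin: "finite V" and ij: "i < k" "j < k" "i \<noteq> j"
  shows "card {xs \<in> tuples V k. xs ! i = xs ! j} * card V \<le> card V ^ k"
proof -
  have "card {xs \<in> tuples V k. xs ! i = xs ! j} * card V \<le> 1 * card V ^ k"
  proof (rule sparse_coordinate[OF fin _ ij(1)])
    fix xs assume "xs \<in> tuples V k"
    then have "{v \<in> V. xs[i := v] \<in> {xs \<in> tuples V k. xs ! i = xs ! j}} \<subseteq> {xs ! j}" using ij by (auto simp: tuples_def)
    then have "card {v \<in> V. xs[i := v] \<in> {xs \<in> tuples V k. xs ! i = xs ! j}} \<le> card {xs ! j}" by (intro card_mono) auto
    then show "card {v \<in> V. xs[i := v] \<in> {xs \<in> tuples V k. xs ! i = xs ! j}} \<le> 1" by simp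
  qed auto
  then show ?thesis by simp
qed

text \<open>Union bound: some coordinate falls into \<open>U\<close>, or two coordinates agree. The
  k events of the first kind have proportion at most \<open>card U\<close> / n each, the fewer than
  k^2 of the second kind 1/n each.\<close>

lemma card_free:
  assumes fin: "finite V" and V0: "card V > 0" and A: "A \<subseteq> tuples V k" and U: "finite U"
  shows "real (card {xs \<in> A. distinct xs \<and> set xs \<inter> U = {}}) \<ge>
     real (card A) - (real k * real (card U) + (real k)\<^sup>2) / real (card V) * real (card V) ^ k"
proof -
  let ?F = "{xs \<in> A. distinct xs \<and> set xs \<inter> U = {}}"
  let ?H = "\<lambda>i. {xs \<in> tuples V k. xs ! i \<in> U}"
  let ?C = "\<lambda>(i, j). {xs \<in> tuples V k. xs ! i = xs ! j}"
  let ?I = "{(i, j) \<in> {..<k} \<times> {..<k}. i \<noteq> j}"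
  have finI: "finite ?I" by (rule finite_subset[of _ "{..<k} \<times> {..<k}"]) auto
  have finA: "finite A" using A fin finite_tuples finite_subset by metis
  have "A \<subseteq> ?F \<union> ((\<Union>i<k. ?H i) \<union> (\<Union>p\<in>?I. ?C p))"
  proof
    fix xs assume xs: "xs \<in> A"
    then have t: "xs \<in> tuples V k" "length xs = k" using A by (auto simp: tuples_def)
    show "xs \<in> ?F \<union> ((\<Union>i<k. ?H i) \<union> (\<Union>p\<in>?I. ?C p))"
    proof (cases "distinct xs")
      case False
      then obtain i j where "i < k" "j < k" "i \<noteq> j" "xs ! i = xs ! j" using t by (auto simp: distinct_conv_nth)
      then have "(i, j) \<in> ?I" "xs \<in> ?C (i, j)" using t by auto
      then show ?thesis by blast
    next
      case True
      show ?thesis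
      proof (cases "set xs \<inter> U = {}")
        case False
        then obtain i where "i < k" "xs ! i \<in> U" using t by (auto simp: in_set_conv_nth)
        then show ?thesis using t by auto
      qed (use True xs in auto)
    qed
  qed
  then have "card A \<le> card (?F \<union> ((\<Union>i<k. ?H i) \<union> (\<Union>p\<in>?I. ?C p)))"
    using fin finA finI by (intro card_mono finite_UnI finite_UN_I) (auto simp: finite_tuples)
  also have "\<dots> \<le> card ?F + (card (\<Union>i<k. ?H i) + card (\<Union>p\<in>?I. ?C p))"
    by (rule order_trans[OF card_Un_le add_left_mono[OF card_Un_le]])
  also have "\<dots> \<le> card ?F + ((\<Sum>i<k. card (?H i)) + (\<Sum>p\<in>?I. card (?C p)))"
    using finI by (intro add_left_mono add_mono card_UN_le) auto
  finally have "card A * card V \<le> (card ?F + ((\<Sum>i<k. card (?H i)) + (\<Sum>p\<in>?I. card (?C p)))) * card V"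
    by (intro mult_right_mono) auto
  also have "\<dots> = card ?F * card V + ((\<Sum>i<k. card (?H i) * card V) + (\<Sum>p\<in>?I. card (?C p) * card V))"
    by (simp add: distrib_right sum_distrib_right)
  also have "\<dots> \<le> card ?F * card V + ((\<Sum>i<k. card U * card V ^ k) + (\<Sum>p\<in>?I. card V ^ k))"
    using card_hitting[OF fin _ U] card_coincident[OF fin] by (intro add_left_mono add_mono sum_mono) auto
  also have "(\<Sum>p\<in>?I. card V ^ k) \<le> k * k * card V ^ k"
  proof -
    have "card ?I \<le> card ({..<k} \<times> {..<k})" by (intro card_mono) auto
    then show ?thesis by (simp add: card_cartesian_product)
  qed
  finally have "card A * card V \<le> card ?F * card V + (k * (card U * card V ^ k) + k * k * card V ^ k)" by simp
  then have "real (card A * card V) \<le> real (card ?F * card V + (k * (card U * card V ^ k) + k * k * card V ^ k))"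
    by (simp only: of_nat_le_iff)
  then have "real (card A) * real (card V) \<le> real (card ?F) * real (card V) + (real k * real (card U) + (real k)\<^sup>2) * real (card V) ^ k"
    by (simp add: algebra_simps power2_eq_square)
  then show ?thesis using V0 by (simp add: field_simps)
qed

section \<open>Dense colorings\<close>

lemma codeg_on_commute: "codeg_on E R u v = codeg_on E R v u"
  by (simp add: codeg_on_def insert_commute)

lemma sum_le_cover:
  fixes f :: "'b \<Rightarrow> real"
  assumes "finite A" "finite B" "finite C" "finite D" "V \<subseteq> A \<union> B \<union> C \<union> D"
    and f: "\<And>x. f x \<ge> 0"
  shows "sum f V \<le> sum f A + sum f B + sum f C + sum f D"
proof -
  have un: "sum f (X \<union> Y) \<le> sum f X + sum f Y" if "finite X" "finite Y" for X Y
    using sum.union_inter[OF that, of f] sum_nonneg[of "X \<inter> Y" f] f by simp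
  have "sum f V \<le> sum f (A \<union> B \<union> C \<union> D)" using assms by (intro sum_mono2) auto
  then show ?thesis using un[of "A \<union> B \<union> C" D] un[of "A \<union> B" C] un[of A B] assms by simp
qed

locale dense_coloring =
  fixes V :: "'a set" and E :: "'a set set" and \<phi> :: "'a set \<Rightarrow> nat" and c :: real
  assumes fin: "finite V" and V0: "card V > 0"
    and E3: "\<And>e. e \<in> E \<Longrightarrow> card e = 3"
    and deg: "\<And>u. u \<in> V \<Longrightarrow> real (card (link E V u)) \<ge> 7 / 16 * (real (card V))\<^sup>2"
    and col: "\<And>u i. u \<in> V \<Longrightarrow> real (card (color_link E \<phi> V u i)) \<le> c * (real (card V))\<^sup>2"
begin

abbreviation n :: real where "n \<equiv> real (card V)"
abbreviation cod :: "'a \<Rightarrow> 'a \<Rightarrow> real" where "cod u v \<equiv> real (codeg_on E V u v)"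

definition rich :: "'a \<Rightarrow> 'a set" where "rich u = {v \<in> V. cod u v \<ge> n / 200}"

lemma finite_rich: "finite (rich u)" using fin by (simp add: rich_def)
lemma rich_in_V: "v \<in> rich u \<Longrightarrow> v \<in> V" by (simp add: rich_def)
lemma rich_subset: "rich u \<subseteq> V" by (auto simp: rich_def)
lemma rich_cod: "v \<in> rich u \<Longrightarrow> cod u v \<ge> n / 200" by (simp add: rich_def)

lemma rich_commute: "u \<in> V \<Longrightarrow> v \<in> V \<Longrightarrow> v \<in> rich u \<longleftrightarrow> u \<in> rich v"
  by (simp add: rich_def codeg_on_commute[of E V u])

lemma cod_le: "cod u v \<le> n"
  unfolding codeg_on_def using fin by (simp add: card_mono)

lemma sum_cod: "A \<subseteq> V \<Longrightarrow> (\<Sum>a\<in>A. cod u a) = real (card {(a, b) \<in> link E V u. a \<in> A})"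
  using sum_codeg_on[OF fin, of A E u] by (simp only: of_nat_sum[symmetric])

lemma card_link_swap: "card {(a, b) \<in> link E V u. b \<in> A} = card {(a, b) \<in> link E V u. a \<in> A}"
proof -
  have "{(a, b) \<in> link E V u. b \<in> A} = prod.swap ` {(a, b) \<in> link E V u. a \<in> A}"
    by (auto simp: link_def insert_commute image_iff)
  then show ?thesis by (simp add: card_image)
qed

lemma finite_link_sub: "finite {(a, b) \<in> link E V u. Q a b}"
  by (rule finite_subset[OF _ finite_link[OF fin, of E u]]) auto

lemma fin_pairs: "finite {(v, w) \<in> V \<times> V. Q v w}"
  by (rule finite_subset[of _ "V \<times> V"]) (use fin in auto)

lemma sum_cod_all: "u \<in> V \<Longrightarrow> (\<Sum>a\<in>V. cod u a) \<ge> 7 / 16 * n\<^sup>2"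
proof -
  assume "u \<in> V"
  moreover have "{(a, b) \<in> link E V u. a \<in> V} = link E V u" by (auto simp: link_def)
  ultimately show ?thesis using sum_cod[OF subset_refl, of u] deg by simp
qed

text \<open>Apart from at most n^2/100 pairs, the link lies in the square of the rich set, and 7/16
  - 1/100 > (13/20)^2. The gain is that 13/20 exceeds both 1/2 and 3/5: two rich sets always meet,
  and so do a rich set and any set of 2n/5 vertices.\<close>

lemma card_rich:
  assumes u: "u \<in> V"
  shows "real (card (rich u)) \<ge> 13 / 20 * n"
proof -
  let ?A = "V - rich u"
  have "(\<Sum>a\<in>?A. cod u a) \<le> (\<Sum>a\<in>?A. n / 200)" by (intro sum_mono) (auto simp: rich_def)
  also have "\<dots> = real (card ?A) * (n / 200)" by simp
  also have "\<dots> \<le> n * (n / 200)" using fin by (intro mult_right_mono) (auto intro!: card_mono)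
  finally have A: "real (card {(a, b) \<in> link E V u. a \<in> ?A}) \<le> n\<^sup>2 / 200"
    using sum_cod[of ?A u] by (simp add: power2_eq_square)
  have "link E V u \<subseteq> rich u \<times> rich u \<union> ({(a, b) \<in> link E V u. a \<in> ?A} \<union> {(a, b) \<in> link E V u. b \<in> ?A})"
    by (auto simp: link_def)
  then have "card (link E V u) \<le> card (rich u \<times> rich u \<union> ({(a, b) \<in> link E V u. a \<in> ?A} \<union> {(a, b) \<in> link E V u. b \<in> ?A}))"
    by (intro card_mono finite_UnI finite_link_sub finite_cartesian_product finite_rich)
  also have "\<dots> \<le> card (rich u \<times> rich u) + (card {(a, b) \<in> link E V u. a \<in> ?A} + card {(a, b) \<in> link E V u. b \<in> ?A})"
    by (rule order_trans[OF card_Un_le add_left_mono[OF card_Un_le]])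
  finally have "card (link E V u) \<le> card (rich u) * card (rich u) + 2 * card {(a, b) \<in> link E V u. a \<in> ?A}"
    unfolding card_link_swap by (simp add: card_cartesian_product)
  then have "real (card (link E V u)) \<le> real (card (rich u) * card (rich u) + 2 * card {(a, b) \<in> link E V u. a \<in> ?A})"
    by (simp only: of_nat_le_iff)
  then have "real (card (link E V u)) \<le> real (card (rich u)) * real (card (rich u)) + 2 * real (card {(a, b) \<in> link E V u. a \<in> ?A})"
    by simp
  then have "real (card (rich u)) * real (card (rich u)) \<ge> (7 / 16 - 1 / 100) * n\<^sup>2"
    using A deg[OF u] by (simp add: algebra_simps)
  moreover have "(7 / 16 - 1 / 100) * n\<^sup>2 \<ge> (13 / 20 * n)\<^sup>2" by (simp add: power_mult_distrib power2_eq_square)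
  ultimately have "(13 / 20 * n)\<^sup>2 \<le> (real (card (rich u)))\<^sup>2" unfolding power2_eq_square by linarith
  then show ?thesis by (rule power2_le_imp_le) simp
qed

text \<open>Pairs whose second entry lies outside \<open>W\<close> have density at most 7/20, and
  7/16 - 7/20 = 7/80. With a rich set for \<open>W\<close> this yields the middle edge of a
  connector.\<close>

lemma link_into:
  assumes y: "y \<in> V" and W: "W \<subseteq> V" "real (card W) \<ge> 13 / 20 * n"
  shows "real (card {(z, w) \<in> V \<times> V. {y, z, w} \<in> E \<and> w \<in> W}) \<ge> 7 / 80 * n\<^sup>2"
proof -
  let ?S = "{(z, w) \<in> V \<times> V. {y, z, w} \<in> E \<and> w \<in> W}"
  have finS: "finite ?S" by (rule finite_subset[of _ "V \<times> V"]) (use fin in auto)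
  have "link E V y \<subseteq> ?S \<union> V \<times> (V - W)" by (auto simp: link_def)
  then have "card (link E V y) \<le> card (?S \<union> V \<times> (V - W))" using fin finS by (intro card_mono) auto
  also have "\<dots> \<le> card ?S + card (V \<times> (V - W))" by (rule card_Un_le)
  finally have "card (link E V y) \<le> card ?S + card V * card (V - W)" by (simp add: card_cartesian_product)
  then have "real (card (link E V y)) \<le> real (card ?S + card V * card (V - W))" by (simp only: of_nat_le_iff)
  then have 1: "real (card (link E V y)) \<le> real (card ?S) + n * real (card (V - W))" by simp
  have "card (V - W) = card V - card W" "card W \<le> card V"
    using W fin by (auto intro!: card_Diff_subset card_mono intro: finite_subset)
  then have "real (card (V - W)) \<le> 7 / 20 * n" using W by simp
  then have "n * real (card (V - W)) \<le> n * (7 / 20 * n)" by (intro mult_left_mono) auto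
  then show ?thesis using 1 deg[OF y] by (simp add: power2_eq_square)
qed

lemma inter_large:
  assumes "A \<subseteq> V" "B \<subseteq> V" "real (card A) \<ge> a * n" "real (card B) \<ge> b * n"
  shows "real (card (A \<inter> B)) \<ge> (a + b - 1) * n"
proof -
  have "card A + card B = card (A \<union> B) + card (A \<inter> B)"
    using assms fin by (intro card_Un_Int) (auto intro: finite_subset)
  moreover have "card (A \<union> B) \<le> card V" using assms fin by (intro card_mono) auto
  ultimately have "real (card A) + real (card B) \<le> n + real (card (A \<inter> B))" by linarith
  then show ?thesis using assms by (simp add: algebra_simps)
qed

text \<open>A root is the common vertex of the edges \<open>{p, x, r}\<close> and
  \<open>{t, z, r}\<close> in the exchange of \<open>x\<close> and \<open>z\<close>. After one of p
  and t is taken from the smaller neighbourhood, the other must lie both in the larger neighbourhood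
  and in a rich set, which 2/5 + 13/20 > 1 guarantees.\<close>

definition roots :: "'a \<Rightarrow> 'a \<Rightarrow> 'a set" where
  "roots x z = {r \<in> V. (cod x r \<ge> 2 / 5 * n \<and> cod z r \<ge> n / 200) \<or> (cod z r \<ge> 2 / 5 * n \<and> cod x r \<ge> n / 200)}"

lemma roots_commute: "roots x z = roots z x"
  by (auto simp: roots_def)

text \<open>Vertices \<open>r\<close> outside \<open>roots x z\<close> have small degree in one of the two links, or degree below
  \<open>2n/5\<close> in both.  With \<open>\<alpha>\<close> the proportion of vertices relevant only to the link of \<open>x\<close>, and
  \<open>\<theta> = 2/5\<close>, this would bound the density of that link by
  \<open>\<alpha>\<^sup>2 + (\<alpha> + \<theta>) (1 - 2 \<alpha>) \<le> 1/4 + \<theta>\<^sup>2 < 7/16\<close>, up to small errors.\<close>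

lemma card_roots_aux:
  assumes x: "x \<in> V"
    and le: "card {r \<in> V. cod z r < n / 200 \<and> cod x r \<ge> n / 200} \<le> card {r \<in> V. cod x r < n / 200}"
  shows "real (card (roots x z)) \<ge> n / 200"
proof (rule ccontr)
  assume "\<not> ?thesis"
  then have g: "real (card (roots x z)) < n / 200" by simp
  define A where "A = {r \<in> V. cod z r < n / 200 \<and> cod x r \<ge> n / 200}"
  define B where "B = {r \<in> V. cod x r < n / 200}"
  define I where "I = {r \<in> V. cod x r \<ge> n / 200 \<and> cod z r \<ge> n / 200 \<and> cod x r < 2 / 5 * n \<and> cod z r < 2 / 5 * n}"
  let ?R = "roots x z"
  have fins: "finite A" "finite B" "finite I" "finite ?R" using fin by (auto simp: A_def B_def I_def roots_def)
  have subs: "A \<subseteq> V" "B \<subseteq> V" "I \<subseteq> V" "?R \<subseteq> V" by (auto simp: A_def B_def I_def roots_def)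
  have cover: "V \<subseteq> A \<union> B \<union> I \<union> ?R" by (auto simp: A_def B_def I_def roots_def not_less)
  have n0: "n > 0" using V0 by simp
  have "card A + card B + card I = card (A \<union> B \<union> I)"
    using fins by (subst card_Un_disjoint; (subst card_Un_disjoint)?) (auto simp: A_def B_def I_def)
  also have "\<dots> \<le> card V" using fin subs by (intro card_mono) auto
  finally have ABI: "real (card A) + real (card B) + real (card I) \<le> n" by linarith
  have leAB: "real (card A) \<le> real (card B)" using le by (simp add: A_def B_def)
  have sB: "(\<Sum>r\<in>B. cod x r) \<le> n\<^sup>2 / 200"
  proof -
    have "(\<Sum>r\<in>B. cod x r) \<le> (\<Sum>r\<in>B. n / 200)" by (intro sum_mono) (auto simp: B_def)
    also have "\<dots> = real (card B) * (n / 200)" by simp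
    also have "\<dots> \<le> n * (n / 200)" using fin subs by (intro mult_right_mono) (auto intro!: card_mono)
    finally show ?thesis by (simp add: power2_eq_square)
  qed
  have sI: "(\<Sum>r\<in>I. cod x r) \<le> 2 / 5 * n * real (card I)"
  proof -
    have "(\<Sum>r\<in>I. cod x r) \<le> (\<Sum>r\<in>I. 2 / 5 * n)" by (intro sum_mono) (auto simp: I_def)
    then show ?thesis by (simp add: mult.commute)
  qed
  have sR: "(\<Sum>r\<in>?R. cod x r) \<le> n\<^sup>2 / 200"
  proof -
    have "(\<Sum>r\<in>?R. cod x r) \<le> (\<Sum>r\<in>?R. n)" by (intro sum_mono cod_le)
    also have "\<dots> = real (card ?R) * n" by simp
    also have "\<dots> \<le> (n / 200) * n" using g by (intro mult_right_mono) auto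
    finally show ?thesis by (simp add: power2_eq_square)
  qed
  have sA: "(\<Sum>r\<in>A. cod x r) \<le> real (card A) * real (card A) + real (card A) * real (card I) + n\<^sup>2 / 100"
  proof -
    let ?L = "\<lambda>Q. {(a, b) \<in> link E V x. b \<in> Q}"
    have "{(a, b) \<in> link E V x. a \<in> A} \<subseteq> (A \<times> A \<union> A \<times> I) \<union> (?L B \<union> ?L ?R)"
      using cover by (auto simp: link_def)
    then have "card {(a, b) \<in> link E V x. a \<in> A} \<le> card ((A \<times> A \<union> A \<times> I) \<union> (?L B \<union> ?L ?R))"
      using fins by (intro card_mono finite_UnI finite_link_sub finite_cartesian_product)
    also have "\<dots> \<le> (card (A \<times> A) + card (A \<times> I)) + (card (?L B) + card (?L ?R))"
      by (rule order_trans[OF card_Un_le add_mono[OF card_Un_le card_Un_le]])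
    finally have "real (card {(a, b) \<in> link E V x. a \<in> A}) \<le>
        real (card A * card A + card A * card I + (card (?L B) + card (?L ?R)))"
      by (simp only: card_cartesian_product of_nat_le_iff)
    also have "\<dots> = real (card A) * real (card A) + real (card A) * real (card I) + ((\<Sum>r\<in>B. cod x r) + (\<Sum>r\<in>?R. cod x r))"
      unfolding card_link_swap using subs by (simp add: sum_cod)
    finally show ?thesis using sB sR subs by (simp add: sum_cod)
  qed
  have "7 / 16 * n\<^sup>2 \<le> (\<Sum>r\<in>V. cod x r)" by (rule sum_cod_all[OF x])
  also have "\<dots> \<le> (\<Sum>r\<in>A. cod x r) + (\<Sum>r\<in>B. cod x r) + (\<Sum>r\<in>I. cod x r) + (\<Sum>r\<in>?R. cod x r)"
    using fins cover by (intro sum_le_cover) auto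
  also have "\<dots> \<le> real (card A) * real (card A) + (real (card A) + 2 / 5 * n) * real (card I) + n\<^sup>2 / 50"
    using sA sB sI sR by (simp add: algebra_simps)
  also have "\<dots> \<le> real (card A) * real (card A) + (real (card A) + 2 / 5 * n) * (n - 2 * real (card A)) + n\<^sup>2 / 50"
    using ABI leAB by (intro add_right_mono add_left_mono mult_left_mono) auto
  \<comment> \<open>The bound 1/4 + (2/5)^2 = 41/100 is attained when \<open>card A\<close> is n/10;
    the small errors add 1/50.\<close>
  also have "\<dots> = 43 / 100 * n\<^sup>2 - (real (card A) - n / 10)\<^sup>2"
    by (simp add: power2_eq_square field_simps)
  also have "\<dots> \<le> 43 / 100 * n\<^sup>2" by simp
  finally have "7 / 16 * n\<^sup>2 \<le> 43 / 100 * n\<^sup>2" .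
  moreover have "n\<^sup>2 > 0" using n0 by simp
  ultimately show False by linarith
qed

text \<open>If the comparison required by the auxiliary lemma fails for \<open>x\<close>, it holds
  with \<open>x\<close> and \<open>z\<close> exchanged, and \<open>roots\<close> is
  symmetric.\<close>

lemma card_roots:
  assumes x: "x \<in> V" and z: "z \<in> V"
  shows "real (card (roots x z)) \<ge> n / 200"
proof (cases "card {r \<in> V. cod z r < n / 200 \<and> cod x r \<ge> n / 200} \<le> card {r \<in> V. cod x r < n / 200}")
  case True
  then show ?thesis using card_roots_aux[OF x] by blast
next
  case False
  have "card {r \<in> V. cod x r < n / 200 \<and> cod z r \<ge> n / 200} \<le> card {r \<in> V. cod x r < n / 200}"
    using fin by (intro card_mono) auto
  also have "\<dots> \<le> card {r \<in> V. cod z r < n / 200 \<and> cod x r \<ge> n / 200}" using False by simp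
  also have "\<dots> \<le> card {r \<in> V. cod z r < n / 200}" using fin by (intro card_mono) auto
  finally have "real (card (roots z x)) \<ge> n / 200" by (rule card_roots_aux[OF z])
  then show ?thesis by (simp add: roots_commute[of x z])
qed

section \<open>Exchanging two vertices through a common root\<close>

lemma swap_pairs_aux:
  assumes r: "r \<in> V" and z: "z \<in> V" and big: "cod x r \<ge> 2 / 5 * n" "cod z r \<ge> n / 200"
  shows "real (card {(p, t) \<in> V \<times> V. {p, x, r} \<in> E \<and> {t, z, r} \<in> E \<and> p \<in> rich t}) \<ge> 1 / 4000 * n\<^sup>2"
proof -
  let ?X = "{p \<in> V. {x, r, p} \<in> E}" and ?Z = "{t \<in> V. {z, r, t} \<in> E}"
  let ?S = "SIGMA t:?Z. ?X \<inter> rich t"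
  have each: "real (card (?X \<inter> rich t)) \<ge> n / 20" if "t \<in> V" for t
  proof -
    have "real (card (?X \<inter> rich t)) \<ge> (2 / 5 + 13 / 20 - 1) * n"
      using big card_rich[OF that] by (intro inter_large rich_subset) (auto simp: codeg_on_def)
    then show ?thesis by simp
  qed
  have "prod.swap ` ?S \<subseteq> {(p, t) \<in> V \<times> V. {p, x, r} \<in> E \<and> {t, z, r} \<in> E \<and> p \<in> rich t}"
    by (auto simp: insert_commute)
  then have "card (prod.swap ` ?S) \<le> card {(p, t) \<in> V \<times> V. {p, x, r} \<in> E \<and> {t, z, r} \<in> E \<and> p \<in> rich t}"
    by (intro card_mono fin_pairs)
  moreover have "card (prod.swap ` ?S) = card ?S" by (intro card_image) auto
  moreover have "card ?S = (\<Sum>t\<in>?Z. card (?X \<inter> rich t))" using fin by (intro card_SigmaI) auto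
  ultimately have "real (\<Sum>t\<in>?Z. card (?X \<inter> rich t)) \<le> real (card {(p, t) \<in> V \<times> V. {p, x, r} \<in> E \<and> {t, z, r} \<in> E \<and> p \<in> rich t})"
    by (simp only: of_nat_le_iff)
  moreover have "(\<Sum>t\<in>?Z. n / 20) \<le> real (\<Sum>t\<in>?Z. card (?X \<inter> rich t))"
    unfolding of_nat_sum by (intro sum_mono each) auto
  moreover have "(\<Sum>t\<in>?Z. n / 20) = cod z r * (n / 20)" by (simp add: codeg_on_def)
  moreover have "cod z r * (n / 20) \<ge> (n / 200) * (n / 20)" using big by (intro mult_right_mono) auto
  moreover have "(n / 200) * (n / 20) = 1 / 4000 * n\<^sup>2" by (simp add: power2_eq_square)
  ultimately show ?thesis by linarith
qed

lemma swap_pairs: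
  assumes x: "x \<in> V" and z: "z \<in> V" and r: "r \<in> roots x z"
  shows "real (card {(p, t) \<in> V \<times> V. {p, x, r} \<in> E \<and> {t, z, r} \<in> E \<and> p \<in> rich t}) \<ge> 1 / 4000 * n\<^sup>2"
proof -
  have rV: "r \<in> V" using r by (auto simp: roots_def)
  consider "cod x r \<ge> 2 / 5 * n" "cod z r \<ge> n / 200" | "cod z r \<ge> 2 / 5 * n" "cod x r \<ge> n / 200"
    using r by (auto simp: roots_def)
  then show ?thesis
  proof cases
    case 1
    then show ?thesis using swap_pairs_aux[OF rV z] by blast
  next
    case 2
    let ?S = "{(p, t) \<in> V \<times> V. {p, z, r} \<in> E \<and> {t, x, r} \<in> E \<and> p \<in> rich t}"
    have "prod.swap ` ?S \<subseteq> {(p, t) \<in> V \<times> V. {p, x, r} \<in> E \<and> {t, z, r} \<in> E \<and> p \<in> rich t}"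
    proof (rule image_subsetI)
      fix y assume "y \<in> ?S"
      then obtain p t where "y = (p, t)" "p \<in> V" "t \<in> V" "{p, z, r} \<in> E" "{t, x, r} \<in> E" "p \<in> rich t" by auto
      moreover from this have "t \<in> rich p" using rich_commute by blast
      ultimately show "prod.swap y \<in> {(p, t) \<in> V \<times> V. {p, x, r} \<in> E \<and> {t, z, r} \<in> E \<and> p \<in> rich t}" by simp
    qed
    then have "card (prod.swap ` ?S) \<le> card {(p, t) \<in> V \<times> V. {p, x, r} \<in> E \<and> {t, z, r} \<in> E \<and> p \<in> rich t}"
      by (intro card_mono fin_pairs)
    moreover have "card (prod.swap ` ?S) = card ?S" by (intro card_image) auto
    ultimately show ?thesis using swap_pairs_aux[OF rV x 2] by linarith
  qed
qed

end

section \<open>Connectors and absorbers\<close>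

text \<open>Five inner vertices make three edges. \<open>i\<close> and \<open>j\<close> stand for
  the colors of the edges that will precede and follow the connector.\<close>

definition linked :: "'a set set \<Rightarrow> ('a set \<Rightarrow> nat) \<Rightarrow> 'a \<Rightarrow> nat \<Rightarrow> 'a \<Rightarrow> nat \<Rightarrow> 'a list \<Rightarrow> bool" where
  "linked E \<phi> u i v j ws \<longleftrightarrow> length ws = 5 \<and> proper_walk E \<phi> (u # ws @ [v]) \<and>
     \<phi> (hd (edges (u # ws @ [v]))) \<noteq> i \<and> \<phi> (last (edges (u # ws @ [v]))) \<noteq> j"

text \<open>The tuples of vertices below are listed in the order in which the vertices are chosen in the counting
  arguments, not in the order in which they appear on the paths.  In the notation of the introduction,
  the \<open>14\<close> entries of an absorber are \<open>y2, b, z1, y1, a, z, r, p, t, s, r2, r3, b2, b3\<close>, where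
  \<open>{r, r2, r3}\<close> and \<open>{b, b2, b3}\<close> are the additional end edges.  The primed paths are those after the
  absorption of \<open>(x, y)\<close>: then \<open>x\<close> replaces \<open>z\<close>, and \<open>z\<close> and \<open>y\<close> are inserted.\<close>

definition connector :: "'a list \<Rightarrow> 'a list" where
  "connector xs = [xs ! 3, xs ! 0, xs ! 1, xs ! 2, xs ! 4]"

definition insert_path :: "'a list \<Rightarrow> 'a list" where
  "insert_path xs = [xs ! 4, xs ! 3, xs ! 2, xs ! 0, xs ! 1, xs ! 12, xs ! 13]"

definition insert_path' :: "'a \<Rightarrow> 'a list \<Rightarrow> 'a list" where
  "insert_path' y xs = [xs ! 4, xs ! 2, xs ! 3, xs ! 5, y, xs ! 0, xs ! 1, xs ! 12, xs ! 13]"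

definition swap_path :: "'a list \<Rightarrow> 'a list" where
  "swap_path xs = [xs ! 9, xs ! 7, xs ! 8, xs ! 5, xs ! 6, xs ! 10, xs ! 11]"

definition swap_path' :: "'a \<Rightarrow> 'a list \<Rightarrow> 'a list" where
  "swap_path' x xs = [xs ! 9, xs ! 8, xs ! 7, x, xs ! 6, xs ! 10, xs ! 11]"

definition absorbs :: "'a set set \<Rightarrow> ('a set \<Rightarrow> nat) \<Rightarrow> 'a \<Rightarrow> 'a \<Rightarrow> 'a list \<Rightarrow> bool" where
  "absorbs E \<phi> x y xs \<longleftrightarrow> proper_walk E \<phi> (insert_path xs) \<and> proper_walk E \<phi> (insert_path' y xs) \<and>
     proper_walk E \<phi> (swap_path xs) \<and> proper_walk E \<phi> (swap_path' x xs)"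

lemma tuples_length: "xs \<in> tuples V k \<Longrightarrow> length xs = k"
  by (simp add: tuples_def)

lemma card_Union_list:
  assumes "\<And>B. B \<in> set Bs \<Longrightarrow> finite B \<and> real (card B) \<le> d"
  shows "finite (\<Union> (set Bs)) \<and> real (card (\<Union> (set Bs))) \<le> real (length Bs) * d"
  using assms
proof (induction Bs)
  case (Cons B Bs)
  have "card (B \<union> \<Union> (set Bs)) \<le> card B + card (\<Union> (set Bs))" by (rule card_Un_le)
  moreover have "finite (\<Union> (set Bs))" "real (card (\<Union> (set Bs))) \<le> real (length Bs) * d" "finite B" "real (card B) \<le> d"
    using Cons by auto
  ultimately show ?case by (simp add: algebra_simps)
qed simp

lemma card_avoid:
  fixes d :: real
  assumes A: "finite A" and Bs: "\<And>B. B \<in> set Bs \<Longrightarrow> finite B \<and> real (card B) \<le> d"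
    and S: "finite S" "A - \<Union> (set Bs) \<subseteq> S"
  shows "real (card S) \<ge> real (card A) - real (length Bs) * d"
proof -
  have "A \<subseteq> S \<union> \<Union> (set Bs)" using S by auto
  then have "card A \<le> card (S \<union> \<Union> (set Bs))" using S card_Union_list[OF Bs] by (intro card_mono) auto
  also have "\<dots> \<le> card S + card (\<Union> (set Bs))" by (rule card_Un_le)
  finally show ?thesis using card_Union_list[OF Bs] by fastforce
qed

context dense_coloring
begin

definition clash :: "nat \<Rightarrow> ('a list \<Rightarrow> 'a) \<Rightarrow> nat \<Rightarrow> nat \<Rightarrow> ('a list \<Rightarrow> nat) \<Rightarrow> 'a list set" where
  "clash k g i j \<chi> = {xs \<in> tuples V k. {g xs, xs ! i, xs ! j} \<in> E \<and> \<phi> {g xs, xs ! i, xs ! j} = \<chi> xs}"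

lemma card_clash:
  assumes "i < k" "j < k" "i \<noteq> j" "\<And>xs. xs \<in> tuples V k \<Longrightarrow> g xs \<in> V"
    "\<And>xs v w. g (xs[i := v, j := w]) = g xs" "\<And>xs v w. \<chi> (xs[i := v, j := w]) = \<chi> xs"
  shows "finite (clash k g i j \<chi>) \<and> real (card (clash k g i j \<chi>)) \<le> c * n ^ k"
proof
  show "finite (clash k g i j \<chi>)" unfolding clash_def using finite_tuples[OF fin] by auto
  show "real (card (clash k g i j \<chi>)) \<le> c * n ^ k"
    unfolding clash_def by (rule sparse_clash[OF fin V0 assms(1-3) col assms(4-6)])
qed

lemma card_nbrs: "{v \<in> V. {x, y, v} \<in> E} \<subseteq> S \<Longrightarrow> finite S \<Longrightarrow> real (card S) \<ge> cod x y"
  unfolding codeg_on_def by (simp add: card_mono)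

text \<open>The joints are chosen first: \<open>xs ! 0\<close> rich for \<open>u\<close>, then an
  edge from it to a vertex \<open>xs ! 2\<close> rich for \<open>v\<close>. Richness leaves linearly
  many choices for the two outer middle vertices. The product of the densities exceeds 1/10^6, and
  after subtracting four clashes of 1/10^7 more than half of it is left.\<close>

lemma card_connectors:
  assumes u: "u \<in> V" and v: "v \<in> V" and c: "c \<le> 1 / 10 ^ 7"
  shows "real (card {xs \<in> tuples V 5. linked E \<phi> u i v j (connector xs)}) \<ge> 1 / (2 * 10 ^ 6) * n ^ 5"
proof -
  define P1 where "P1 xs \<longleftrightarrow> xs ! 0 \<in> rich u" for xs
  define P3 where "P3 xs \<longleftrightarrow> xs ! 0 \<in> rich u \<and> {xs ! 0, xs ! 1, xs ! 2} \<in> E \<and> xs ! 2 \<in> rich v" for xs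
  define P4 where "P4 xs \<longleftrightarrow> P3 xs \<and> {u, xs ! 0, xs ! 3} \<in> E" for xs
  define P5 where "P5 xs \<longleftrightarrow> P4 xs \<and> {v, xs ! 2, xs ! 4} \<in> E" for xs
  have 0: "real (card {xs \<in> tuples V 0. True}) \<ge> 1 * n ^ 0" by (simp add: card_tuples fin)
  have 1: "real (card {xs \<in> tuples V 1. P1 xs}) \<ge> (1 * (13 / 20)) * n ^ 1"
  proof (rule dense_snoc[OF fin _ 0])
    fix xs :: "'a list" assume "xs \<in> tuples V 0"
    then have "{v \<in> V. P1 (xs @ [v])} = rich u" by (auto simp: tuples_def P1_def rich_in_V)
    then show "real (card {v \<in> V. P1 (xs @ [v])}) \<ge> 13 / 20 * n" using card_rich[OF u] by simp
  qed simp_all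
  have 3: "real (card {xs \<in> tuples V 3. P3 xs}) \<ge> (1 * (13 / 20) * (7 / 80)) * n ^ 3"
  proof (rule dense_snoc2[OF fin _ 1])
    fix xs assume xs: "xs \<in> tuples V 1" "P1 xs"
    then have l: "length xs = 1" by (simp add: tuples_length)
    have "{(z, w) \<in> V \<times> V. {xs ! 0, z, w} \<in> E \<and> w \<in> rich v} \<subseteq> {(z, w) \<in> V \<times> V. P3 (xs @ [z, w])}"
      using l xs by (auto simp: P3_def P1_def nth_append)
    then have "card {(z, w) \<in> V \<times> V. {xs ! 0, z, w} \<in> E \<and> w \<in> rich v} \<le> card {(z, w) \<in> V \<times> V. P3 (xs @ [z, w])}"
      by (intro card_mono fin_pairs)
    moreover have "real (card {(z, w) \<in> V \<times> V. {xs ! 0, z, w} \<in> E \<and> w \<in> rich v}) \<ge> 7 / 80 * n\<^sup>2"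
      using xs card_rich[OF v] by (intro link_into rich_subset) (auto simp: tuples_nth)
    ultimately show "real (card {(z, w) \<in> V \<times> V. P3 (xs @ [z, w])}) \<ge> 7 / 80 * n\<^sup>2" by linarith
  qed simp_all
  have 4: "real (card {xs \<in> tuples V 4. P4 xs}) \<ge> (1 * (13 / 20) * (7 / 80) * (1 / 200)) * n ^ 4"
  proof (rule dense_snoc[OF fin _ 3])
    fix xs assume xs: "xs \<in> tuples V 3" "P3 xs"
    then have l: "length xs = 3" by (simp add: tuples_length)
    have "real (card {w \<in> V. P4 (xs @ [w])}) \<ge> cod u (xs ! 0)"
      by (rule card_nbrs) (use l xs fin in \<open>auto simp: P3_def P4_def nth_append\<close>)
    moreover have "cod u (xs ! 0) \<ge> n / 200" using xs unfolding P3_def by (intro rich_cod) simp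
    ultimately show "real (card {w \<in> V. P4 (xs @ [w])}) \<ge> 1 / 200 * n" by linarith
  qed simp_all
  have 5: "real (card {xs \<in> tuples V 5. P5 xs}) \<ge> (1 * (13 / 20) * (7 / 80) * (1 / 200) * (1 / 200)) * n ^ 5"
  proof (rule dense_snoc[OF fin _ 4])
    fix xs assume xs: "xs \<in> tuples V 4" "P4 xs"
    then have l: "length xs = 4" by (simp add: tuples_length)
    have "real (card {w \<in> V. P5 (xs @ [w])}) \<ge> cod v (xs ! 2)"
      by (rule card_nbrs) (use l xs fin in \<open>auto simp: P3_def P4_def P5_def nth_append\<close>)
    moreover have "cod v (xs ! 2) \<ge> n / 200" using xs unfolding P3_def P4_def by (intro rich_cod) simp
    ultimately show "real (card {w \<in> V. P5 (xs @ [w])}) \<ge> 1 / 200 * n" by linarith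
  qed simp_all
  let ?A = "{xs \<in> tuples V 5. P5 xs}" and ?S = "{xs \<in> tuples V 5. linked E \<phi> u i v j (connector xs)}"
  \<comment> \<open>The middle edge is compared with the first one by varying \<open>xs ! 1\<close>
    and \<open>xs ! 2\<close>, and with the last one by varying \<open>xs ! 0\<close> and
    \<open>xs ! 1\<close>. The outer edges each have two free vertices against the prescribed
    colors.\<close>
  define Bs where "Bs = [clash 5 (\<lambda>_. u) 0 3 (\<lambda>_. i), clash 5 (\<lambda>xs. xs ! 0) 1 2 (\<lambda>xs. \<phi> {u, xs ! 0, xs ! 3}),
    clash 5 (\<lambda>xs. xs ! 2) 0 1 (\<lambda>xs. \<phi> {v, xs ! 2, xs ! 4}), clash 5 (\<lambda>_. v) 2 4 (\<lambda>_. j)]"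
  have "finite B \<and> real (card B) \<le> c * n ^ 5" if "B \<in> set Bs" for B
  proof -
    have "finite (clash 5 (\<lambda>_. u) 0 3 (\<lambda>_. i)) \<and> real (card (clash 5 (\<lambda>_. u) 0 3 (\<lambda>_. i))) \<le> c * n ^ 5"
      using u by (intro card_clash) auto
    moreover have "finite (clash 5 (\<lambda>_. v) 2 4 (\<lambda>_. j)) \<and> real (card (clash 5 (\<lambda>_. v) 2 4 (\<lambda>_. j))) \<le> c * n ^ 5"
      using v by (intro card_clash) auto
    moreover have "finite (clash 5 (\<lambda>xs. xs ! 0) 1 2 (\<lambda>xs. \<phi> {u, xs ! 0, xs ! 3})) \<and>
        real (card (clash 5 (\<lambda>xs. xs ! 0) 1 2 (\<lambda>xs. \<phi> {u, xs ! 0, xs ! 3}))) \<le> c * n ^ 5"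
      by (intro card_clash) (auto simp: tuples_nth)
    moreover have "finite (clash 5 (\<lambda>xs. xs ! 2) 0 1 (\<lambda>xs. \<phi> {v, xs ! 2, xs ! 4})) \<and>
        real (card (clash 5 (\<lambda>xs. xs ! 2) 0 1 (\<lambda>xs. \<phi> {v, xs ! 2, xs ! 4}))) \<le> c * n ^ 5"
      by (intro card_clash) (auto simp: tuples_nth)
    ultimately show ?thesis using that unfolding Bs_def by auto
  qed
  moreover have "?A - \<Union> (set Bs) \<subseteq> ?S"
  proof
    fix xs assume "xs \<in> ?A - \<Union> (set Bs)"
    then have xs: "xs \<in> tuples V 5" "P5 xs" "xs \<notin> \<Union> (set Bs)" by auto
    have e: "{u, xs ! 0, xs ! 3} \<in> E" "{xs ! 0, xs ! 1, xs ! 2} \<in> E" "{v, xs ! 2, xs ! 4} \<in> E"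
      using xs(2) by (auto simp: P5_def P4_def P3_def)
    have c: "\<phi> {u, xs ! 0, xs ! 3} \<noteq> i" "\<phi> {xs ! 0, xs ! 1, xs ! 2} \<noteq> \<phi> {u, xs ! 0, xs ! 3}"
      "\<phi> {xs ! 0, xs ! 1, xs ! 2} \<noteq> \<phi> {v, xs ! 2, xs ! 4}" "\<phi> {v, xs ! 2, xs ! 4} \<noteq> j"
      using xs(3) e xs(1) by (auto simp: Bs_def clash_def insert_commute)
    show "xs \<in> ?S" using xs(1) e c
      by (auto simp: linked_def connector_def proper_walk_def insert_commute)
  qed
  ultimately have "real (card ?S) \<ge> real (card ?A) - real (length Bs) * (c * n ^ 5)"
    using finite_tuples[OF fin] by (intro card_avoid) auto
  moreover have "real (card ?A) \<ge> 1 / 10 ^ 6 * n ^ 5"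
  proof -
    have "real (card ?A) \<ge> 91 / 64000000 * n ^ 5" using 5 by simp
    moreover have "91 / 64000000 * n ^ 5 \<ge> 1 / 10 ^ 6 * n ^ 5" by (intro mult_right_mono) auto
    ultimately show ?thesis by linarith
  qed
  moreover have "c * n ^ 5 \<le> 1 / 10 ^ 7 * n ^ 5" using c by (intro mult_right_mono) auto
  moreover have "real (length Bs) = 4" by (simp add: Bs_def)
  ultimately show ?thesis by simp
qed

text \<open>\<open>y2\<close> has codegree at least 2n/5 with \<open>y\<close>, so that
  \<open>b\<close> can complete an edge with them and still be rich for \<open>y2\<close>.
  \<open>y1\<close> is rich for both \<open>z1\<close> and \<open>y\<close>, which is possible as
  13/20 + 13/20 > 1. Now \<open>z\<close> ranges over the vertices completing \<open>y\<close> and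
  \<open>y1\<close>, and the exchange of \<open>x\<close> and \<open>z\<close> starts from one of
  their roots. The product of the densities exceeds 8/10^20; nine clashes of 1/10^21 are
  subtracted.\<close>

lemma card_absorbers:
  assumes x: "x \<in> V" and y: "y \<in> V" and c: "c \<le> 1 / 10 ^ 21"
  shows "real (card {xs \<in> tuples V 14. absorbs E \<phi> x y xs}) \<ge> 7 / 10 ^ 20 * n ^ 14"
proof -
  define P1 where "P1 xs \<longleftrightarrow> cod y (xs ! 0) \<ge> 2 / 5 * n" for xs
  define P2 where "P2 xs \<longleftrightarrow> {y, xs ! 0, xs ! 1} \<in> E \<and> xs ! 1 \<in> rich (xs ! 0)" for xs
  define P3 where "P3 xs \<longleftrightarrow> P2 xs \<and> {xs ! 0, xs ! 1, xs ! 2} \<in> E" for xs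
  define P4 where "P4 xs \<longleftrightarrow> P3 xs \<and> xs ! 3 \<in> rich (xs ! 2) \<and> xs ! 3 \<in> rich y" for xs
  define P5 where "P5 xs \<longleftrightarrow> P4 xs \<and> {xs ! 2, xs ! 3, xs ! 4} \<in> E" for xs
  define P6 where "P6 xs \<longleftrightarrow> P5 xs \<and> {y, xs ! 3, xs ! 5} \<in> E" for xs
  define P7 where "P7 xs \<longleftrightarrow> P6 xs \<and> xs ! 6 \<in> roots x (xs ! 5)" for xs
  define P9 where "P9 xs \<longleftrightarrow> P6 xs \<and> {xs ! 7, x, xs ! 6} \<in> E \<and> {xs ! 8, xs ! 5, xs ! 6} \<in> E \<and> xs ! 7 \<in> rich (xs ! 8)" for xs
  define P10 where "P10 xs \<longleftrightarrow> P9 xs \<and> {xs ! 8, xs ! 7, xs ! 9} \<in> E" for xs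
  define P12 where "P12 xs \<longleftrightarrow> P10 xs \<and> {xs ! 6, xs ! 10, xs ! 11} \<in> E" for xs
  define P14 where "P14 xs \<longleftrightarrow> P12 xs \<and> {xs ! 1, xs ! 12, xs ! 13} \<in> E" for xs
  note defs = P1_def P2_def P3_def P4_def P5_def P6_def P7_def P9_def P10_def P12_def P14_def
  have 0: "real (card {xs \<in> tuples V 0. True}) \<ge> 1 * n ^ 0" by (simp add: card_tuples fin)
  have 1: "real (card {xs \<in> tuples V 1. P1 xs}) \<ge> (1 * (3 / 80)) * n ^ 1"
  proof (rule dense_snoc[OF fin _ 0])
    fix xs :: "'a list" assume "xs \<in> tuples V 0"
    then have eq: "{v \<in> V. P1 (xs @ [v])} = {v \<in> V. cod y v \<ge> 2 / 5 * n}" by (auto simp: tuples_def P1_def)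
    \<comment> \<open>Averaging: vertices outside \<open>?D\<close> contribute at most 2/5 n^2 to
      the sum of codegrees, and 7/16 - 2/5 = 3/80.\<close>
    let ?D = "{v \<in> V. cod y v \<ge> 2 / 5 * n}"
    have "7 / 16 * n\<^sup>2 \<le> (\<Sum>v\<in>V. cod y v)" by (rule sum_cod_all[OF y])
    also have "\<dots> = (\<Sum>v\<in>?D. cod y v) + (\<Sum>v\<in>V - ?D. cod y v)"
      using fin by (subst sum.subset_diff[of ?D V]) auto
    also have "\<dots> \<le> (\<Sum>v\<in>?D. n) + (\<Sum>v\<in>V - ?D. 2 / 5 * n)"
      by (intro add_mono sum_mono cod_le) auto
    also have "\<dots> = real (card ?D) * n + real (card (V - ?D)) * (2 / 5 * n)" by simp
    also have "\<dots> \<le> real (card ?D) * n + n * (2 / 5 * n)"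
      using fin by (intro add_left_mono mult_right_mono) (auto intro!: card_mono)
    finally have "(3 / 80 * n) * n \<le> real (card ?D) * n" by (simp add: power2_eq_square)
    then show "real (card {v \<in> V. P1 (xs @ [v])}) \<ge> 3 / 80 * n" using V0 eq by simp
  qed simp_all
  have 2: "real (card {xs \<in> tuples V 2. P2 xs}) \<ge> (1 * (3 / 80) * (1 / 20)) * n ^ 2"
  proof (rule dense_snoc[OF fin _ 1])
    fix xs assume xs: "xs \<in> tuples V 1" "P1 xs"
    then have l: "length xs = 1" by (simp add: tuples_length)
    have "real (card ({v \<in> V. {y, xs ! 0, v} \<in> E} \<inter> rich (xs ! 0))) \<ge> (2 / 5 + 13 / 20 - 1) * n"
      using xs by (intro inter_large rich_subset card_rich) (auto simp: tuples_nth P1_def codeg_on_def)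
    moreover have "{v \<in> V. {y, xs ! 0, v} \<in> E} \<inter> rich (xs ! 0) \<subseteq> {v \<in> V. P2 (xs @ [v])}"
      using l by (auto simp: P2_def nth_append)
    then have "card ({v \<in> V. {y, xs ! 0, v} \<in> E} \<inter> rich (xs ! 0)) \<le> card {v \<in> V. P2 (xs @ [v])}"
      using fin by (intro card_mono) auto
    moreover have "(2 / 5 + 13 / 20 - 1) * n = 1 / 20 * n" by simp
    ultimately show "real (card {v \<in> V. P2 (xs @ [v])}) \<ge> 1 / 20 * n" by linarith
  qed simp_all
  have 3: "real (card {xs \<in> tuples V 3. P3 xs}) \<ge> (1 * (3 / 80) * (1 / 20) * (1 / 200)) * n ^ 3"
  proof (rule dense_snoc[OF fin _ 2])
    fix xs assume xs: "xs \<in> tuples V 2" "P2 xs"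
    then have l: "length xs = 2" by (simp add: tuples_length)
    have "real (card {w \<in> V. P3 (xs @ [w])}) \<ge> cod (xs ! 0) (xs ! 1)"
      by (rule card_nbrs) (use l xs fin in \<open>auto simp: defs nth_append\<close>)
    moreover have "cod (xs ! 0) (xs ! 1) \<ge> n / 200" using xs unfolding defs by (intro rich_cod) simp
    ultimately show "real (card {w \<in> V. P3 (xs @ [w])}) \<ge> 1 / 200 * n" by linarith
  qed simp_all
  have 4: "real (card {xs \<in> tuples V 4. P4 xs}) \<ge> (1 * (3 / 80) * (1 / 20) * (1 / 200) * (3 / 10)) * n ^ 4"
  proof (rule dense_snoc[OF fin _ 3])
    fix xs assume xs: "xs \<in> tuples V 3" "P3 xs"
    then have l: "length xs = 3" by (simp add: tuples_length)
    have "real (card (rich (xs ! 2) \<inter> rich y)) \<ge> (13 / 20 + 13 / 20 - 1) * n"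
      using xs y by (intro inter_large rich_subset card_rich) (auto simp: tuples_nth)
    moreover have "rich (xs ! 2) \<inter> rich y \<subseteq> {v \<in> V. P4 (xs @ [v])}"
      using l xs by (auto simp: defs nth_append rich_in_V)
    then have "card (rich (xs ! 2) \<inter> rich y) \<le> card {v \<in> V. P4 (xs @ [v])}"
      using fin by (intro card_mono) auto
    moreover have "(13 / 20 + 13 / 20 - 1) * n = 3 / 10 * n" by simp
    ultimately show "real (card {v \<in> V. P4 (xs @ [v])}) \<ge> 3 / 10 * n" by linarith
  qed simp_all
  have 5: "real (card {xs \<in> tuples V 5. P5 xs}) \<ge> (1 * (3 / 80) * (1 / 20) * (1 / 200) * (3 / 10) * (1 / 200)) * n ^ 5"
  proof (rule dense_snoc[OF fin _ 4])
    fix xs assume xs: "xs \<in> tuples V 4" "P4 xs"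
    then have l: "length xs = 4" by (simp add: tuples_length)
    have "real (card {w \<in> V. P5 (xs @ [w])}) \<ge> cod (xs ! 2) (xs ! 3)"
      by (rule card_nbrs) (use l xs fin in \<open>auto simp: defs nth_append\<close>)
    moreover have "cod (xs ! 2) (xs ! 3) \<ge> n / 200" using xs unfolding defs by (intro rich_cod) simp
    ultimately show "real (card {w \<in> V. P5 (xs @ [w])}) \<ge> 1 / 200 * n" by linarith
  qed simp_all
  have 6: "real (card {xs \<in> tuples V 6. P6 xs}) \<ge> (1 * (3 / 80) * (1 / 20) * (1 / 200) * (3 / 10) * (1 / 200) * (1 / 200)) * n ^ 6"
  proof (rule dense_snoc[OF fin _ 5])
    fix xs assume xs: "xs \<in> tuples V 5" "P5 xs"
    then have l: "length xs = 5" by (simp add: tuples_length)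
    have "real (card {w \<in> V. P6 (xs @ [w])}) \<ge> cod y (xs ! 3)"
      by (rule card_nbrs) (use l xs fin in \<open>auto simp: defs nth_append\<close>)
    moreover have "cod y (xs ! 3) \<ge> n / 200" using xs unfolding defs by (intro rich_cod) simp
    ultimately show "real (card {w \<in> V. P6 (xs @ [w])}) \<ge> 1 / 200 * n" by linarith
  qed simp_all
  have 7: "real (card {xs \<in> tuples V 7. P7 xs}) \<ge> (1 * (3 / 80) * (1 / 20) * (1 / 200) * (3 / 10) * (1 / 200) * (1 / 200) * (1 / 200)) * n ^ 7"
  proof (rule dense_snoc[OF fin _ 6])
    fix xs assume xs: "xs \<in> tuples V 6" "P6 xs"
    then have l: "length xs = 6" by (simp add: tuples_length)
    have "roots x (xs ! 5) \<subseteq> {v \<in> V. P7 (xs @ [v])}"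
      using l xs by (auto simp: defs nth_append roots_def)
    then have "card (roots x (xs ! 5)) \<le> card {v \<in> V. P7 (xs @ [v])}"
      using fin by (intro card_mono) auto
    moreover have "real (card (roots x (xs ! 5))) \<ge> n / 200"
      using xs by (intro card_roots x) (auto simp: tuples_nth)
    ultimately show "real (card {v \<in> V. P7 (xs @ [v])}) \<ge> 1 / 200 * n" by linarith
  qed simp_all
  have 9: "real (card {xs \<in> tuples V 9. P9 xs}) \<ge> (1 * (3 / 80) * (1 / 20) * (1 / 200) * (3 / 10) * (1 / 200) * (1 / 200) * (1 / 200) * (1 / 4000)) * n ^ 9"
  proof (rule dense_snoc2[OF fin _ 7])
    fix xs assume xs: "xs \<in> tuples V 7" "P7 xs"
    then have l: "length xs = 7" by (simp add: tuples_length)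
    let ?S = "{(p, t) \<in> V \<times> V. {p, x, xs ! 6} \<in> E \<and> {t, xs ! 5, xs ! 6} \<in> E \<and> p \<in> rich t}"
    have "?S \<subseteq> {(v, w) \<in> V \<times> V. P9 (xs @ [v, w])}"
      using l xs by (auto simp: defs nth_append)
    then have "card ?S \<le> card {(v, w) \<in> V \<times> V. P9 (xs @ [v, w])}" by (intro card_mono fin_pairs)
    moreover have "real (card ?S) \<ge> 1 / 4000 * n\<^sup>2"
      using xs by (intro swap_pairs x) (auto simp: tuples_nth P7_def)
    ultimately show "real (card {(v, w) \<in> V \<times> V. P9 (xs @ [v, w])}) \<ge> 1 / 4000 * n\<^sup>2" by linarith
  qed simp_all
  have 10: "real (card {xs \<in> tuples V 10. P10 xs}) \<ge> (1 * (3 / 80) * (1 / 20) * (1 / 200) * (3 / 10) * (1 / 200) * (1 / 200) * (1 / 200) * (1 / 4000) * (1 / 200)) * n ^ 10"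
  proof (rule dense_snoc[OF fin _ 9])
    fix xs assume xs: "xs \<in> tuples V 9" "P9 xs"
    then have l: "length xs = 9" by (simp add: tuples_length)
    have "real (card {w \<in> V. P10 (xs @ [w])}) \<ge> cod (xs ! 8) (xs ! 7)"
      by (rule card_nbrs) (use l xs fin in \<open>auto simp: defs nth_append\<close>)
    moreover have "cod (xs ! 8) (xs ! 7) \<ge> n / 200" using xs unfolding P9_def by (intro rich_cod) simp
    ultimately show "real (card {w \<in> V. P10 (xs @ [w])}) \<ge> 1 / 200 * n" by linarith
  qed simp_all
  have 12: "real (card {xs \<in> tuples V 12. P12 xs}) \<ge> (1 * (3 / 80) * (1 / 20) * (1 / 200) * (3 / 10) * (1 / 200) * (1 / 200) * (1 / 200) * (1 / 4000) * (1 / 200) * (7 / 16)) * n ^ 12"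
  proof (rule dense_snoc2[OF fin _ 10])
    fix xs assume xs: "xs \<in> tuples V 10" "P10 xs"
    then have l: "length xs = 10" by (simp add: tuples_length)
    have "link E V (xs ! 6) \<subseteq> {(v, w) \<in> V \<times> V. P12 (xs @ [v, w])}"
      using l xs by (auto simp: defs nth_append link_def)
    then have "card (link E V (xs ! 6)) \<le> card {(v, w) \<in> V \<times> V. P12 (xs @ [v, w])}" by (intro card_mono fin_pairs)
    moreover have "real (card (link E V (xs ! 6))) \<ge> 7 / 16 * n\<^sup>2"
      using xs by (intro deg) (auto simp: tuples_nth)
    ultimately show "real (card {(v, w) \<in> V \<times> V. P12 (xs @ [v, w])}) \<ge> 7 / 16 * n\<^sup>2" by linarith
  qed simp_all
  have 14: "real (card {xs \<in> tuples V 14. P14 xs}) \<ge> (1 * (3 / 80) * (1 / 20) * (1 / 200) * (3 / 10) * (1 / 200) * (1 / 200) * (1 / 200) * (1 / 4000) * (1 / 200) * (7 / 16) * (7 / 16)) * n ^ 14"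
  proof (rule dense_snoc2[OF fin _ 12])
    fix xs assume xs: "xs \<in> tuples V 12" "P12 xs"
    then have l: "length xs = 12" by (simp add: tuples_length)
    have "link E V (xs ! 1) \<subseteq> {(v, w) \<in> V \<times> V. P14 (xs @ [v, w])}"
      using l xs by (auto simp: defs nth_append link_def)
    then have "card (link E V (xs ! 1)) \<le> card {(v, w) \<in> V \<times> V. P14 (xs @ [v, w])}" by (intro card_mono fin_pairs)
    moreover have "real (card (link E V (xs ! 1))) \<ge> 7 / 16 * n\<^sup>2"
      using xs by (intro deg) (auto simp: tuples_nth)
    ultimately show "real (card {(v, w) \<in> V \<times> V. P14 (xs @ [v, w])}) \<ge> 7 / 16 * n\<^sup>2" by linarith
  qed simp_all
  let ?A = "{xs \<in> tuples V 14. P14 xs}" and ?S = "{xs \<in> tuples V 14. absorbs E \<phi> x y xs}"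
  let ?C = "clash 14"
  \<comment> \<open>One set for each of the nine pairs of successive edges on the four paths. The
    two coordinates to be varied lie on one edge of the pair and off the other.\<close>
  define B1 where "B1 = ?C (\<lambda>xs. xs ! 2) 3 4 (\<lambda>xs. \<phi> {xs ! 0, xs ! 1, xs ! 2})"
  define B2 where "B2 = ?C (\<lambda>xs. xs ! 1) 12 13 (\<lambda>xs. \<phi> {xs ! 0, xs ! 1, xs ! 2})"
  define B3 where "B3 = ?C (\<lambda>xs. xs ! 3) 2 4 (\<lambda>xs. \<phi> {y, xs ! 3, xs ! 5})"
  define B4 where "B4 = ?C (\<lambda>xs. y) 3 5 (\<lambda>xs. \<phi> {y, xs ! 0, xs ! 1})"
  define B5 where "B5 = ?C (\<lambda>xs. xs ! 1) 12 13 (\<lambda>xs. \<phi> {y, xs ! 0, xs ! 1})"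
  define B6 where "B6 = ?C (\<lambda>xs. xs ! 8) 7 9 (\<lambda>xs. \<phi> {xs ! 8, xs ! 5, xs ! 6})"
  define B7 where "B7 = ?C (\<lambda>xs. xs ! 6) 10 11 (\<lambda>xs. \<phi> {xs ! 8, xs ! 5, xs ! 6})"
  define B8 where "B8 = ?C (\<lambda>xs. xs ! 7) 8 9 (\<lambda>xs. \<phi> {xs ! 7, x, xs ! 6})"
  define B9 where "B9 = ?C (\<lambda>xs. xs ! 6) 10 11 (\<lambda>xs. \<phi> {xs ! 7, x, xs ! 6})"
  define Bs where "Bs = [B1, B2, B3, B4, B5, B6, B7, B8, B9]"
  have small: "finite B1 \<and> real (card B1) \<le> c * n ^ 14" "finite B2 \<and> real (card B2) \<le> c * n ^ 14"
     "finite B3 \<and> real (card B3) \<le> c * n ^ 14" "finite B4 \<and> real (card B4) \<le> c * n ^ 14"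
     "finite B5 \<and> real (card B5) \<le> c * n ^ 14" "finite B6 \<and> real (card B6) \<le> c * n ^ 14"
     "finite B7 \<and> real (card B7) \<le> c * n ^ 14" "finite B8 \<and> real (card B8) \<le> c * n ^ 14"
     "finite B9 \<and> real (card B9) \<le> c * n ^ 14"
    unfolding B1_def B2_def B3_def B4_def B5_def B6_def B7_def B8_def B9_def
    by (rule card_clash; use y in \<open>simp add: tuples_nth\<close>)+
  then have "finite B \<and> real (card B) \<le> c * n ^ 14" if "B \<in> set Bs" for B
    using that unfolding Bs_def by auto
  moreover have "?A - \<Union> (set Bs) \<subseteq> ?S"
  proof
    fix xs assume "xs \<in> ?A - \<Union> (set Bs)"
    then have xs: "xs \<in> tuples V 14" "P14 xs" "xs \<notin> \<Union> (set Bs)" by auto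
    have e: "{y, xs ! 0, xs ! 1} \<in> E" "{xs ! 0, xs ! 1, xs ! 2} \<in> E" "{xs ! 2, xs ! 3, xs ! 4} \<in> E"
      "{y, xs ! 3, xs ! 5} \<in> E" "{xs ! 7, x, xs ! 6} \<in> E" "{xs ! 8, xs ! 5, xs ! 6} \<in> E"
      "{xs ! 8, xs ! 7, xs ! 9} \<in> E" "{xs ! 6, xs ! 10, xs ! 11} \<in> E" "{xs ! 1, xs ! 12, xs ! 13} \<in> E"
      using xs(2) unfolding defs by simp_all
    have nb: "xs \<notin> B1" "xs \<notin> B2" "xs \<notin> B3" "xs \<notin> B4" "xs \<notin> B5" "xs \<notin> B6" "xs \<notin> B7" "xs \<notin> B8" "xs \<notin> B9"
      using xs(3) by (simp_all add: Bs_def)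
    have c: "\<phi> {xs ! 2, xs ! 3, xs ! 4} \<noteq> \<phi> {xs ! 0, xs ! 1, xs ! 2}"
      "\<phi> {xs ! 1, xs ! 12, xs ! 13} \<noteq> \<phi> {xs ! 0, xs ! 1, xs ! 2}"
      "\<phi> {xs ! 2, xs ! 3, xs ! 4} \<noteq> \<phi> {y, xs ! 3, xs ! 5}"
      "\<phi> {y, xs ! 3, xs ! 5} \<noteq> \<phi> {y, xs ! 0, xs ! 1}"
      "\<phi> {xs ! 1, xs ! 12, xs ! 13} \<noteq> \<phi> {y, xs ! 0, xs ! 1}"
      "\<phi> {xs ! 8, xs ! 7, xs ! 9} \<noteq> \<phi> {xs ! 8, xs ! 5, xs ! 6}"
      "\<phi> {xs ! 6, xs ! 10, xs ! 11} \<noteq> \<phi> {xs ! 8, xs ! 5, xs ! 6}"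
      "\<phi> {xs ! 8, xs ! 7, xs ! 9} \<noteq> \<phi> {xs ! 7, x, xs ! 6}"
      "\<phi> {xs ! 6, xs ! 10, xs ! 11} \<noteq> \<phi> {xs ! 7, x, xs ! 6}"
      using nb e xs(1)
      by (simp_all add: B1_def B2_def B3_def B4_def B5_def B6_def B7_def B8_def B9_def clash_def insert_commute)
    show "xs \<in> ?S" using xs(1) e c
      by (simp add: absorbs_def insert_path_def insert_path'_def swap_path_def swap_path'_def proper_walk_def insert_commute)
  qed
  ultimately have "real (card ?S) \<ge> real (card ?A) - real (length Bs) * (c * n ^ 14)"
    using finite_tuples[OF fin] by (intro card_avoid) auto
  moreover have "real (card ?A) \<ge> 8 / 10 ^ 20 * n ^ 14"
  proof -
    have "(8 / 10 ^ 20) * n ^ 14 \<le> (1 * (3 / 80) * (1 / 20) * (1 / 200) * (3 / 10) * (1 / 200) * (1 / 200) * (1 / 200) * (1 / 4000) * (1 / 200) * (7 / 16) * (7 / 16)) * n ^ 14"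
      by (intro mult_right_mono) auto
    then show ?thesis using 14 by linarith
  qed
  moreover have "c * n ^ 14 \<le> 1 / 10 ^ 21 * n ^ 14" using c by (intro mult_right_mono) auto
  moreover have "real (length Bs) = 9" by (simp add: Bs_def)
  ultimately show ?thesis by simp
qed

end

section \<open>Selecting a balanced disjoint family\<close>

text \<open>The tuples are chosen one at a time, each minimizing the sum of \<open>(1/2)^hits j\<close> over all \<open>j\<close>, where
  \<open>hits j\<close> is the number of tuples in \<open>A j\<close> chosen so far.\<close>

lemma greedy_selection:
  fixes \<beta> :: real
  assumes fin: "finite V" and V0: "card V > 0" and J: "finite J" "J \<noteq> {}"
    and A: "\<And>j. j \<in> J \<Longrightarrow> A j \<subseteq> tuples V k" "\<And>j. j \<in> J \<Longrightarrow> real (card (A j)) \<ge> \<beta> * real (card V) ^ k"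
    and U: "finite U" and beta: "0 < \<beta>" "\<beta> \<le> 1"
    and m: "(real k * (real (card U) + real k * real m) + (real k)\<^sup>2) / real (card V) \<le> \<beta> / 2"
  shows "\<exists>Fs. length Fs = m \<and> distinct (concat Fs) \<and> set (concat Fs) \<inter> U = {} \<and>
     (\<forall>F\<in>set Fs. \<exists>j\<in>J. F \<in> A j) \<and>
     (\<Sum>j\<in>J. (1 / 2) ^ length (filter (\<lambda>F. F \<in> A j) Fs)) \<le> real (card J) * (1 - \<beta> / 4) ^ m"
  using m
proof (induction m)
  case 0
  show ?case by (intro exI[of _ "[]"]) simp
next
  case (Suc m)
  let ?n = "real (card V)"
  have n0: "?n > 0" using V0 by simp
  have mono: "(real k * (real (card U) + real k * real m) + (real k)\<^sup>2) / ?n \<le> (real k * (real (card U) + real k * real (Suc m)) + (real k)\<^sup>2) / ?n"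
    using n0 by (intro divide_right_mono add_right_mono mult_left_mono add_left_mono) auto
  then obtain Fs where Fs: "length Fs = m" "distinct (concat Fs)" "set (concat Fs) \<inter> U = {}"
     "\<And>F. F \<in> set Fs \<Longrightarrow> \<exists>j\<in>J. F \<in> A j"
     "(\<Sum>j\<in>J. (1 / 2) ^ length (filter (\<lambda>F. F \<in> A j) Fs)) \<le> real (card J) * (1 - \<beta> / 4) ^ m"
    using Suc.IH[OF order_trans[OF mono Suc.prems]] by blast
  define \<psi> :: "'b \<Rightarrow> real" where "\<psi> j = (1 / 2) ^ length (filter (\<lambda>F. F \<in> A j) Fs)" for j
  define \<Phi> where "\<Phi> = (\<Sum>j\<in>J. \<psi> j)"
  define W where "W = U \<union> set (concat Fs)"
  define free where "free j = {F \<in> A j. distinct F \<and> set F \<inter> W = {}}" for j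
  define X where "X = (\<Union>j\<in>J. free j)"
  have finW: "finite W" using U by (simp add: W_def)
  have lenF: "length F = k" if "F \<in> set Fs" for F using Fs(4)[OF that] A(1) by (auto simp: tuples_def)
  have "length (concat Fs) = length Fs * k" using lenF by (induction Fs) auto
  then have "card (set (concat Fs)) = m * k" using Fs(1,2) distinct_card by metis
  then have "card W \<le> card U + m * k" unfolding W_def using card_Un_le[of U "set (concat Fs)"] by simp
  then have cW: "real (card W) \<le> real (card U) + real k * real m" by (metis of_nat_add of_nat_le_iff of_nat_mult mult.commute)
  have free: "real (card (free j)) \<ge> \<beta> / 2 * ?n ^ k" if j: "j \<in> J" for j
  proof -
    have "real (card (free j)) \<ge> real (card (A j)) - (real k * real (card W) + (real k)\<^sup>2) / ?n * ?n ^ k"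
      unfolding free_def by (rule card_free[OF fin V0 A(1)[OF j] finW])
    moreover have "(real k * real (card W) + (real k)\<^sup>2) / ?n * ?n ^ k \<le> \<beta> / 2 * ?n ^ k"
    proof (intro mult_right_mono)
      have "(real k * real (card W) + (real k)\<^sup>2) / ?n \<le> (real k * (real (card U) + real k * real m) + (real k)\<^sup>2) / ?n"
        using cW n0 by (intro divide_right_mono add_right_mono mult_left_mono) auto
      then show "(real k * real (card W) + (real k)\<^sup>2) / ?n \<le> \<beta> / 2" using order_trans[OF mono Suc.prems] by linarith
    qed simp
    moreover have "\<beta> / 2 * ?n ^ k + \<beta> / 2 * ?n ^ k = \<beta> * ?n ^ k" by (simp add: field_simps)
    ultimately show ?thesis using A(2)[OF j] by linarith
  qed
  have fsub: "free j \<subseteq> X" "free j \<subseteq> A j" if "j \<in> J" for j using that by (auto simp: X_def free_def)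
  have Xt: "X \<subseteq> tuples V k" using A(1) by (auto simp: X_def free_def)
  have finX: "finite X" using Xt finite_tuples[OF fin] finite_subset by metis
  have cX: "real (card X) \<le> ?n ^ k"
  proof -
    have "card X \<le> card (tuples V k)" using Xt finite_tuples[OF fin] by (intro card_mono)
    then show ?thesis using fin by (simp add: card_tuples)
  qed
  have psi0: "\<psi> j > 0" for j by (simp add: \<psi>_def)
  have Phi0: "\<Phi> > 0" unfolding \<Phi>_def using J psi0 by (intro sum_pos) auto
  define g where "g F = (\<Sum>j\<in>J. if F \<in> A j then \<psi> j else 0)" for F
  \<comment> \<open>Averaging over \<open>X\<close>, which has at most n^k elements: each
    \<open>A j\<close> retains \<beta>/2 n^k free tuples, so some tuple carries the proportion
    \<beta>/2 of the potential. A hit halves a term, so the potential drops by the proportion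
    \<beta>/4.\<close>
  have "\<exists>F\<in>X. g F \<ge> \<beta> / 2 * \<Phi>"
  proof (rule ccontr)
    assume "\<not> ?thesis"
    then have lt: "\<And>F. F \<in> X \<Longrightarrow> g F < \<beta> / 2 * \<Phi>" by force
    obtain j where j: "j \<in> J" using J by auto
    have "real (card (free j)) > 0" using free[OF j] beta n0 by (smt (verit) divide_pos_pos mult_pos_pos zero_less_power)
    then have "X \<noteq> {}" using fsub(1)[OF j] by auto
    then have "(\<Sum>F\<in>X. g F) < (\<Sum>F\<in>X. \<beta> / 2 * \<Phi>)" using lt finX by (intro sum_strict_mono) auto
    also have "\<dots> = real (card X) * (\<beta> / 2 * \<Phi>)" by simp
    also have "\<dots> \<le> ?n ^ k * (\<beta> / 2 * \<Phi>)" using cX beta Phi0 by (intro mult_right_mono) auto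
    finally have "(\<Sum>F\<in>X. g F) < ?n ^ k * (\<beta> / 2 * \<Phi>)" .
    moreover have "(\<Sum>F\<in>X. g F) = (\<Sum>j\<in>J. \<Sum>F\<in>X. if F \<in> A j then \<psi> j else 0)"
      unfolding g_def by (rule sum.swap)
    moreover have "(\<Sum>j\<in>J. \<Sum>F\<in>X. if F \<in> A j then \<psi> j else 0) \<ge> (\<Sum>j\<in>J. \<beta> / 2 * ?n ^ k * \<psi> j)"
    proof (intro sum_mono)
      fix j assume j: "j \<in> J"
      have "\<beta> / 2 * ?n ^ k * \<psi> j \<le> real (card (free j)) * \<psi> j"
        using free[OF j] psi0[of j] by (intro mult_right_mono) auto
      also have "\<dots> = (\<Sum>F\<in>free j. if F \<in> A j then \<psi> j else 0)"
        by (simp add: free_def)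
      also have "\<dots> \<le> (\<Sum>F\<in>X. if F \<in> A j then \<psi> j else 0)"
        using finX fsub(1)[OF j] psi0[of j] by (intro sum_mono2) auto
      finally show "\<beta> / 2 * ?n ^ k * \<psi> j \<le> (\<Sum>F\<in>X. if F \<in> A j then \<psi> j else 0)" .
    qed
    moreover have "(\<Sum>j\<in>J. \<beta> / 2 * ?n ^ k * \<psi> j) = \<beta> / 2 * ?n ^ k * \<Phi>"
      by (simp add: \<Phi>_def sum_distrib_left)
    ultimately show False by (simp add: mult_ac)
  qed
  then obtain F where F: "F \<in> X" "g F \<ge> \<beta> / 2 * \<Phi>" by auto
  obtain j where j: "j \<in> J" "F \<in> free j" using F(1) by (auto simp: X_def)
  have Fp: "distinct F" "set F \<inter> W = {}" "F \<in> A j" using j by (auto simp: free_def)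
  have "(\<Sum>j\<in>J. (1 / 2) ^ length (filter (\<lambda>G. G \<in> A j) (F # Fs))) = (\<Sum>j\<in>J. \<psi> j - (if F \<in> A j then \<psi> j else 0) / 2)"
    by (intro sum.cong) (auto simp: \<psi>_def)
  also have "\<dots> = \<Phi> - g F / 2" by (simp add: sum_subtractf \<Phi>_def g_def sum_divide_distrib)
  also have "\<dots> \<le> \<Phi> * (1 - \<beta> / 4)" using F(2) by (simp add: algebra_simps)
  also have "\<dots> \<le> (real (card J) * (1 - \<beta> / 4) ^ m) * (1 - \<beta> / 4)"
    using Fs(5) beta by (intro mult_right_mono) (auto simp: \<Phi>_def \<psi>_def)
  also have "\<dots> = real (card J) * (1 - \<beta> / 4) ^ Suc m" by simp
  finally have "(\<Sum>j\<in>J. (1 / 2) ^ length (filter (\<lambda>G. G \<in> A j) (F # Fs))) \<le> real (card J) * (1 - \<beta> / 4) ^ Suc m" .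
  then show ?case using Fs Fp j(1) by (intro exI[of _ "F # Fs"]) (auto simp: W_def)
qed

text \<open>A single term (1/2)^hits is at most the whole potential, which is at most |J| exp (-
  \<beta> m / 4). Since 1/2 \<ge> 1/e and |J| \<le> exp (\<beta> m / 8), the number of hits is at
  least \<beta> m / 8. In the applications |J| is polynomial in n and m is linear in n.\<close>

lemma balanced_selection:
  fixes \<beta> :: real
  assumes fin: "finite V" and V0: "card V > 0" and J: "finite J" "J \<noteq> {}"
    and A: "\<And>j. j \<in> J \<Longrightarrow> A j \<subseteq> tuples V k" "\<And>j. j \<in> J \<Longrightarrow> real (card (A j)) \<ge> \<beta> * real (card V) ^ k"
    and U: "finite U" and beta: "0 < \<beta>" "\<beta> \<le> 1"
    and m: "(real k * (real (card U) + real k * real m) + (real k)\<^sup>2) / real (card V) \<le> \<beta> / 2"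
    and cardJ: "real (card J) \<le> exp (\<beta> * real m / 8)"
  shows "\<exists>Fs. length Fs = m \<and> distinct (concat Fs) \<and> set (concat Fs) \<inter> U = {} \<and>
     (\<forall>F\<in>set Fs. \<exists>j\<in>J. F \<in> A j) \<and>
     (\<forall>j\<in>J. real (length (filter (\<lambda>F. F \<in> A j) Fs)) \<ge> \<beta> * real m / 8)"
proof -
  obtain Fs where Fs: "length Fs = m" "distinct (concat Fs)" "set (concat Fs) \<inter> U = {}"
     "\<And>F. F \<in> set Fs \<Longrightarrow> \<exists>j\<in>J. F \<in> A j"
     "(\<Sum>j\<in>J. (1 / 2) ^ length (filter (\<lambda>F. F \<in> A j) Fs)) \<le> real (card J) * (1 - \<beta> / 4) ^ m"
    using greedy_selection[where A = A, OF fin V0 J A U beta m] by blast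
  have "real (length (filter (\<lambda>F. F \<in> A j) Fs)) \<ge> \<beta> * real m / 8" if j: "j \<in> J" for j
  proof -
    let ?h = "length (filter (\<lambda>F. F \<in> A j) Fs)"
    have "exp (- real ?h) = exp (- 1) ^ ?h" by (simp add: exp_of_nat_mult[symmetric])
    also have "\<dots> \<le> (1 / 2) ^ ?h"
    proof (rule power_mono)
      have "2 \<le> exp (1::real)" using exp_ge_add_one_self[of 1] by simp
      then show "exp (- 1) \<le> (1 / 2 :: real)" by (simp add: exp_minus field_simps)
    qed simp
    also have "\<dots> \<le> (\<Sum>j\<in>J. (1 / 2) ^ length (filter (\<lambda>F. F \<in> A j) Fs))"
      using J j by (intro member_le_sum) auto
    also have "\<dots> \<le> exp (\<beta> * real m / 8) * exp (- \<beta> / 4) ^ m"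
    proof (rule order_trans[OF Fs(5)], intro mult_mono power_mono)
      show "1 - \<beta> / 4 \<le> exp (- \<beta> / 4)" using exp_ge_add_one_self[of "- \<beta> / 4"] by simp
    qed (use cardJ beta in auto)
    also have "\<dots> = exp (\<beta> * real m / 8 + real m * (- \<beta> / 4))" by (simp only: exp_add exp_of_nat_mult)
    finally have "- real ?h \<le> \<beta> * real m / 8 + real m * (- \<beta> / 4)" by (simp only: exp_le_cancel_iff)
    then show ?thesis by (simp add: field_simps)
  qed
  then show ?thesis using Fs by blast
qed

section \<open>From blocks and connectors to a Hamilton cycle\<close>

abbreviation head_color :: "('a set \<Rightarrow> nat) \<Rightarrow> 'a list \<Rightarrow> nat" where
  "head_color \<phi> B \<equiv> \<phi> (hd (edges B))"

abbreviation last_color :: "('a set \<Rightarrow> nat) \<Rightarrow> 'a list \<Rightarrow> nat" where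
  "last_color \<phi> B \<equiv> \<phi> (last (edges B))"

section \<open>Walks that alternate between blocks and connectors\<close>

definition weave :: "'a list list \<Rightarrow> 'a list list \<Rightarrow> 'a list" where
  "weave Bs Cs = concat (map2 (@) Bs Cs)"

lemma edges_join:
  assumes B: "odd (length B)" and C: "odd (length C)" and w: "w \<noteq> []"
  shows "edges (B @ C @ w) = edges B @ edges (last B # C @ [hd w]) @ edges w"
proof -
  have ne: "B \<noteq> []" using B by auto
  have e1: "butlast B @ last B # (C @ w) = B @ C @ w" "butlast B @ [last B] = B" using ne by simp_all
  have "edges (butlast B @ last B # (C @ w)) = edges (butlast B @ [last B]) @ edges (last B # (C @ w))"
    by (rule edges_append) (use B in simp)
  then have e2: "edges (B @ C @ w) = edges B @ edges (last B # (C @ w))" by (simp only: e1)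
  have e3: "(last B # C) @ hd w # tl w = last B # C @ w" "hd w # tl w = w" using w by simp_all
  have "edges ((last B # C) @ hd w # tl w) = edges ((last B # C) @ [hd w]) @ edges (hd w # tl w)"
    by (rule edges_append) (use C in simp)
  then show ?thesis unfolding e2 e3 by simp
qed

text \<open>The walk ends at the first vertex of \<open>B'\<close>, so only this vertex and the
  color of the first edge of \<open>B'\<close> matter. With the first block in the place of
  \<open>B'\<close> the walk closes up, and the last conjunct is the color condition at the
  seam.\<close>

lemma proper_walk_weave:
  assumes len: "length Bs = length Cs"
    and B: "\<And>B. B \<in> set Bs \<Longrightarrow> proper_walk E \<phi> B \<and> edges B \<noteq> []"
    and C: "\<And>i. i < length Cs \<Longrightarrow> linked E \<phi> (last (Bs ! i)) (last_color \<phi> (Bs ! i))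
        (hd ((Bs @ [B']) ! Suc i)) (head_color \<phi> ((Bs @ [B']) ! Suc i)) (Cs ! i)"
  shows "proper_walk E \<phi> (weave Bs Cs @ [hd B']) \<and> hd (weave Bs Cs @ [hd B']) = hd (hd (Bs @ [B'])) \<and>
     (Bs \<noteq> [] \<longrightarrow> edges (weave Bs Cs @ [hd B']) \<noteq> [] \<and>
       head_color \<phi> (weave Bs Cs @ [hd B']) = head_color \<phi> (hd (Bs @ [B'])) \<and>
       last_color \<phi> (weave Bs Cs @ [hd B']) \<noteq> head_color \<phi> B')"
  using assms
proof (induction Bs Cs rule: list_induct2)
  case Nil
  then show ?case by (simp add: weave_def proper_walk_def)
next
  case (Cons B Bs C Cs)
  define w where "w = weave Bs Cs @ [hd B']"
  define N where "N = hd (Bs @ [B'])"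
  have C': "linked E \<phi> (last (Bs ! i)) (last_color \<phi> (Bs ! i))
        (hd ((Bs @ [B']) ! Suc i)) (head_color \<phi> ((Bs @ [B']) ! Suc i)) (Cs ! i)" if "i < length Cs" for i
    using Cons.prems(2)[of "Suc i"] that by simp
  have IH: "proper_walk E \<phi> w" "hd w = hd N"
    "Bs \<noteq> [] \<Longrightarrow> edges w \<noteq> [] \<and> head_color \<phi> w = head_color \<phi> N \<and> last_color \<phi> w \<noteq> head_color \<phi> B'"
    using Cons.IH[OF _ C'] Cons.prems(1) by (auto simp: w_def N_def)
  have B: "proper_walk E \<phi> B" "edges B \<noteq> []" using Cons.prems(1) by auto
  have "(Bs @ [B']) ! 0 = N" by (simp add: N_def hd_conv_nth)
  then have L: "linked E \<phi> (last B) (last_color \<phi> B) (hd N) (head_color \<phi> N) C"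
    using Cons.prems(2)[of 0] by simp
  define L where "L = edges (last B # C @ [hd w])"
  have w: "w \<noteq> []" by (simp add: w_def)
  have len: "odd (length B)" "length C = 5" "odd (length w)" using B L IH by (auto simp: proper_walk_def linked_def)
  have eq: "weave (B # Bs) (C # Cs) @ [hd B'] = B @ C @ w" by (simp add: weave_def w_def)
  have edges: "edges (B @ C @ w) = edges B @ L @ edges w" unfolding L_def using len w by (intro edges_join) auto
  have "length L = 3" using len by (simp add: L_def length_edges)
  then have L0: "L \<noteq> []" by auto
  have Lp: "set L \<subseteq> E" "successively (\<lambda>e f. \<phi> e \<noteq> \<phi> f) L" "\<phi> (hd L) \<noteq> last_color \<phi> B" "\<phi> (last L) \<noteq> head_color \<phi> N"
    using L unfolding linked_def proper_walk_def L_def IH(2) by auto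
  have Nw: "Bs = [] \<Longrightarrow> edges w = [] \<and> N = B'" by (simp add: w_def N_def weave_def Cons.hyps(1)[symmetric])
  have "successively (\<lambda>e f. \<phi> e \<noteq> \<phi> f) (edges B @ L @ edges w)"
    using B IH Lp L0 Nw by (cases "Bs = []") (auto simp: successively_append_iff proper_walk_def)
  then have "proper_walk E \<phi> (B @ C @ w)"
    using B IH Lp len unfolding proper_walk_def edges by auto
  moreover have "last_color \<phi> (B @ C @ w) \<noteq> head_color \<phi> B'"
    using IH(3) Lp L0 Nw unfolding edges by (cases "Bs = []") auto
  moreover have "B \<noteq> []" using len by auto
  ultimately show ?case unfolding eq using B edges by (auto simp: proper_walk_def)
qed

lemma length_weave:
  assumes "length Bs = length Cs" "\<And>B. B \<in> set Bs \<Longrightarrow> odd (length B)" "\<And>C. C \<in> set Cs \<Longrightarrow> odd (length C)"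
  shows "even (length (weave Bs Cs))"
  using assms by (induction Bs Cs rule: list_induct2) (auto simp: weave_def)

lemma set_weave: "length Bs = length Cs \<Longrightarrow> set (weave Bs Cs) = set (concat Bs) \<union> set (concat Cs)"
  by (induction Bs Cs rule: list_induct2) (auto simp: weave_def)

lemma distinct_weave:
  assumes "length Bs = length Cs" "distinct (concat Bs)" "distinct (concat Cs)" "set (concat Bs) \<inter> set (concat Cs) = {}"
  shows "distinct (weave Bs Cs)"
  using assms
proof (induction Bs Cs rule: list_induct2)
  case (Cons B Bs C Cs)
  have "set (weave Bs Cs) = set (concat Bs) \<union> set (concat Cs)" using Cons.hyps by (rule set_weave)
  then show ?case using Cons by (auto simp: weave_def)
qed (simp add: weave_def)

text \<open>Greedy choice: a connector has five vertices, so those chosen before never exceed the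
  size \<open>5 * length Bs\<close> of a set that can be avoided.\<close>

lemma link_blocks:
  assumes pool: "\<And>u i v j W. u \<in> S \<Longrightarrow> v \<in> S \<Longrightarrow> finite W \<Longrightarrow> card W \<le> 5 * length Bs \<Longrightarrow>
      \<exists>ws. linked E \<phi> u i v j ws \<and> distinct ws \<and> set ws \<subseteq> C - W"
    and S: "\<And>B. B \<in> set Bs \<Longrightarrow> hd B \<in> S \<and> last B \<in> S"
  obtains Cs where "length Cs = length Bs - 1" "distinct (concat Cs)" "set (concat Cs) \<subseteq> C"
     "\<And>i. i < length Cs \<Longrightarrow> linked E \<phi> (last (Bs ! i)) (last_color \<phi> (Bs ! i)) (hd (Bs ! Suc i)) (head_color \<phi> (Bs ! Suc i)) (Cs ! i)"
proof -
  have "\<exists>Cs. length Cs = k \<and> distinct (concat Cs) \<and> set (concat Cs) \<subseteq> C \<and>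
     (\<forall>i<k. linked E \<phi> (last (Bs ! i)) (last_color \<phi> (Bs ! i)) (hd (Bs ! Suc i)) (head_color \<phi> (Bs ! Suc i)) (Cs ! i))"
    if "k \<le> length Bs - 1" for k
    using that
  proof (induction k)
    case (Suc k)
    then obtain Cs where Cs: "length Cs = k" "distinct (concat Cs)" "set (concat Cs) \<subseteq> C"
     "\<And>i. i < k \<Longrightarrow> linked E \<phi> (last (Bs ! i)) (last_color \<phi> (Bs ! i)) (hd (Bs ! Suc i)) (head_color \<phi> (Bs ! Suc i)) (Cs ! i)"
      by auto
    have "length X = 5" if "X \<in> set Cs" for X
      using that Cs(1,4) by (auto simp: in_set_conv_nth linked_def)
    then have "length (concat Cs) = 5 * length Cs" by (induction Cs) auto
    then have "card (set (concat Cs)) \<le> 5 * length Bs" using Cs(1) Suc.prems card_length[of "concat Cs"] by linarith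
    moreover have "last (Bs ! k) \<in> S" "hd (Bs ! Suc k) \<in> S" using S Suc.prems by auto
    ultimately obtain ws where ws: "linked E \<phi> (last (Bs ! k)) (last_color \<phi> (Bs ! k)) (hd (Bs ! Suc k)) (head_color \<phi> (Bs ! Suc k)) ws"
       "distinct ws" "set ws \<subseteq> C - set (concat Cs)"
      using pool[of "last (Bs ! k)" "hd (Bs ! Suc k)" "set (concat Cs)"] by blast
    then show ?case using Cs
      by (intro exI[of _ "Cs @ [ws]"]) (auto simp: nth_append less_Suc_eq)
  qed simp
  from this[OF le_refl] obtain Cs where "length Cs = length Bs - 1" "distinct (concat Cs)" "set (concat Cs) \<subseteq> C"
    "\<And>i. i < length Bs - 1 \<Longrightarrow> linked E \<phi> (last (Bs ! i)) (last_color \<phi> (Bs ! i)) (hd (Bs ! Suc i)) (head_color \<phi> (Bs ! Suc i)) (Cs ! i)"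
    by blast
  then show thesis using that by simp
qed

lemma Hamilton_cycle_of_closed_walk:
  assumes E3: "\<And>e. e \<in> E \<Longrightarrow> card e = 3"
    and vs: "distinct vs" "set vs = V" "length vs = 2 * m" "m \<ge> 3"
    and walk: "proper_walk E \<phi> (vs @ [hd vs])" "last_color \<phi> (vs @ [hd vs]) \<noteq> head_color \<phi> (vs @ [hd vs])"
  shows "\<exists>C. loose_Hamilton_cycle V E C \<and> properly_colored C \<phi>"
proof -
  define w where "w = vs @ [hd vs]"
  \<comment> \<open>Edges are compared through their index sets, as \<open>(!) vs\<close> is
    injective on positions; reduction modulo 2m sends the position after the last one to 0.\<close>
  define I where "I i = {2 * i mod (2 * m), (2 * i + 1) mod (2 * m), (2 * i + 2) mod (2 * m)}" for i
  let ?c = "\<lambda>i. consecutive3 (2 * m) ((!) vs) (2 * i)"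
  have ne: "vs \<noteq> []" using vs by auto
  have lw: "length (edges w) = m" using vs by (simp add: w_def length_edges)
  have I: "I i = (if Suc i < m then {2 * i, 2 * i + 1, 2 * i + 2} else {2 * i, 2 * i + 1, 0})" if "i < m" for i
  proof (cases "Suc i < m")
    case False
    then have "2 * i + 2 = 2 * m" using that by simp
    then have "(2 * i + 2) mod (2 * m) = 0" by simp
    then show ?thesis using that False by (simp add: I_def)
  qed (simp add: I_def)
  \<comment> \<open>The last edge is followed by edge number m, which is the first one
    again.\<close>
  have Im: "I m = {0, 1, 2}" using vs(4) by (simp add: I_def mod_Suc numeral_2_eq_2)
  have c: "?c i = (!) vs ` I i" for i by (simp add: consecutive3_def I_def)
  have ce: "?c i = edges w ! i" if "i < m" for i
  proof -
    have "edges w ! i = {w ! (2 * i), w ! (2 * i + 1), w ! (2 * i + 2)}"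
      using that vs by (intro edges_nth) (auto simp: w_def)
    also have "\<dots> = (!) vs ` I i"
      using that vs ne by (auto simp: I w_def nth_append hd_conv_nth)
    finally show ?thesis by (simp add: c)
  qed
  have Isub: "I i \<subseteq> {..<2 * m}" for i using vs by (auto simp: I_def)
  have inj: "inj_on ((!) vs) {..<2 * m}" using vs by (intro inj_on_nth) auto
  have cint: "?c i \<inter> ?c j = (!) vs ` (I i \<inter> I j)" for i j
    unfolding c using inj_on_image_Int[OF inj Isub Isub] by blast
  have cE: "?c i \<in> E" if "i < m" for i
    using walk(1) that ce[OF that] lw by (auto simp: proper_walk_def w_def[symmetric])
  have one: "card (?c i \<inter> ?c (i + 1)) = 1" if i: "i < m" for i
  proof -
    have "\<exists>a. I i \<inter> I (i + 1) = {a}"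
    proof (cases "i + 1 < m")
      case True
      then show ?thesis using vs(4) i I[of i] I[of "i + 1"] by (auto split: if_splits)
    next
      case False
      then have "i + 1 = m" using i by simp
      then have "I i \<inter> I (i + 1) = {0}" using vs(4) i I[of i] Im by auto
      then show ?thesis by blast
    qed
    then obtain a where "I i \<inter> I (i + 1) = {a}" by blast
    then have "?c i \<inter> ?c (i + 1) = {vs ! a}" unfolding cint by simp
    then show ?thesis by simp
  qed
  have "bij_betw ((!) vs) {..<2 * m} V" using vs by (intro bij_betw_nth) auto
  then have loose: "loose_cycle V (?c ` {..<m})"
    unfolding loose_cycle_def using vs(4) cE E3 one by (intro exI[of _ m] exI[of _ "(!) vs"]) auto
  have adj: "\<phi> (edges w ! i) \<noteq> \<phi> (edges w ! Suc i)" if "Suc i < m" for i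
    using walk(1) that lw by (auto simp: proper_walk_def w_def[symmetric] successively_conv_nth)
  have ends: "\<phi> (edges w ! (m - 1)) \<noteq> \<phi> (edges w ! 0)"
  proof -
    have "edges w \<noteq> []" using lw vs(4) by auto
    then show ?thesis using walk(2) lw by (simp add: w_def[symmetric] last_conv_nth hd_conv_nth)
  qed
  \<comment> \<open>Index sets of different edges meet only if the edges are successive or are the
    first and the last.\<close>
  have key: "\<phi> (edges w ! i) \<noteq> \<phi> (edges w ! j)" if ij: "i < j" "j < m" "I i \<inter> I j \<noteq> {}" for i j
  proof (cases "j = Suc i")
    case False
    then have "i = 0 \<and> j = m - 1"
      using ij I[of i] I[of j] by (auto split: if_splits)
    then show ?thesis using ends by metis
  qed (use adj ij in auto)
  have "properly_colored (?c ` {..<m}) \<phi>"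
    unfolding properly_colored_def
  proof (intro ballI impI)
    fix e f assume ef: "e \<in> ?c ` {..<m}" "f \<in> ?c ` {..<m}" "e \<noteq> f \<and> e \<inter> f \<noteq> {}"
    obtain i where i: "i < m" "e = ?c i" using ef(1) by blast
    obtain j where j: "j < m" "f = ?c j" using ef(2) by blast
    have "i \<noteq> j" using ef(3) i j by blast
    have "I i \<inter> I j \<noteq> {}" using ef(3) cint[of i j] unfolding i(2) j(2) by blast
    then have "I j \<inter> I i \<noteq> {}" by blast
    have "\<phi> (edges w ! i) \<noteq> \<phi> (edges w ! j)"
    proof (cases "i < j")
      case True
      show ?thesis by (rule key) fact+
    next
      case False
      then have "j < i" using \<open>i \<noteq> j\<close> by simp
      have "\<phi> (edges w ! j) \<noteq> \<phi> (edges w ! i)" by (rule key) fact+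
      then show ?thesis by (rule not_sym)
    qed
    then show "\<phi> e \<noteq> \<phi> f" unfolding i(2) j(2) ce[OF i(1)] ce[OF j(1)] .
  qed
  moreover have "loose_Hamilton_cycle V E (?c ` {..<m})"
    unfolding loose_Hamilton_cycle_def using loose cE by auto
  ultimately show ?thesis by blast
qed

section \<open>The absorbing family and the reservoir\<close>

fun absorber_blocks :: "'a list \<Rightarrow> ('a \<times> 'a) option \<Rightarrow> 'a list list" where
  "absorber_blocks F None = [insert_path F, swap_path F]"
| "absorber_blocks F (Some (x, y)) = [insert_path' y F, swap_path' x F]"

text \<open>All that the adjoining connectors see of a block: its end vertices and its end edges,
  hence also the end colors. Once the connectors are fixed, blocks of equal signature can be
  exchanged for each other.\<close>

definition signature :: "'a list \<Rightarrow> 'a \<times> 'a \<times> 'a set \<times> 'a set" where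
  "signature B = (hd B, last B, hd (edges B), last (edges B))"

lemma signature_absorber_blocks:
  "map signature (absorber_blocks F o1) = map signature (absorber_blocks F o2)"
proof -
  have "map signature (absorber_blocks F o1) = map signature (absorber_blocks F None)" for o1
    by (cases "(F, o1)" rule: absorber_blocks.cases)
      (auto simp: signature_def insert_path_def insert_path'_def swap_path_def swap_path'_def insert_commute)
  then show ?thesis by metis
qed

lemma list_of_length_14:
  assumes "length F = 14"
  shows "F = [F ! 0, F ! 1, F ! 2, F ! 3, F ! 4, F ! 5, F ! 6, F ! 7, F ! 8, F ! 9, F ! 10, F ! 11, F ! 12, F ! 13]"
proof -
  have "[0..<14] = [0, 1, 2, 3, 4, 5, 6, 7, 8, 9, 10, 11, 12, 13 :: nat]" by (simp add: upt_conv_Cons)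
  then have "map ((!) F) [0..<length F] =
      [F ! 0, F ! 1, F ! 2, F ! 3, F ! 4, F ! 5, F ! 6, F ! 7, F ! 8, F ! 9, F ! 10, F ! 11, F ! 12, F ! 13]"
    unfolding assms by simp
  then show ?thesis by (rule trans[OF map_nth[symmetric]])
qed

text \<open>Multisets record at once which vertices occur and that none occurs twice, so both facts
  survive the rearrangement inside an absorber.\<close>

lemma mset_absorber_blocks:
  assumes "length F = 14"
  shows "mset (concat (absorber_blocks F None)) = mset F"
    "mset (concat (absorber_blocks F (Some (x, y)))) = mset F + {#x, y#}"
proof -
  have F: "mset F = mset [F ! 0, F ! 1, F ! 2, F ! 3, F ! 4, F ! 5, F ! 6, F ! 7, F ! 8, F ! 9, F ! 10, F ! 11, F ! 12, F ! 13]"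
    using list_of_length_14[OF assms] by (rule arg_cong)
  show "mset (concat (absorber_blocks F None)) = mset F"
    unfolding F by (simp add: insert_path_def swap_path_def add_mset_commute)
  show "mset (concat (absorber_blocks F (Some (x, y)))) = mset F + {#x, y#}"
    unfolding F by (simp add: insert_path'_def swap_path'_def add_mset_commute)
qed

section \<open>Absorbing a list of pairs\<close>

definition pair_list :: "('a \<times> 'a) list \<Rightarrow> 'a list" where
  "pair_list ps = concat (map (\<lambda>(x, y). [x, y]) ps)"

lemma pairing:
  assumes "finite W" "even (card W)"
  obtains ps where "distinct (pair_list ps)" "set (pair_list ps) = W" "2 * length ps = card W"
proof -
  obtain ws where ws: "set ws = W" "distinct ws" using finite_distinct_list[OF assms(1)] by blast
  have "\<exists>ps. pair_list ps = xs \<and> 2 * length ps = length xs" if "even (length xs)" for xs :: "'a list"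
    using that
  proof (induction xs rule: induct_list012)
    case 1
    then show ?case by (intro exI[of _ "[]"]) (simp add: pair_list_def)
  next
    case (3 x y zs)
    then obtain ps where "pair_list ps = zs" "2 * length ps = length zs" by auto
    then show ?case by (intro exI[of _ "(x, y) # ps"]) (simp add: pair_list_def)
  qed simp
  moreover have "length ws = card W" using ws distinct_card by metis
  ultimately show thesis using that assms(2) ws by metis
qed

text \<open>Every pair occupies one absorber, so a pair with at least \<open>length ps\<close>
  suitable absorbers always finds an idle one, marked by \<open>None\<close>. The number of occupied
  absorbers is part of the induction for this reason.\<close>

lemma absorb_pairs:
  assumes len: "\<And>F. F \<in> set Fs \<Longrightarrow> length F = 14"
    and base: "\<And>F. F \<in> set Fs \<Longrightarrow> proper_walk E \<phi> (insert_path F) \<and> proper_walk E \<phi> (swap_path F)"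
    and hits: "\<And>x y. (x, y) \<in> set ps \<Longrightarrow> length (filter (absorbs E \<phi> x y) Fs) \<ge> length ps"
  shows "\<exists>os. length os = length Fs \<and> length (filter (\<lambda>oo. oo \<noteq> None) os) = length ps \<and>
     mset (concat (concat (map2 absorber_blocks Fs os))) = mset (concat Fs) + mset (pair_list ps) \<and>
     (\<forall>B\<in>set (concat (map2 absorber_blocks Fs os)). proper_walk E \<phi> B)"
  using hits
proof (induction ps)
  case Nil
  have "mset (concat (concat (map2 absorber_blocks Fs (replicate (length Fs) None)))) = mset (concat Fs)"
    using len by (induction Fs) (simp_all add: mset_absorber_blocks del: absorber_blocks.simps)
  moreover have "\<forall>B\<in>set (concat (map2 absorber_blocks Fs (replicate (length Fs) None))). proper_walk E \<phi> B"
    using base by (induction Fs) auto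
  ultimately show ?case
    by (intro exI[of _ "replicate (length Fs) None"]) (simp add: pair_list_def)
next
  case (Cons p ps)
  obtain x y where p: "p = (x, y)" by (cases p)
  have "length (filter (absorbs E \<phi> x' y') Fs) \<ge> length ps" if "(x', y') \<in> set ps" for x' y'
    using Cons.prems[of x' y'] that by simp
  then obtain os where os: "length os = length Fs" "length (filter (\<lambda>oo. oo \<noteq> None) os) = length ps"
    "mset (concat (concat (map2 absorber_blocks Fs os))) = mset (concat Fs) + mset (pair_list ps)"
    "\<And>B. B \<in> set (concat (map2 absorber_blocks Fs os)) \<Longrightarrow> proper_walk E \<phi> B"
    using Cons.IH by blast
  have "\<exists>i<length Fs. absorbs E \<phi> x y (Fs ! i) \<and> os ! i = None"
  proof (rule ccontr)
    assume "\<not> ?thesis"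
    then have "{i. i < length Fs \<and> absorbs E \<phi> x y (Fs ! i)} \<subseteq> {i. i < length os \<and> os ! i \<noteq> None}"
      using os(1) by auto
    then have "card {i. i < length Fs \<and> absorbs E \<phi> x y (Fs ! i)} \<le> card {i. i < length os \<and> os ! i \<noteq> None}"
      by (intro card_mono) auto
    then have "length (filter (absorbs E \<phi> x y) Fs) \<le> length (filter (\<lambda>oo. oo \<noteq> None) os)"
      by (simp only: length_filter_conv_card)
    then show False using Cons.prems[of x y] os(2) p by simp
  qed
  then obtain i where i: "i < length Fs" "absorbs E \<phi> x y (Fs ! i)" "os ! i = None" by blast
  define F1 F2 o1 o2 where "F1 = take i Fs" and "F2 = drop (Suc i) Fs" and "o1 = take i os" and "o2 = drop (Suc i) os"
  define F where "F = Fs ! i"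
  have Fs: "Fs = F1 @ F # F2" unfolding F_def F1_def F2_def using i(1) by (rule id_take_nth_drop)
  have "os = o1 @ os ! i # o2" unfolding o1_def o2_def using i(1) os(1) by (intro id_take_nth_drop) simp
  then have osd: "os = o1 @ None # o2" using i(3) by simp
  have l1: "length F1 = length o1" using i(1) os(1) by (simp add: F1_def o1_def)
  define os' where "os' = o1 @ Some (x, y) # o2"
  have F14: "length F = 14" using len i(1) by (simp add: F_def)
  have m: "map2 absorber_blocks Fs os = map2 absorber_blocks F1 o1 @ absorber_blocks F None # map2 absorber_blocks F2 o2"
    "map2 absorber_blocks Fs os' = map2 absorber_blocks F1 o1 @ absorber_blocks F (Some (x, y)) # map2 absorber_blocks F2 o2"
    using l1 by (simp_all add: Fs osd os'_def zip_append)
  have eq: "mset (concat (concat (map2 absorber_blocks Fs os'))) = mset (concat (concat (map2 absorber_blocks Fs os))) + {#x, y#}"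
    unfolding m using mset_absorber_blocks[OF F14] by (simp del: absorber_blocks.simps)
  have "mset (concat (concat (map2 absorber_blocks Fs os'))) = mset (concat Fs) + mset (pair_list (p # ps))"
    unfolding eq os(3) by (simp add: pair_list_def p)
  moreover have "length os' = length Fs" "length (filter (\<lambda>oo. oo \<noteq> None) os') = length (p # ps)"
    using os(1,2) by (simp_all add: osd os'_def)
  moreover have "\<forall>B\<in>set (concat (map2 absorber_blocks Fs os')). proper_walk E \<phi> B"
  proof
    fix B assume "B \<in> set (concat (map2 absorber_blocks Fs os'))"
    then have "B \<in> set (concat (map2 absorber_blocks Fs os)) \<or> B = insert_path' y F \<or> B = swap_path' x F"
      unfolding m by auto
    then show "proper_walk E \<phi> B" using os(4) i(2) unfolding absorbs_def F_def by blast
  qed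
  ultimately show ?case by blast
qed

lemma signature_concat_blocks:
  assumes "length os = length Fs"
  shows "map signature (concat (map2 absorber_blocks Fs os)) =
     map signature (concat (map (\<lambda>F. absorber_blocks F None) Fs))"
  using assms[symmetric]
proof (induction Fs os rule: list_induct2)
  case (Cons F Fs oo os)
  have "map signature (absorber_blocks F oo) = map signature (absorber_blocks F None)"
    by (rule signature_absorber_blocks)
  then show ?case using Cons.IH by (simp del: absorber_blocks.simps)
qed simp

lemma edges_absorber_blocks: "B \<in> set (absorber_blocks F oo) \<Longrightarrow> edges B \<noteq> []"
  by (cases "(F, oo)" rule: absorber_blocks.cases)
    (auto simp: insert_path_def insert_path'_def swap_path_def swap_path'_def)

context dense_coloring
begin

text \<open>One family serves all n^2 pairs: a pair is absorbed by the proportion 7/10^20 of all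
  tuples, and by at least an eighth of this proportion of the selected ones.\<close>

lemma absorbing_family:
  assumes c: "c \<le> 1 / 10 ^ 21"
    and m: "(14 * (14 * real m) + 196) / n \<le> 35 / 10 ^ 21"
    and large: "n\<^sup>2 \<le> exp (7 / 10 ^ 20 * real m / 8)"
  obtains Fs where "length Fs = m" "distinct (concat Fs)" "set (concat Fs) \<subseteq> V"
    "\<And>F. F \<in> set Fs \<Longrightarrow> length F = 14 \<and> proper_walk E \<phi> (insert_path F) \<and> proper_walk E \<phi> (swap_path F)"
    "\<And>x y. x \<in> V \<Longrightarrow> y \<in> V \<Longrightarrow> real (length (filter (absorbs E \<phi> x y) Fs)) \<ge> 7 / 10 ^ 20 * real m / 8"
proof -
  define A where "A = (\<lambda>(x, y). {xs \<in> tuples V 14. absorbs E \<phi> x y xs})"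
  have A: "A j \<subseteq> tuples V 14" "j \<in> V \<times> V \<Longrightarrow> real (card (A j)) \<ge> 7 / 10 ^ 20 * real (card V) ^ 14" for j
    using card_absorbers c by (auto simp: A_def)
  have b: "0 < (7 / 10 ^ 20 :: real)" "(7 / 10 ^ 20 :: real) \<le> 1" by simp_all
  have ne: "V \<times> V \<noteq> {}" using V0 by auto
  have finVV: "finite (V \<times> V)" using fin by simp
  have m': "(real 14 * (real (card ({} :: 'a set)) + real 14 * real m) + (real 14)\<^sup>2) / real (card V) \<le> 7 / 10 ^ 20 / 2"
    using m by simp
  have J: "real (card (V \<times> V)) \<le> exp (7 / 10 ^ 20 * real m / 8)"
    using large by (simp add: card_cartesian_product power2_eq_square)
  obtain Fs where Fs: "length Fs = m" "distinct (concat Fs)" "set (concat Fs) \<inter> {} = {}"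
     "\<And>F. F \<in> set Fs \<Longrightarrow> \<exists>j\<in>V \<times> V. F \<in> A j"
     "\<And>j. j \<in> V \<times> V \<Longrightarrow> real (length (filter (\<lambda>F. F \<in> A j) Fs)) \<ge> 7 / 10 ^ 20 * real m / 8"
    using balanced_selection[where A = A and U = "{}", OF fin V0 finVV ne A(1) A(2) finite.emptyI b m' J] by blast
  have F: "F \<in> tuples V 14 \<and> proper_walk E \<phi> (insert_path F) \<and> proper_walk E \<phi> (swap_path F)" if "F \<in> set Fs" for F
    using Fs(4)[OF that] by (auto simp: A_def absorbs_def)
  show thesis
  proof (rule that[OF Fs(1,2)])
    show "set (concat Fs) \<subseteq> V" using F by (auto simp: tuples_def)
    show "length F = 14 \<and> proper_walk E \<phi> (insert_path F) \<and> proper_walk E \<phi> (swap_path F)" if "F \<in> set Fs" for F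
      using F[OF that] by (simp add: tuples_def)
    show "real (length (filter (absorbs E \<phi> x y) Fs)) \<ge> 7 / 10 ^ 20 * real m / 8" if "x \<in> V" "y \<in> V" for x y
    proof -
      have "filter (\<lambda>F. F \<in> A (x, y)) Fs = filter (absorbs E \<phi> x y) Fs"
        using F by (intro filter_cong) (auto simp: A_def)
      then show ?thesis using Fs(5)[of "(x, y)"] that by simp
    qed
  qed
qed

section \<open>Connectors that avoid used vertices\<close>

lemma connector_list:
  assumes "xs \<in> tuples V 5"
  shows "set (connector xs) = set xs" "distinct xs \<Longrightarrow> distinct (connector xs)"
proof -
  have "length xs = 5" using assms by (simp add: tuples_def)
  then obtain a b c d e where "xs = [a, b, c, d, e]" by (auto simp: eval_nat_numeral length_Suc_conv)
  then show "set (connector xs) = set xs" "distinct xs \<Longrightarrow> distinct (connector xs)"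
    by (auto simp: connector_def)
qed

lemma link_avoiding:
  assumes c: "c \<le> 1 / 10 ^ 7" and uv: "u \<in> V" "v \<in> V" and W: "finite W" "(5 * real (card W) + 25) / n < 1 / (2 * 10 ^ 6)"
  shows "\<exists>ws. linked E \<phi> u i v j ws \<and> distinct ws \<and> set ws \<subseteq> V - W"
proof -
  let ?A = "{xs \<in> tuples V 5. linked E \<phi> u i v j (connector xs)}"
  have "real (card {xs \<in> ?A. distinct xs \<and> set xs \<inter> W = {}}) \<ge> real (card ?A) - (real 5 * real (card W) + (real 5)\<^sup>2) / n * n ^ 5"
    by (rule card_free[OF fin V0 _ W(1)]) auto
  moreover have "(real 5 * real (card W) + (real 5)\<^sup>2) / n * n ^ 5 < 1 / (2 * 10 ^ 6) * n ^ 5"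
    using W(2) V0 by (intro mult_strict_right_mono) auto
  ultimately have "card {xs \<in> ?A. distinct xs \<and> set xs \<inter> W = {}} \<noteq> 0"
    using card_connectors[OF uv c, of i j] by linarith
  then obtain xs where xs: "xs \<in> ?A" "distinct xs" "set xs \<inter> W = {}"
    by (metis (mono_tags, lifting) card.empty empty_Collect_eq)
  then have "set xs \<subseteq> V" "xs \<in> tuples V 5" by (auto simp: tuples_def)
  then show ?thesis using xs connector_list[of xs] by (intro exI[of _ "connector xs"]) auto
qed

text \<open>\<open>link_avoiding\<close> draws on all of \<open>V\<close> and serves while few
  vertices are used. Once the tiling has covered most vertices, connectors must come from a small
  set fixed in advance that works for all end vertices and all forbidden colors. The colors are
  confined to the finite set \<open>K\<close> to keep the index set small.\<close>

lemma link_reservoir: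
  assumes c: "c \<le> 1 / 10 ^ 7" and U: "finite U" and K: "finite K" "\<phi> ` E \<subseteq> K" "K \<noteq> {}"
    and m: "(5 * (real (card U) + 5 * real m) + 25) / n \<le> 1 / (4 * 10 ^ 6)"
    and large: "n\<^sup>2 * (real (card K))\<^sup>2 \<le> exp (1 / (2 * 10 ^ 6) * real m / 8)"
  obtains Q where "Q \<subseteq> V" "Q \<inter> U = {}" "card Q \<le> 5 * m"
    "\<And>u i v j W. u \<in> V \<Longrightarrow> v \<in> V \<Longrightarrow> finite W \<Longrightarrow> real (card W) < 1 / (2 * 10 ^ 6) * real m / 8 \<Longrightarrow>
       \<exists>ws. linked E \<phi> u i v j ws \<and> distinct ws \<and> set ws \<subseteq> Q - W"
proof -
  define A where "A = (\<lambda>(u, v, i, j). {xs \<in> tuples V 5. linked E \<phi> u i v j (connector xs)})"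
  let ?J = "V \<times> V \<times> K \<times> K"
  have A: "A j \<subseteq> tuples V 5" "j \<in> ?J \<Longrightarrow> real (card (A j)) \<ge> 1 / (2 * 10 ^ 6) * real (card V) ^ 5" for j
    using card_connectors[OF _ _ c] by (auto simp: A_def)
  have b: "0 < (1 / (2 * 10 ^ 6) :: real)" "1 / (2 * 10 ^ 6) \<le> (1 :: real)" by simp_all
  have ne: "?J \<noteq> {}" using V0 K by auto
  have finJ: "finite ?J" using fin K by simp
  have m': "(real 5 * (real (card U) + real 5 * real m) + (real 5)\<^sup>2) / real (card V) \<le> 1 / (2 * 10 ^ 6) / 2"
    using m by simp
  have J: "real (card ?J) \<le> exp (1 / (2 * 10 ^ 6) * real m / 8)"
    using large by (simp add: card_cartesian_product power2_eq_square mult_ac)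
  obtain Fs where Fs: "length Fs = m" "distinct (concat Fs)" "set (concat Fs) \<inter> U = {}"
     "\<And>F. F \<in> set Fs \<Longrightarrow> \<exists>j\<in>?J. F \<in> A j"
     "\<And>j. j \<in> ?J \<Longrightarrow> real (length (filter (\<lambda>F. F \<in> A j) Fs)) \<ge> 1 / (2 * 10 ^ 6) * real m / 8"
    using balanced_selection[where A = A, OF fin V0 finJ ne A(1) A(2) U b m' J] by blast
  have t: "F \<in> tuples V 5" if F: "F \<in> set Fs" for F
  proof -
    obtain j where "F \<in> A j" using Fs(4)[OF F] by blast
    then show ?thesis by (rule subsetD[OF A(1)])
  qed
  define Q where "Q = set (concat Fs)"
  show thesis
  proof (rule that[of Q])
    show "Q \<subseteq> V" using t by (auto simp: Q_def tuples_def)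
    show "Q \<inter> U = {}" using Fs(3) by (simp add: Q_def)
    have "length (concat Fs) = 5 * length Fs" using tuples_length[OF t] by (induction Fs) auto
    then show "card Q \<le> 5 * m" using Fs(1) card_length[of "concat Fs"] by (simp add: Q_def)
    fix u v and W :: "'a set" and i j :: nat
    assume uv: "u \<in> V" "v \<in> V" and W: "finite W" "real (card W) < 1 / (2 * 10 ^ 6) * real m / 8"
    obtain k where k: "k \<in> K" using K by auto
    \<comment> \<open>A color outside \<open>K\<close> occurs on no edge, so forbidding it is void
      and any color of \<open>K\<close> may take its place.\<close>
    define i' j' where "i' = (if i \<in> K then i else k)" and "j' = (if j \<in> K then j else k)"
    have ij: "i' \<in> K" "j' \<in> K" using k by (auto simp: i'_def j'_def)
    let ?H = "{F \<in> set Fs. F \<in> A (u, v, i', j')}"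
    \<comment> \<open>The selected tuples are disjoint, so each vertex of \<open>W\<close> spoils at
      most one of them.\<close>
    have "\<exists>F\<in>?H. set F \<inter> W = {}"
    proof (rule ccontr)
      assume none: "\<not> ?thesis"
      have dis: "set F \<inter> set F' = {}" if "F \<in> set Fs" "F' \<in> set Fs" "F \<noteq> F'" for F F'
        using Fs(2) that by (auto simp: distinct_concat_iff)
      have "\<exists>w. w \<in> set F \<inter> W" if "F \<in> ?H" for F using none that by blast
      then obtain w where w: "\<And>F. F \<in> ?H \<Longrightarrow> w F \<in> set F \<inter> W" by metis
      have "inj_on w ?H"
      proof (rule inj_onI)
        fix F F' assume *: "F \<in> ?H" "F' \<in> ?H" "w F = w F'"
        then have "w F \<in> set F \<inter> set F'" using w by (metis IntD1 IntI)
        then show "F = F'" using dis * by blast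
      qed
      moreover have "w ` ?H \<subseteq> W" using w by auto
      ultimately have "card ?H \<le> card W" using W(1) by (intro card_inj_on_le)
      moreover have "distinct Fs"
      proof -
        have "[] \<notin> set Fs" using tuples_length[OF t, of "[]"] by auto
        then have "removeAll [] Fs = Fs" by (simp add: removeAll_id)
        then show ?thesis using Fs(2) by (metis distinct_concat_iff)
      qed
      then have "length (filter (\<lambda>F. F \<in> A (u, v, i', j')) Fs) = card ?H"
        using distinct_card[of "filter (\<lambda>F. F \<in> A (u, v, i', j')) Fs"] by simp
      ultimately show False using Fs(5)[of "(u, v, i', j')"] uv ij W(2) by simp
    qed
    then obtain F where F: "F \<in> set Fs" "F \<in> A (u, v, i', j')" "set F \<inter> W = {}" by auto
    have L: "linked E \<phi> u i' v j' (connector F)" using F(2) by (simp add: A_def)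
    define L' where "L' = edges (u # connector F @ [v])"
    have "length L' = 3" using L by (simp add: L'_def linked_def length_edges)
    then have "hd L' \<in> set L'" "last L' \<in> set L'" by (auto intro!: hd_in_set last_in_set)
    then have "\<phi> (hd L') \<in> K" "\<phi> (last L') \<in> K"
      using L K by (auto simp: linked_def proper_walk_def L'_def)
    then have "linked E \<phi> u i v j (connector F)"
      using L unfolding linked_def L'_def[symmetric] i'_def j'_def by (auto split: if_splits)
    moreover have "distinct F" using Fs(2) F(1) by (auto simp: distinct_concat_iff)
    moreover have "set F \<subseteq> Q" using F(1) by (auto simp: Q_def)
    ultimately show "\<exists>ws. linked E \<phi> u i v j ws \<and> distinct ws \<and> set ws \<subseteq> Q - W"
      using connector_list[OF t[OF F(1)]] F(3) by (intro exI[of _ "connector F"]) auto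
  qed
qed

end

section \<open>Assembling the cycle\<close>

lemma card_link_deg:
  assumes fin: "finite V" and E: "\<And>e. e \<in> E \<Longrightarrow> e \<subseteq> V \<and> card e = 3"
  shows "card (link E V v) = 2 * deg E {v}"
proof -
  let ?E = "{e \<in> E. {v} \<subseteq> e}"
  let ?f = "\<lambda>e. {(a, b) \<in> V \<times> V. {v, a, b} = e}"
  have "?E \<subseteq> Pow V" using E by auto
  then have finE: "finite ?E" using fin by (meson finite_Pow_iff finite_subset)
  have two: "card (?f e) = 2" if e: "e \<in> ?E" for e
  proof -
    have "card e = 3" using e E by auto
    then obtain x y z where xyz: "e = {x, y, z}" "x \<noteq> y" "y \<noteq> z" "x \<noteq> z" unfolding card_3_iff by blast
    have "\<exists>p q. e = {v, p, q} \<and> v \<noteq> p \<and> p \<noteq> q \<and> v \<noteq> q"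
    proof -
      have "v \<in> e" using e by simp
      then consider "v = x" | "v = y" | "v = z" using xyz(1) by blast
      then show ?thesis
      proof cases
        case 1 then show ?thesis using xyz by blast
      next
        case 2 then show ?thesis using xyz by (intro exI[of _ x] exI[of _ z]) auto
      next
        case 3 then show ?thesis using xyz by (intro exI[of _ x] exI[of _ y]) auto
      qed
    qed
    then obtain p q where pq: "e = {v, p, q}" "v \<noteq> p" "p \<noteq> q" "v \<noteq> q" by blast
    have "p \<in> V" "q \<in> V"
      using E[of e] e pq(1) by blast+
    have "?f e = {(p, q), (q, p)}"
    proof (rule set_eqI)
      fix ab :: "'a \<times> 'a"
      obtain a b where ab: "ab = (a, b)" by (cases ab)
      have "a = p \<and> b = q \<or> a = q \<and> b = p" if eq: "{v, a, b} = e"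
      proof -
        have "card {v, a, b} = 3" using eq \<open>card e = 3\<close> by simp
        then have "v \<noteq> a" "v \<noteq> b" "a \<noteq> b" by (rule card3_distinct)+
        moreover have "a \<in> {v, p, q}" "b \<in> {v, p, q}" using eq pq(1) by blast+
        ultimately show ?thesis by blast
      qed
      moreover have "{v, p, q} = {v, q, p}" by blast
      ultimately show "ab \<in> ?f e \<longleftrightarrow> ab \<in> {(p, q), (q, p)}"
        unfolding ab using \<open>p \<in> V\<close> \<open>q \<in> V\<close> pq(1) by auto
    qed
    then show ?thesis using pq by simp
  qed
  have "link E V v = (\<Union>e\<in>?E. ?f e)" using E by (auto simp: link_def)
  moreover have "card (\<Union>e\<in>?E. ?f e) = (\<Sum>e\<in>?E. card (?f e))"
    using finE two by (intro card_UN_disjoint) (auto intro: card_ge_0_finite)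
  moreover have "(\<Sum>e\<in>?E. card (?f e)) = (\<Sum>e\<in>?E. 2)" by (intro sum.cong refl two)
  ultimately show ?thesis by (simp add: deg_def)
qed

lemma finite_card_subsets: "finite V \<Longrightarrow> finite {S. S \<subseteq> V \<and> card S = s}"
  by (rule finite_subset[of _ "Pow V"]) auto

lemma min_deg_le:
  assumes "finite V" "v \<in> V"
  shows "min_deg 1 V E \<le> deg E {v}"
  unfolding min_deg_def
proof (rule Min_le)
  show "finite (deg E ` {S. S \<subseteq> V \<and> card S = 1})" using assms(1) by (intro finite_imageI finite_card_subsets)
  show "deg E {v} \<in> deg E ` {S. S \<subseteq> V \<and> card S = 1}" using assms(2) by (intro imageI) simp
qed

lemma max_deg_ge:
  assumes "finite V" "v \<in> V"
  shows "deg E {v} \<le> max_deg 1 V E"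
  unfolding max_deg_def
proof (rule Max_ge)
  show "finite (deg E ` {S. S \<subseteq> V \<and> card S = 1})" using assms(1) by (intro finite_imageI finite_card_subsets)
  show "deg E {v} \<in> deg E ` {S. S \<subseteq> V \<and> card S = 1}" using assms(2) by (intro imageI) simp
qed

lemma color_link_color_class: "color_link E \<phi> V v i = link (color_class E \<phi> i) V v"
  by (auto simp: color_link_def link_def color_class_def)

lemma mset_base_blocks:
  assumes "\<And>F. F \<in> set Fs \<Longrightarrow> length F = 14"
  shows "mset (concat (concat (map (\<lambda>F. absorber_blocks F None) Fs))) = mset (concat Fs)"
  using assms by (induction Fs) (simp_all add: mset_absorber_blocks del: absorber_blocks.simps)

lemma linked_signature:
  assumes "signature B = signature B'" "signature D = signature D'"
    "linked E \<phi> (last B) (last_color \<phi> B) (hd D) (head_color \<phi> D) ws"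
  shows "linked E \<phi> (last B') (last_color \<phi> B') (hd D') (head_color \<phi> D') ws"
  using assms by (simp add: signature_def)

text \<open>\<open>D\<close> is the chain of all absorber blocks in the idle state, joined by
  \<open>As\<close>. \<open>L\<close> runs from the last block of \<open>D\<close> through the
  tiling paths back to its first block, so \<open>Qs\<close> closes the cycle. The leftover is known
  only then; \<open>D\<close> is replaced by a chain that absorbs it, and equal signatures keep
  every connector valid.\<close>

lemma assemble:
  assumes fin: "finite V" and E3: "\<And>e. e \<in> E \<Longrightarrow> card e = 3" and V6: "card V \<ge> 6" "even (card V)"
    and F: "Fs \<noteq> []" "distinct (concat Fs)" "set (concat Fs) \<subseteq> V"
      "\<And>F. F \<in> set Fs \<Longrightarrow> length F = 14 \<and> proper_walk E \<phi> (insert_path F) \<and> proper_walk E \<phi> (swap_path F)"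
    and hits: "\<And>x y. x \<in> V \<Longrightarrow> y \<in> V \<Longrightarrow> length (filter (absorbs E \<phi> x y) Fs) \<ge> h"
    and D: "D = concat (map (\<lambda>F. absorber_blocks F None) Fs)"
    and A: "length As = length D - 1" "distinct (concat As)" "set (concat As) \<subseteq> V - set (concat Fs)"
      "\<And>i. i < length As \<Longrightarrow> linked E \<phi> (last (D ! i)) (last_color \<phi> (D ! i)) (hd (D ! Suc i)) (head_color \<phi> (D ! Suc i)) (As ! i)"
    and P: "\<And>P. P \<in> set Ps \<Longrightarrow> proper_walk E \<phi> P \<and> edges P \<noteq> []" "distinct (concat Ps)"
      "set (concat Ps) \<subseteq> V - (set (concat Fs) \<union> set (concat As))"
    and L: "L = last D # Ps @ [hd D]"
    and Q: "length Qs = length L - 1" "distinct (concat Qs)"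
      "set (concat Qs) \<subseteq> V - (set (concat Fs) \<union> set (concat As) \<union> set (concat Ps))"
      "\<And>i. i < length Qs \<Longrightarrow> linked E \<phi> (last (L ! i)) (last_color \<phi> (L ! i)) (hd (L ! Suc i)) (head_color \<phi> (L ! Suc i)) (Qs ! i)"
    and cap: "card (V - (set (concat Fs) \<union> set (concat As) \<union> set (concat Ps) \<union> set (concat Qs))) \<le> 2 * h"
  shows "\<exists>C. loose_Hamilton_cycle V E C \<and> properly_colored C \<phi>"
proof -
  define W where "W = V - (set (concat Fs) \<union> set (concat As) \<union> set (concat Ps) \<union> set (concat Qs))"
  let ?B = "D @ Ps" and ?C = "As @ Qs"
  have D0: "D \<noteq> []" using F(1) unfolding D by (cases Fs) auto
  have mD: "mset (concat D) = mset (concat Fs)" unfolding D using F(4) by (intro mset_base_blocks) auto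
  have sD: "set (concat D) = set (concat Fs)" using mD by (metis set_mset_mset)
  have dD: "distinct (concat D)" using mD F(2) by (metis mset_eq_imp_distinct_iff)
  have Dp: "proper_walk E \<phi> B \<and> edges B \<noteq> []" if B: "B \<in> set D" for B
  proof -
    obtain F where F': "F \<in> set Fs" "B \<in> set (absorber_blocks F None)" using B unfolding D by auto
    then have "proper_walk E \<phi> B" using F(4) by auto
    then show ?thesis using edges_absorber_blocks[OF F'(2)] by blast
  qed
  have len: "length ?B = length ?C" using A(1) Q(1) D0 by (cases D) (auto simp: L)
  have L5: "length X = 5" if X: "X \<in> set ?C" for X
  proof -
    consider i where "i < length As" "X = As ! i" | i where "i < length Qs" "X = Qs ! i"
      using X by (auto simp: in_set_conv_nth)
    then show ?thesis using A(4) Q(4) by cases (auto simp: linked_def)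
  qed
  \<comment> \<open>The last block of \<open>D\<close> is also the first one of \<open>L\<close>, so
    that connector number \<open>length As + j\<close> of the cycle is
    \<open>Qs ! j\<close>.\<close>
  have BL: "?B @ [hd D] = butlast D @ L" using D0 by (simp add: L)
  have base: "linked E \<phi> (last (?B ! i)) (last_color \<phi> (?B ! i)) (hd ((?B @ [hd D]) ! Suc i)) (head_color \<phi> ((?B @ [hd D]) ! Suc i)) (?C ! i)"
    if i: "i < length ?C" for i
  proof (cases "i < length As")
    case True
    then have "i < length D" "Suc i < length D" using A(1) by auto
    then show ?thesis using A(4)[OF True] True by (simp add: nth_append)
  next
    case False
    then obtain j where j: "i = length As + j" "j < length Qs" using i by (metis add_diff_inverse_nat length_append nat_add_left_cancel_less)
    have la: "length As = length (butlast D)" using A(1) by simp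
    have iB: "i < length ?B" using i len by linarith
    have "?B ! i = (?B @ [hd D]) ! i" by (rule nth_append_left[OF iB, symmetric])
    also have "\<dots> = L ! j" unfolding BL j la by (rule nth_append_length_plus)
    finally have 1: "?B ! i = L ! j" .
    have 2: "(?B @ [hd D]) ! Suc i = L ! Suc j"
      unfolding BL j la add_Suc_right[symmetric] by (rule nth_append_length_plus)
    have 3: "?C ! i = Qs ! j" unfolding j by (rule nth_append_length_plus)
    show ?thesis unfolding 1 2 3 by (rule Q(4)[OF j(2)])
  qed
  have dB: "distinct (concat ?B)" using dD P(2,3) sD by auto
  have dC: "distinct (concat ?C)" using A(2) Q(2,3) by auto
  have BC: "set (concat ?B) \<inter> set (concat ?C) = {}" using sD A(3) P(3) Q(3) by auto
  have oddB: "odd (length B)" if "B \<in> set ?B" for B using that Dp P(1) by (auto simp: proper_walk_def)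
  \<comment> \<open>Parity: blocks and connectors have odd length and are equally many, so the cycle
    before absorption covers an even number of vertices and the leftover splits into pairs.\<close>
  have "even (length (weave ?B ?C))" using len oddB L5 by (intro length_weave) auto
  moreover have "distinct (weave ?B ?C)" using len dB dC BC by (rule distinct_weave)
  moreover have sw: "set (weave ?B ?C) = set (concat Fs) \<union> set (concat As) \<union> set (concat Ps) \<union> set (concat Qs)"
    using set_weave[OF len] sD by auto
  ultimately have "even (card (set (concat Fs) \<union> set (concat As) \<union> set (concat Ps) \<union> set (concat Qs)))"
    by (metis distinct_card)
  moreover have sub: "set (concat Fs) \<union> set (concat As) \<union> set (concat Ps) \<union> set (concat Qs) \<subseteq> V" using F(3) A(3) P(3) Q(3) by blast
  then have "card W = card V - card (set (concat Fs) \<union> set (concat As) \<union> set (concat Ps) \<union> set (concat Qs))"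
    unfolding W_def by (intro card_Diff_subset) auto
  ultimately have evW: "even (card W)" using V6 by simp
  have finW: "finite W" using fin by (simp add: W_def)
  obtain ps where ps: "distinct (pair_list ps)" "set (pair_list ps) = W" "2 * length ps = card W"
    by (rule pairing[OF finW evW])
  have hits': "length (filter (absorbs E \<phi> x y) Fs) \<ge> length ps" if xy: "(x, y) \<in> set ps" for x y
  proof -
    have "x \<in> W" "y \<in> W" using xy unfolding ps(2)[symmetric] pair_list_def by auto
    then have "length (filter (absorbs E \<phi> x y) Fs) \<ge> h" by (intro hits) (auto simp: W_def)
    moreover have "2 * length ps \<le> 2 * h" using cap ps(3) by (simp add: W_def)
    ultimately show ?thesis by linarith
  qed
  obtain os where os: "length os = length Fs"
     "mset (concat (concat (map2 absorber_blocks Fs os))) = mset (concat Fs) + mset (pair_list ps)"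
     "\<And>B. B \<in> set (concat (map2 absorber_blocks Fs os)) \<Longrightarrow> proper_walk E \<phi> B"
    using absorb_pairs[of Fs E \<phi> ps] F(4) hits' by blast
  define D' where "D' = concat (map2 absorber_blocks Fs os)"
  have sig: "map signature D' = map signature D" unfolding D'_def D by (rule signature_concat_blocks[OF os(1)])
  have D'0: "D' \<noteq> []" using sig D0 by auto
  have lD': "length D' = length D" using sig by (metis length_map)
  have D'p: "proper_walk E \<phi> B \<and> edges B \<noteq> []" if B: "B \<in> set D'" for B
  proof
    show "proper_walk E \<phi> B" using B os(3) by (simp add: D'_def)
    obtain F oo where "B \<in> set (absorber_blocks F oo)" using B by (auto simp: D'_def)
    then show "edges B \<noteq> []" by (rule edges_absorber_blocks)
  qed
  have "mset (concat D') = mset (concat Fs @ pair_list ps)" using os(2) by (simp add: D'_def)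
  moreover have "distinct (concat Fs @ pair_list ps)" using F(2) ps(1,2) by (auto simp: W_def)
  ultimately have dD': "distinct (concat D')" and sD': "set (concat D') = set (concat Fs) \<union> W"
    using ps(2) by (metis mset_eq_imp_distinct_iff, metis set_mset_mset set_append)
  let ?B' = "D' @ Ps"
  have len': "length ?B' = length ?C" using len lD' by simp
  have "signature (hd D') = signature (hd D)" using sig D0 D'0 by (metis hd_map)
  then have sigB: "map signature (?B' @ [hd D']) = map signature (?B @ [hd D])" using sig by simp
  have sigi: "signature ((?B' @ [hd D']) ! i) = signature ((?B @ [hd D]) ! i)" if "i < length (?B @ [hd D])" for i
    using sigB that lD' by (metis length_map nth_map)
  have link': "linked E \<phi> (last (?B' ! i)) (last_color \<phi> (?B' ! i)) (hd ((?B' @ [hd D']) ! Suc i)) (head_color \<phi> ((?B' @ [hd D']) ! Suc i)) (?C ! i)"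
    if i: "i < length ?C" for i
  proof (rule linked_signature[OF _ _ base[OF i]])
    have iB: "i < length ?B" "i < length ?B'" using i len len' by linarith+
    have eq: "(?B' @ [hd D']) ! i = ?B' ! i" "(?B @ [hd D]) ! i = ?B ! i"
      by (rule nth_append_left[OF iB(2)], rule nth_append_left[OF iB(1)])
    have "signature ((?B' @ [hd D']) ! i) = signature ((?B @ [hd D]) ! i)" using iB by (intro sigi) simp
    then show "signature (?B ! i) = signature (?B' ! i)" unfolding eq by (rule sym)
    have "signature ((?B' @ [hd D']) ! Suc i) = signature ((?B @ [hd D]) ! Suc i)" using iB by (intro sigi) simp
    then show "signature ((?B @ [hd D]) ! Suc i) = signature ((?B' @ [hd D']) ! Suc i)" by (rule sym)
  qed
  define vs where "vs = weave ?B' ?C"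
  have B'p: "proper_walk E \<phi> B \<and> edges B \<noteq> []" if "B \<in> set ?B'" for B using that D'p P(1) by auto
  have walk: "proper_walk E \<phi> (vs @ [hd (hd D')])" "hd (vs @ [hd (hd D')]) = hd (hd D')"
     "head_color \<phi> (vs @ [hd (hd D')]) = head_color \<phi> (hd D')" "last_color \<phi> (vs @ [hd (hd D')]) \<noteq> head_color \<phi> (hd D')"
    using proper_walk_weave[OF len' B'p link'] D'0 unfolding vs_def by auto
  have svs: "set vs = V"
  proof -
    have "set vs = set (concat ?B') \<union> set (concat ?C)" unfolding vs_def by (rule set_weave[OF len'])
    also have "\<dots> = (set (concat Fs) \<union> W) \<union> set (concat Ps) \<union> (set (concat As) \<union> set (concat Qs))"
      by (simp only: concat_append set_append sD')
    also have "\<dots> = V" using sub by (auto simp: W_def)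
    finally show ?thesis .
  qed
  have dvs: "distinct vs" unfolding vs_def
  proof (rule distinct_weave[OF len' _ dC])
    show "distinct (concat ?B')" using dD' sD' P(2,3) by (auto simp: W_def)
    have "set (concat ?B') = set (concat Fs) \<union> W \<union> set (concat Ps)" by (simp only: concat_append set_append sD')
    moreover have "set (concat ?C) = set (concat As) \<union> set (concat Qs)" by (simp only: concat_append set_append)
    ultimately show "set (concat ?B') \<inter> set (concat ?C) = {}"
      using A(3) P(3) Q(3) unfolding W_def by blast
  qed
  have lvs: "length vs = card V" using svs dvs distinct_card by metis
  then have "vs \<noteq> []" using V6 by auto
  then have "hd vs = hd (hd D')" using walk(2) by simp
  moreover have "length vs = 2 * (card V div 2)" "card V div 2 \<ge> 3" using lvs V6 by auto
  ultimately show ?thesis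
    using Hamilton_cycle_of_closed_walk[where vs = vs and m = "card V div 2", OF E3 dvs svs] walk by metis
qed

section \<open>Choice of the parameters\<close>

lemma hd_last_in:
  assumes "B \<in> set Bs" "B \<noteq> []" "set (concat Bs) \<subseteq> V"
  shows "hd B \<in> V \<and> last B \<in> V"
proof -
  have "set B \<subseteq> V" using assms(1,3) by auto
  then show ?thesis using hd_in_set[OF assms(2)] last_in_set[OF assms(2)] by blast
qed

text \<open>Separates the combinatorics from the arithmetic: \<open>k\<close> absorbers,
  \<open>m\<close> reservoir tuples, tiling paths of \<open>t\<close> edges that miss at most
  \<open>r\<close> vertices, and \<open>h\<close> pairs that can be absorbed. The absorbers have 14k
  vertices, and the connectors between their 2k blocks fewer than 10k, whence 24k.\<close>

lemma (in dense_coloring) Hamilton_cycle_of_tiling: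
  assumes c: "c \<le> 1 / 10 ^ 21" and V6: "card V \<ge> 6" "even (card V)"
    and K: "finite K" "\<phi> ` E \<subseteq> K" "K \<noteq> {}" and k1: "k \<ge> 1" and t1: "t \<ge> 1"
    and k: "(14 * (14 * real k) + 196) / n \<le> 35 / 10 ^ 21" "n\<^sup>2 \<le> exp (7 / 10 ^ 20 * real k / 8)"
      "(120 * real k + 25) / n < 1 / (2 * 10 ^ 6)"
    and m: "(5 * (24 * real k + 5 * real m) + 25) / n \<le> 1 / (4 * 10 ^ 6)"
      "n\<^sup>2 * (real (card K))\<^sup>2 \<le> exp (1 / (2 * 10 ^ 6) * real m / 8)"
      "5 * (n / real (2 * t + 1) + 2) < 1 / (2 * 10 ^ 6) * real m / 8"
    and tiling: "\<And>R. R \<subseteq> V \<Longrightarrow> card (V - R) \<le> 24 * k + 5 * m \<Longrightarrow>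
      \<exists>Ps. (\<forall>P\<in>set Ps. proper_walk E \<phi> P \<and> length P = 2 * t + 1) \<and> distinct (concat Ps) \<and>
        set (concat Ps) \<subseteq> R \<and> real (card (R - set (concat Ps))) \<le> r"
    and h: "5 * real m + r \<le> 2 * real h" "real h \<le> 7 / 10 ^ 20 * real k / 8"
  shows "\<exists>C. loose_Hamilton_cycle V E C \<and> properly_colored C \<phi>"
proof -
  have n0: "n > 0" using V0 by simp
  have c7: "c \<le> 1 / 10 ^ 7" by (rule order_trans[OF c]) simp
  obtain Fs where Fs: "length Fs = k" "distinct (concat Fs)" "set (concat Fs) \<subseteq> V"
    "\<And>F. F \<in> set Fs \<Longrightarrow> length F = 14 \<and> proper_walk E \<phi> (insert_path F) \<and> proper_walk E \<phi> (swap_path F)"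
    "\<And>x y. x \<in> V \<Longrightarrow> y \<in> V \<Longrightarrow> real (length (filter (absorbs E \<phi> x y) Fs)) \<ge> 7 / 10 ^ 20 * real k / 8"
    using absorbing_family[OF c k(1,2)] by blast
  have hits: "length (filter (absorbs E \<phi> x y) Fs) \<ge> h" if "x \<in> V" "y \<in> V" for x y
    using Fs(5)[OF that] h(2) by linarith
  have Fs0: "Fs \<noteq> []" using Fs(1) k1 by auto
  define D where "D = concat (map (\<lambda>F. absorber_blocks F None) Fs)"
  have "mset (concat D) = mset (concat Fs)" unfolding D_def using Fs(4) by (intro mset_base_blocks) auto
  then have sD: "set (concat D) = set (concat Fs)" by (metis set_mset_mset)
  have lD: "length D = 2 * k" unfolding D_def Fs(1)[symmetric] by (induction Fs) auto
  have DV: "hd B \<in> V \<and> last B \<in> V" if B: "B \<in> set D" for B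
  proof (rule hd_last_in[OF B])
    obtain F where "B \<in> set (absorber_blocks F None)" using B unfolding D_def by auto
    then have "edges B \<noteq> []" by (rule edges_absorber_blocks)
    then show "B \<noteq> []" by auto
  qed (use Fs(3) sD in simp)
  have "length (concat Fs) = length Fs * 14" using Fs(4) by (intro length_concat_const) auto
  then have cF: "card (set (concat Fs)) \<le> 14 * k" using card_length[of "concat Fs"] Fs(1) by simp
  have poolA: "\<exists>ws. linked E \<phi> u i v j ws \<and> distinct ws \<and> set ws \<subseteq> (V - set (concat Fs)) - W"
    if uv: "u \<in> V" "v \<in> V" and W: "finite W" "card W \<le> 5 * length D" for u i v j W
  proof -
    have "card (W \<union> set (concat Fs)) \<le> 24 * k" using card_Un_le[of W "set (concat Fs)"] W(2) cF lD by linarith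
    then have "5 * real (card (W \<union> set (concat Fs))) + 25 \<le> 120 * real k + 25" by linarith
    then have "(5 * real (card (W \<union> set (concat Fs))) + 25) / n \<le> (120 * real k + 25) / n"
      using n0 by (intro divide_right_mono) auto
    then have "(5 * real (card (W \<union> set (concat Fs))) + 25) / n < 1 / (2 * 10 ^ 6)" using k(3) by linarith
    then obtain ws where "linked E \<phi> u i v j ws" "distinct ws" "set ws \<subseteq> V - (W \<union> set (concat Fs))"
      using link_avoiding[OF c7 uv, of "W \<union> set (concat Fs)" i j] W(1) by auto
    then show ?thesis by blast
  qed
  obtain As where As: "length As = length D - 1" "distinct (concat As)" "set (concat As) \<subseteq> V - set (concat Fs)"
     "\<And>i. i < length As \<Longrightarrow> linked E \<phi> (last (D ! i)) (last_color \<phi> (D ! i)) (hd (D ! Suc i)) (head_color \<phi> (D ! Suc i)) (As ! i)"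
    using link_blocks[where S = V and C = "V - set (concat Fs)", OF poolA DV] by blast
  have "length X = 5" if X: "X \<in> set As" for X
    using X As(4) by (auto simp: in_set_conv_nth linked_def)
  then have "length (concat As) = length As * 5" by (intro length_concat_const) auto
  then have cA: "card (set (concat As)) \<le> 10 * k" using card_length[of "concat As"] As(1) lD by linarith
  define U where "U = set (concat Fs) \<union> set (concat As)"
  have cU: "card U \<le> 24 * k" unfolding U_def using card_Un_le[of "set (concat Fs)" "set (concat As)"] cF cA by linarith
  have UV: "U \<subseteq> V" using Fs(3) As(3) by (auto simp: U_def)
  have finU: "finite U" by (simp add: U_def)
  have "real (card U) \<le> real (24 * k)" using cU by (simp only: of_nat_le_iff)
  then have "5 * (real (card U) + 5 * real m) + 25 \<le> 5 * (24 * real k + 5 * real m) + 25" by simp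
  then have "(5 * (real (card U) + 5 * real m) + 25) / n \<le> (5 * (24 * real k + 5 * real m) + 25) / n"
    using n0 by (intro divide_right_mono) auto
  then have mU: "(5 * (real (card U) + 5 * real m) + 25) / n \<le> 1 / (4 * 10 ^ 6)" using m(1) by linarith
  obtain Q where Q: "Q \<subseteq> V" "Q \<inter> U = {}" "card Q \<le> 5 * m"
    "\<And>u i v j W. u \<in> V \<Longrightarrow> v \<in> V \<Longrightarrow> finite W \<Longrightarrow> real (card W) < 1 / (2 * 10 ^ 6) * real m / 8 \<Longrightarrow>
       \<exists>ws. linked E \<phi> u i v j ws \<and> distinct ws \<and> set ws \<subseteq> Q - W"
    using link_reservoir[OF c7 finU K mU m(2)] by blast
  define R where "R = V - (U \<union> Q)"
  have "V - R \<subseteq> U \<union> Q" by (auto simp: R_def)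
  moreover have finQ: "finite Q" using Q(1) fin by (rule finite_subset)
  ultimately have "card (V - R) \<le> card (U \<union> Q)" using finU by (intro card_mono) auto
  also have "\<dots> \<le> 24 * k + 5 * m" using card_Un_le[of U Q] cU Q(3) by linarith
  finally have "card (V - R) \<le> 24 * k + 5 * m" .
  moreover have RV: "R \<subseteq> V" by (auto simp: R_def)
  ultimately obtain Ps where Ps: "\<And>P. P \<in> set Ps \<Longrightarrow> proper_walk E \<phi> P \<and> length P = 2 * t + 1" "distinct (concat Ps)"
     "set (concat Ps) \<subseteq> R" "real (card (R - set (concat Ps))) \<le> r"
    using tiling[of R] by blast
  have PsE: "proper_walk E \<phi> P \<and> edges P \<noteq> []" if "P \<in> set Ps" for P
  proof -
    have "length (edges P) = t" using Ps(1)[OF that] by (simp add: length_edges)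
    then show ?thesis using Ps(1)[OF that] t1 by auto
  qed
  define L where "L = last D # Ps @ [hd D]"
  have D0: "D \<noteq> []" using lD k1 by auto
  have LV: "hd B \<in> V \<and> last B \<in> V" if B: "B \<in> set L" for B
  proof (cases "B \<in> set Ps")
    case True
    then have "B \<noteq> []" using Ps(1) by fastforce
    then show ?thesis using hd_last_in[OF True] Ps(3) RV by blast
  next
    case False
    then have "B \<in> set D" using B D0 by (auto simp: L_def)
    then show ?thesis by (rule DV)
  qed
  have "length (concat Ps) = length Ps * (2 * t + 1)" using Ps(1) by (intro length_concat_const) auto
  then have "length Ps * (2 * t + 1) = card (set (concat Ps))" using Ps(2) distinct_card by metis
  also have "\<dots> \<le> card V" using Ps(3) RV fin by (intro card_mono) auto
  finally have "real (length Ps * (2 * t + 1)) \<le> n" by (simp only: of_nat_le_iff)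
  then have "real (length Ps) * real (2 * t + 1) \<le> n" by (simp only: of_nat_mult)
  moreover have "real (2 * t + 1) > 0" by simp
  ultimately have "real (length Ps) \<le> n / real (2 * t + 1)" by (simp only: pos_le_divide_eq)
  then have lL: "5 * real (length L) \<le> 5 * (n / real (2 * t + 1) + 2)" by (simp add: L_def)
  have poolQ: "\<exists>ws. linked E \<phi> u i v j ws \<and> distinct ws \<and> set ws \<subseteq> Q - W"
    if uv: "u \<in> V" "v \<in> V" and W: "finite W" "card W \<le> 5 * length L" for u i v j W
  proof (rule Q(4)[OF uv W(1)])
    have "real (card W) \<le> 5 * real (length L)" using W(2) by linarith
    then show "real (card W) < 1 / (2 * 10 ^ 6) * real m / 8" using lL m(3) by linarith
  qed
  obtain Qs where Qs: "length Qs = length L - 1" "distinct (concat Qs)" "set (concat Qs) \<subseteq> Q"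
     "\<And>i. i < length Qs \<Longrightarrow> linked E \<phi> (last (L ! i)) (last_color \<phi> (L ! i)) (hd (L ! Suc i)) (head_color \<phi> (L ! Suc i)) (Qs ! i)"
    using link_blocks[where S = V and C = Q, OF poolQ LV] by blast
  have PV: "set (concat Ps) \<subseteq> V - (set (concat Fs) \<union> set (concat As))"
    using Ps(3) by (auto simp: R_def U_def)
  have QV: "set (concat Qs) \<subseteq> V - (set (concat Fs) \<union> set (concat As) \<union> set (concat Ps))"
    using Qs(3) Q(1,2) Ps(3) unfolding R_def U_def by blast
  have cap: "card (V - (set (concat Fs) \<union> set (concat As) \<union> set (concat Ps) \<union> set (concat Qs))) \<le> 2 * h"
  proof -
    have "V - (set (concat Fs) \<union> set (concat As) \<union> set (concat Ps) \<union> set (concat Qs)) \<subseteq> Q \<union> (R - set (concat Ps))"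
      by (auto simp: R_def U_def)
    then have "card (V - (set (concat Fs) \<union> set (concat As) \<union> set (concat Ps) \<union> set (concat Qs))) \<le> card (Q \<union> (R - set (concat Ps)))"
      using finQ fin RV by (intro card_mono) (auto intro: finite_subset)
    also have "\<dots> \<le> card Q + card (R - set (concat Ps))" by (rule card_Un_le)
    finally show ?thesis using Q(3) Ps(4) h(1) by linarith
  qed
  show ?thesis
    by (rule assemble[OF fin E3 V6 Fs0 Fs(2-4) hits D_def As PsE Ps(2) PV L_def Qs(1,2) QV Qs(4) cap])
qed

lemma nat_floor_bounds:
  fixes r :: real
  assumes "r \<ge> 0"
  shows "real (nat \<lfloor>r\<rfloor>) \<le> r" "real (nat \<lfloor>r\<rfloor>) \<ge> r - 1"
  using assms by (simp_all add: of_nat_nat floor_le_iff)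

lemma eventually_poly_le_exp:
  assumes "(a::real) > 0"
  shows "eventually (\<lambda>n::nat. (real n)\<^sup>2 * ((real n) ^ 3 + 1)\<^sup>2 \<le> exp (a * real n)) sequentially"
proof -
  have "(\<lambda>n::nat. (real n)\<^sup>2 * ((real n) ^ 3 + 1)\<^sup>2 / exp (a * real n)) \<longlonglongrightarrow> 0"
    using assms by real_asymp
  then have "eventually (\<lambda>n::nat. (real n)\<^sup>2 * ((real n) ^ 3 + 1)\<^sup>2 / exp (a * real n) < 1) sequentially"
    by (rule order_tendstoD) simp
  then show ?thesis by (rule eventually_mono) (simp add: pos_divide_less_eq)
qed

lemma Hamilton_cycle_links:
  fixes \<gamma> :: real
  assumes gam: "0 < \<gamma>" "\<gamma> \<le> 1"
  shows "\<exists>c>0. \<exists>n0. \<forall>(V :: 'a set) E \<phi>. finite V \<longrightarrow> even (card V) \<longrightarrow> card V \<ge> n0 \<longrightarrow>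
     (\<forall>e\<in>E. e \<subseteq> V \<and> card e = 3) \<longrightarrow>
     (\<forall>u\<in>V. real (card (link E V u)) \<ge> (7 / 16 + \<gamma>) * (real (card V))\<^sup>2) \<longrightarrow>
     (\<forall>u\<in>V. \<forall>i. real (card (color_link E \<phi> V u i)) \<le> c * (real (card V))\<^sup>2) \<longrightarrow>
     (\<exists>C. loose_Hamilton_cycle V E C \<and> properly_colored C \<phi>)"
proof -
  \<comment> \<open>Absorbers and reservoir take at most 25 \<eta> n vertices, which costs a link at
    most 50 \<eta> n^2 pairs; this has to stay below \<gamma> n^2 / 2.\<close>
  define \<eta> where "\<eta> = \<gamma> / 10 ^ 24"
  \<comment> \<open>A pair finds about 7/(8 * 10^20) of the absorbers suitable, and these must
    outnumber the pairs in a leftover of up to 7 \<zeta> n vertices.\<close>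
  define \<zeta> where "\<zeta> = \<eta> / 10 ^ 23"
  have eta: "0 < \<eta>" "\<eta> \<le> 1 / 10 ^ 24" using gam by (auto simp: \<eta>_def)
  have zeta: "0 < \<zeta>" "\<zeta> \<le> 1 / 10 ^ 47" using eta by (auto simp: \<zeta>_def)
  \<comment> \<open>The first summand keeps five times the number of tiling paths below m/(16 *
    10^6), the number of vertices that the reservoir can spare; the second is what
    \<open>path_tiling\<close> asks for with \<gamma>/2.\<close>
  define t where "t = nat \<lceil>10 ^ 9 / \<zeta> + 64 / (\<zeta> * \<gamma>)\<rceil>"
  have pos: "10 ^ 9 / \<zeta> > 0" "64 / (\<zeta> * \<gamma>) > 0" using zeta gam by auto
  then have t: "real t \<ge> 10 ^ 9 / \<zeta> + 64 / (\<zeta> * \<gamma>)" unfolding t_def by (intro real_nat_ceiling_ge)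
  have t64: "real t \<ge> 64 / (\<zeta> * \<gamma>)" and t9: "real t \<ge> 10 ^ 9 / \<zeta>" using t pos by linarith+
  have t1: "t \<ge> 1" using t9 pos by linarith
  have g2: "0 < \<gamma> / 2" "\<gamma> / 2 \<le> 1" using gam by auto
  have z1: "\<zeta> \<le> 1" by (rule order_trans[OF zeta(2)]) simp
  have "32 / (\<zeta> * (\<gamma> / 2)) = 64 / (\<zeta> * \<gamma>)" by simp
  then have tt: "real t \<ge> 32 / (\<zeta> * (\<gamma> / 2))" using t64 by simp
  obtain cT nT where cT: "cT > 0" and tile: "\<forall>(R :: 'a set) E \<phi>. finite R \<longrightarrow> card R \<ge> nT \<longrightarrow> (\<forall>e\<in>E. card e = 3) \<longrightarrow>
     (\<forall>u\<in>R. real (card (link E R u)) \<ge> (7 / 16 + \<gamma> / 2) * (real (card R))\<^sup>2) \<longrightarrow>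
     (\<forall>u\<in>R. \<forall>i. real (card (color_link E \<phi> R u i)) \<le> cT * (real (card R))\<^sup>2) \<longrightarrow>
     (\<exists>Ps. (\<forall>P\<in>set Ps. proper_walk E \<phi> P \<and> length P = 2 * t + 1) \<and> distinct (concat Ps) \<and>
        set (concat Ps) \<subseteq> R \<and> real (card (R - set (concat Ps))) \<le> 2 * \<zeta> * real (card R))"
    using path_tiling[OF g2 zeta(1) z1 tt, where 'a = 'a] by (elim exE conjE) (rule that)
  \<comment> \<open>The tiling takes place in a set of at least n/2 vertices, relative to which
    color degrees grow by a factor of at most 4.\<close>
  define c where "c = min (1 / 10 ^ 21) (cT / 4)"
  have c: "c > 0" "c \<le> 1 / 10 ^ 21" "c \<le> cT / 4" using cT by (auto simp: c_def)
  \<comment> \<open>Rounding down costs at most half of \<eta> n and of \<zeta> n, hence 16 instead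
    of 8: both exponents needed below are then at least a n.\<close>
  define a where "a = min (7 / 10 ^ 20 * \<eta> / 16) (1 / (2 * 10 ^ 6) * \<zeta> / 16)"
  have a: "a > 0" "a \<le> 7 / 10 ^ 20 * \<eta> / 16" "a \<le> 1 / (2 * 10 ^ 6) * \<zeta> / 16" using eta zeta by (auto simp: a_def)
  obtain nE where nE: "\<And>n::nat. n \<ge> nE \<Longrightarrow> (real n)\<^sup>2 * ((real n) ^ 3 + 1)\<^sup>2 \<le> exp (a * real n)"
    using eventually_poly_le_exp[OF a(1)] unfolding eventually_sequentially by auto
  define nB where "nB = nat \<lceil>10 ^ 12 / \<zeta>\<rceil>"
  have main: "\<exists>C. loose_Hamilton_cycle V E C \<and> properly_colored C \<phi>"
    if fin: "finite V" and even: "even (card V)" and large: "card V \<ge> 2 * nT + nE + nB"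
      and E: "\<forall>e\<in>E. e \<subseteq> V \<and> card e = 3"
      and degV: "\<forall>u\<in>V. real (card (link E V u)) \<ge> (7 / 16 + \<gamma>) * (real (card V))\<^sup>2"
      and colV: "\<forall>u\<in>V. \<forall>i. real (card (color_link E \<phi> V u i)) \<le> c * (real (card V))\<^sup>2"
    for V :: "'a set" and E \<phi>
  proof -
    define n where "n = real (card V)"
    have "10 ^ 12 / \<zeta> \<le> real nB" unfolding nB_def by (rule real_nat_ceiling_ge)
    also have "\<dots> \<le> n" using large by (simp add: n_def)
    finally have zn: "\<zeta> * n \<ge> 10 ^ 12" using zeta by (simp add: pos_divide_le_eq mult.commute)
    have n00: "n \<ge> 0" by (simp add: n_def)
    have "\<zeta> * n \<le> 1 / 10 ^ 47 * n" using zeta n00 by (intro mult_right_mono) auto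
    then have nbig: "n \<ge> 10 ^ 59" using zn by simp
    have en: "\<eta> * n = 10 ^ 23 * (\<zeta> * n)" by (simp add: \<zeta>_def)
    have enu: "\<eta> * n \<le> n / 10 ^ 24" using mult_right_mono[OF eta(2) n00] by simp
    define k where "k = nat \<lfloor>\<eta> * n\<rfloor>"
    define m where "m = nat \<lfloor>\<zeta> * n\<rfloor>"
    define x y where "x = real k" and "y = real m"
    have k: "x \<le> \<eta> * n" "x \<ge> \<eta> * n - 1" using zn en unfolding x_def k_def by (auto simp: of_nat_nat)
    have m: "y \<le> \<zeta> * n" "y \<ge> \<zeta> * n - 1" using zn unfolding y_def m_def by (auto simp: of_nat_nat)
    have zn': "\<zeta> * n \<ge> 1000000000000" using zn by simp
    have en': "\<eta> * n = 100000000000000000000000 * (\<zeta> * n)" using en by simp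
    have enu': "\<eta> * n \<le> n / 1000000000000000000000000" using enu by simp
    have nbig': "n \<ge> 100000000000000000000000000000000000000" by (rule order_trans[OF _ nbig]) simp
    have k2: "x \<ge> \<eta> * n / 2" using k zn' en' by linarith
    have m2: "y \<ge> \<zeta> * n / 2" using m zn' by linarith
    have n0: "n > 0" using nbig' by simp
    have "7 / 16 * n\<^sup>2 \<le> (7 / 16 + \<gamma>) * n\<^sup>2" using gam by (intro mult_right_mono) auto
    then interpret dense_coloring V E \<phi> c
      using fin n0 E degV colV by unfold_locales (auto simp: n_def intro: order_trans)
    have growth: "n\<^sup>2 * (n ^ 3 + 1)\<^sup>2 \<le> exp (a * n)" using nE[of "card V"] large by (simp add: n_def)
    have "1 \<le> (n ^ 3 + 1)\<^sup>2" using n00 by (intro one_le_power) simp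
    then have "n\<^sup>2 * 1 \<le> n\<^sup>2 * (n ^ 3 + 1)\<^sup>2" by (intro mult_left_mono) auto
    then have n1: "n\<^sup>2 \<le> n\<^sup>2 * (n ^ 3 + 1)\<^sup>2" by simp
    \<comment> \<open>0 is added so that \<open>K\<close> is nonempty even without edges.\<close>
    define K where "K = insert 0 (\<phi> ` E)"
    have "E \<subseteq> Pow V" using E by blast
    then have finE: "finite E" using fin by (meson finite_Pow_iff finite_subset)
    have "n \<ge> real 6" using nbig' by simp
    then have V6: "6 \<le> card V" unfolding n_def by (simp only: of_nat_le_iff)
    have cK: "real (card K) \<le> n ^ 3 + 1"
    proof -
      have "E \<subseteq> {S. S \<subseteq> V \<and> card S = 3}" using E by auto
      then have "card E \<le> card {S. S \<subseteq> V \<and> card S = 3}" using fin by (intro card_mono finite_card_subsets)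
      also have "\<dots> = card V choose 3" using fin by (rule n_subsets)
      also have "\<dots> \<le> card V ^ 3" using V6 by (intro binomial_le_pow) simp
      finally have "card E \<le> card V ^ 3" .
      moreover have "card K \<le> Suc (card (\<phi> ` E))" unfolding K_def using finE by (simp add: card_insert_if)
      moreover have "card (\<phi> ` E) \<le> card E" using finE by (rule card_image_le)
      ultimately have "card K \<le> card V ^ 3 + 1" by linarith
      then have "real (card K) \<le> real (card V ^ 3 + 1)" by (simp only: of_nat_le_iff)
      then show ?thesis by (simp add: n_def)
    qed
    define h where "h = nat \<lfloor>7 / 10 ^ 20 * real k / 8\<rfloor>"
    define z where "z = real h"
    have x0: "x \<ge> 0" by (simp add: x_def)
    have h: "z \<le> 7 / 10 ^ 20 * x / 8" "z \<ge> 7 / 10 ^ 20 * x / 8 - 1"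
      using nat_floor_bounds[of "7 / 10 ^ 20 * x / 8"] x0 unfolding z_def h_def x_def[symmetric] by auto
    show ?thesis
    proof (rule Hamilton_cycle_of_tiling[OF c(2) _ even, where K = K and k = k and t = t and m = m and r = "2 * \<zeta> * n" and h = h])
      show "6 \<le> card V" by (rule V6)
      show "finite K" "\<phi> ` E \<subseteq> K" "K \<noteq> {}" using finE by (auto simp: K_def)
      have "real k > 0" using k zn' en' unfolding x_def[symmetric] by linarith
      then show "k \<ge> 1" by simp
      show "t \<ge> 1" by (rule t1)
      show "(14 * (14 * real k) + 196) / real (card V) \<le> 35 / 10 ^ 21"
        unfolding n_def[symmetric] x_def[symmetric] y_def[symmetric] pos_divide_le_eq[OF n0] using k enu' nbig' by (simp, linarith)
      show "(120 * real k + 25) / real (card V) < 1 / (2 * 10 ^ 6)"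
        unfolding n_def[symmetric] x_def[symmetric] y_def[symmetric] pos_divide_less_eq[OF n0] using k enu' nbig' by (simp, linarith)
      show "(5 * (24 * real k + 5 * real m) + 25) / real (card V) \<le> 1 / (4 * 10 ^ 6)"
        unfolding n_def[symmetric] x_def[symmetric] y_def[symmetric] pos_divide_le_eq[OF n0] using k m en' enu' nbig' zn' by (simp, linarith)
      show "(real (card V))\<^sup>2 \<le> exp (7 / 10 ^ 20 * real k / 8)"
      proof -
        have "a * n \<le> 7 / 10 ^ 20 * \<eta> / 16 * n" using a n00 by (intro mult_right_mono) auto
        also have "\<dots> = 7 / 10 ^ 20 * (\<eta> * n / 2) / 8" by simp
        also have "\<dots> \<le> 7 / 10 ^ 20 * x / 8" using k2 by (intro divide_right_mono mult_left_mono) auto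
        finally have "exp (a * n) \<le> exp (7 / 10 ^ 20 * x / 8)" by simp
        then show ?thesis using growth n1 unfolding n_def[symmetric] x_def[symmetric] by linarith
      qed
      show "(real (card V))\<^sup>2 * (real (card K))\<^sup>2 \<le> exp (1 / (2 * 10 ^ 6) * real m / 8)"
      proof -
        have "a * n \<le> 1 / (2 * 10 ^ 6) * \<zeta> / 16 * n" using a n00 by (intro mult_right_mono) auto
        also have "\<dots> = 1 / (2 * 10 ^ 6) * (\<zeta> * n / 2) / 8" by simp
        also have "\<dots> \<le> 1 / (2 * 10 ^ 6) * y / 8" using m2 by (intro divide_right_mono mult_left_mono) auto
        finally have "exp (a * n) \<le> exp (1 / (2 * 10 ^ 6) * y / 8)" by simp
        moreover have "n\<^sup>2 * (real (card K))\<^sup>2 \<le> n\<^sup>2 * (n ^ 3 + 1)\<^sup>2"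
          using cK by (intro mult_left_mono power_mono) auto
        ultimately show ?thesis using growth unfolding n_def[symmetric] y_def[symmetric] by linarith
      qed
      show "5 * (real (card V) / real (2 * t + 1) + 2) < 1 / (2 * 10 ^ 6) * real m / 8"
      proof -
        have "10 ^ 9 / \<zeta> \<le> real (2 * t + 1)" using t9 by simp
        then have "n / real (2 * t + 1) \<le> n / (10 ^ 9 / \<zeta>)" using pos n00 by (intro divide_left_mono) auto
        also have "\<dots> = \<zeta> * n / 1000000000" by simp
        finally have "5 * (n / real (2 * t + 1) + 2) < y / 16000000" using m2 zn' by argo
        then show ?thesis unfolding n_def[symmetric] y_def[symmetric] by simp
      qed
      show "real h \<le> 7 / 10 ^ 20 * real k / 8" using h(1) unfolding x_def z_def .
      show "5 * real m + 2 * \<zeta> * n \<le> 2 * real h"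
      proof -
        have "z \<ge> 7 * x / 800000000000000000000 - 1" using h(2) by simp
        then show ?thesis unfolding y_def[symmetric] z_def[symmetric] using m k2 en' zn' by argo
      qed
      fix R assume RV: "R \<subseteq> V" and VR: "card (V - R) \<le> 24 * k + 5 * m"
      have finR: "finite R" using RV fin by (rule finite_subset)
      have "real (card (V - R)) \<le> real (24 * k + 5 * m)" using VR by (simp only: of_nat_le_iff)
      also have "\<dots> = 24 * x + 5 * y" by (simp add: x_def y_def)
      also have "\<dots> \<le> 25 * (\<eta> * n)" using k m en' zn' by linarith
      finally have VRe: "real (card (V - R)) \<le> 25 * (\<eta> * n)" .
      have "card (V - R) = card V - card R" using finR RV by (rule card_Diff_subset)
      moreover have cRV: "card R \<le> card V" using RV fin by (intro card_mono)
      ultimately have cR: "real (card R) = n - real (card (V - R))" by (simp add: n_def)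
      have cR2: "real (card R) \<ge> n / 2" using cR VRe enu' n00 by argo
      have cRn: "real (card R) \<le> n" using cRV by (simp add: n_def)
      have "2 * nT \<le> card V" using large by linarith
      then have "real (2 * nT) \<le> n" unfolding n_def by (simp only: of_nat_le_iff)
      then have "real nT \<le> real (card R)" using cR2 by simp
      then have nT: "card R \<ge> nT" by (simp only: of_nat_le_iff)
      have degR: "real (card (link E R u)) \<ge> (7 / 16 + \<gamma> / 2) * (real (card R))\<^sup>2" if u: "u \<in> R" for u
      proof -
        have "V - (V - R) = R" using RV by blast
        then have "card (link E V u) \<le> card (link E R u) + 2 * (\<Sum>a\<in>V - R. codeg_on E V u a)"
          using card_link_diff[OF fin, where T = "V - R" and E = E and u = u] by simp
        then have "real (card (link E V u)) \<le> real (card (link E R u) + 2 * (\<Sum>a\<in>V - R. codeg_on E V u a))"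
          by (simp only: of_nat_le_iff)
        also have "\<dots> = real (card (link E R u)) + 2 * (\<Sum>a\<in>V - R. real (codeg_on E V u a))" by simp
        also have "\<dots> \<le> real (card (link E R u)) + 2 * (\<Sum>a\<in>V - R. n)"
          unfolding n_def by (intro add_left_mono mult_left_mono sum_mono cod_le) auto
        also have "\<dots> = real (card (link E R u)) + 2 * (real (card (V - R)) * n)" by simp
        also have "\<dots> \<le> real (card (link E R u)) + 2 * (25 * (\<eta> * n) * n)"
          using VRe n00 by (intro add_left_mono mult_left_mono mult_right_mono) auto
        finally have "real (card (link E V u)) \<le> real (card (link E R u)) + 50 * \<eta> * n\<^sup>2" by (simp add: power2_eq_square)
        moreover have "real (card (link E V u)) \<ge> (7 / 16 + \<gamma>) * n\<^sup>2" using degV u RV by (auto simp: n_def)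
        moreover have "50 * \<eta> * n\<^sup>2 \<le> \<gamma> / 2 * n\<^sup>2" using gam by (intro mult_right_mono) (auto simp: \<eta>_def)
        ultimately have "(7 / 16 + \<gamma> / 2) * n\<^sup>2 \<le> real (card (link E R u))" by (simp add: algebra_simps)
        moreover have "(7 / 16 + \<gamma> / 2) * (real (card R))\<^sup>2 \<le> (7 / 16 + \<gamma> / 2) * n\<^sup>2"
          using cRn gam by (intro mult_left_mono power_mono) auto
        ultimately show ?thesis by linarith
      qed
      have colR: "real (card (color_link E \<phi> R u i)) \<le> cT * (real (card R))\<^sup>2" if u: "u \<in> R" for u i
      proof -
        have "card (color_link E \<phi> R u i) \<le> card (color_link E \<phi> V u i)" using RV fin by (intro card_mono color_link_mono finite_color_link)
        then have "real (card (color_link E \<phi> R u i)) \<le> real (card (color_link E \<phi> V u i))" by (simp only: of_nat_le_iff)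
        also have "\<dots> \<le> c * n\<^sup>2" using colV u RV unfolding n_def by blast
        also have "c * n\<^sup>2 \<le> cT / 4 * n\<^sup>2" using c by (intro mult_right_mono) auto
        also have "\<dots> = cT * (n / 2)\<^sup>2" by (simp add: power_divide)
        also have "\<dots> \<le> cT * (real (card R))\<^sup>2" using cT cR2 n00 by (intro mult_left_mono power_mono) auto
        finally show ?thesis .
      qed
      have "\<exists>Ps. (\<forall>P\<in>set Ps. proper_walk E \<phi> P \<and> length P = 2 * t + 1) \<and> distinct (concat Ps) \<and>
        set (concat Ps) \<subseteq> R \<and> real (card (R - set (concat Ps))) \<le> 2 * \<zeta> * real (card R)"
        by (rule tile[rule_format, OF finR nT _ degR colR]) (use E in blast)
      then obtain Ps where Ps: "(\<forall>P\<in>set Ps. proper_walk E \<phi> P \<and> length P = 2 * t + 1)" "distinct (concat Ps)"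
        "set (concat Ps) \<subseteq> R" "real (card (R - set (concat Ps))) \<le> 2 * \<zeta> * real (card R)"
        by (elim exE conjE) (rule that)
      moreover have "2 * \<zeta> * real (card R) \<le> 2 * \<zeta> * n" using cRn zeta by (intro mult_left_mono) auto
      ultimately show "\<exists>Ps. (\<forall>P\<in>set Ps. proper_walk E \<phi> P \<and> length P = 2 * t + 1) \<and> distinct (concat Ps) \<and>
        set (concat Ps) \<subseteq> R \<and> real (card (R - set (concat Ps))) \<le> 2 * \<zeta> * n"
        using Ps by (intro exI[of _ Ps] conjI) linarith+
    qed
  qed
  show ?thesis using c(1) main by blast
qed

theorem theorem1p4:
  fixes \<gamma> :: real
  assumes "\<gamma> > 0"
  shows "\<exists>c::real. c > 0 \<and> (\<exists>n0::nat. n0 > 0 \<and>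
    (\<forall>(V :: 'a set) (E :: 'a set set) (\<phi> :: 'a set \<Rightarrow> nat) (n :: nat).
       uniform_hypergraph 3 V E \<and> card V = n \<and> 2 dvd n \<and> n \<ge> n0 \<and>
       real (min_deg 1 V E) \<ge> (7 / 16 + \<gamma>) * (real n)\<^sup>2 / 2 \<and>
       (\<forall>i. real (max_deg 1 V (color_class E \<phi> i)) \<le> c * (real n)\<^sup>2) \<longrightarrow>
       (\<exists>C. loose_Hamilton_cycle V E C \<and> properly_colored C \<phi>)))"
proof -
  \<comment> \<open>The choice of parameters assumes a surplus of at most 1; a larger one contains
    this case.\<close>
  define g where "g = min \<gamma> 1"
  have g: "0 < g" "g \<le> 1" "g \<le> \<gamma>" using assms by (auto simp: g_def)
  obtain c n0 where c: "c > 0" and main: "\<forall>(V :: 'a set) E \<phi>. finite V \<longrightarrow> even (card V) \<longrightarrow> card V \<ge> n0 \<longrightarrow>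
     (\<forall>e\<in>E. e \<subseteq> V \<and> card e = 3) \<longrightarrow>
     (\<forall>u\<in>V. real (card (link E V u)) \<ge> (7 / 16 + g) * (real (card V))\<^sup>2) \<longrightarrow>
     (\<forall>u\<in>V. \<forall>i. real (card (color_link E \<phi> V u i)) \<le> c * (real (card V))\<^sup>2) \<longrightarrow>
     (\<exists>C. loose_Hamilton_cycle V E C \<and> properly_colored C \<phi>)"
    using Hamilton_cycle_links[OF g(1,2), where 'a = 'a] by (elim exE conjE) (rule that)
  have "\<exists>C. loose_Hamilton_cycle V E C \<and> properly_colored C \<phi>"
    if H: "uniform_hypergraph 3 V E \<and> card V = n \<and> 2 dvd n \<and> n \<ge> n0 + 1 \<and>
       real (min_deg 1 V E) \<ge> (7 / 16 + \<gamma>) * (real n)\<^sup>2 / 2 \<and>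
       (\<forall>i. real (max_deg 1 V (color_class E \<phi> i)) \<le> c / 2 * (real n)\<^sup>2)"
    for V :: "'a set" and E \<phi> n
  proof (rule main[THEN spec, THEN spec, THEN spec, THEN mp, THEN mp, THEN mp, THEN mp, THEN mp, THEN mp])
    have fin: "finite V" and E: "\<And>e. e \<in> E \<Longrightarrow> e \<subseteq> V \<and> card e = 3"
      using H by (auto simp: uniform_hypergraph_def)
    show "finite V" by (rule fin)
    show "even (card V)" "card V \<ge> n0" "\<forall>e\<in>E. e \<subseteq> V \<and> card e = 3" using H E by auto
    show "\<forall>u\<in>V. real (card (link E V u)) \<ge> (7 / 16 + g) * (real (card V))\<^sup>2"
    proof
      fix u assume u: "u \<in> V"
      have "(7 / 16 + g) * (real (card V))\<^sup>2 \<le> (7 / 16 + \<gamma>) * (real n)\<^sup>2" using H g by (intro mult_mono) auto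
      also have "\<dots> \<le> 2 * real (min_deg 1 V E)" using H by simp
      also have "\<dots> \<le> 2 * real (deg E {u})" using min_deg_le[OF fin u, of E] by simp
      also have "\<dots> = real (card (link E V u))" using card_link_deg[OF fin E, where v = u] by simp
      finally show "(7 / 16 + g) * (real (card V))\<^sup>2 \<le> real (card (link E V u))" .
    qed
    show "\<forall>u\<in>V. \<forall>i. real (card (color_link E \<phi> V u i)) \<le> c * (real (card V))\<^sup>2"
    proof (intro ballI allI)
      fix u i assume u: "u \<in> V"
      have "card (color_link E \<phi> V u i) = 2 * deg (color_class E \<phi> i) {u}"
        unfolding color_link_color_class using E by (intro card_link_deg[OF fin]) (auto simp: color_class_def)
      then have "real (card (color_link E \<phi> V u i)) = 2 * real (deg (color_class E \<phi> i) {u})" by simp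
      also have "\<dots> \<le> 2 * real (max_deg 1 V (color_class E \<phi> i))" using max_deg_ge[OF fin u] by simp
      also have "\<dots> \<le> 2 * (c / 2 * (real n)\<^sup>2)" using H by (intro mult_left_mono) auto
      also have "\<dots> = c * (real (card V))\<^sup>2" using H by simp
      finally show "real (card (color_link E \<phi> V u i)) \<le> c * (real (card V))\<^sup>2" .
    qed
  qed
  \<comment> \<open>Color links count ordered pairs, hence c/2; the increment makes the bound on n
    positive.\<close>
  then show ?thesis using c by (intro exI[of _ "c / 2"] conjI exI[of _ "n0 + 1"]) auto
qed

end
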